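(* The functor $V\mapsto \mathfrak{F}\otimes_{\mathbb{Q}}V$, where $\mathfrak{F}$ is the Fermionic Fock space, is an equivalence from the abelian category of $\mathbb{Q}$-vector spaces to the abelian category of graded admissible $\mathcal{C}$-modules; and the functor $V\mapsto B\otimes_{\mathbb{Q}}V$, where $B$ is the Bosonic Fock space, is an equivalence from the abelian category of $\mathbb{Q}$-vector spaces to the abelian category of admissible $\mathcal{H}$-modules.
   Context: $\mathcal{H}$ (Heisenberg algebra): the $\mathbb{Q}$-algebra generated by $H_i$, $i\in\mathbb{Z}\setminus\{0\}$, with $[H_i,H_j]=i\,\delta_{i,-j}$. $\mathcal{C}$ (Clifford algebra): the $\mathbb{Q}$-algebra generated by $P_i,Q_i$, $i\in\mathbb{Z}_{>0}$, with $\{P_i,P_j\}=\{Q_i,Q_j\}=0$, $\{P_i,Q_j\}=\delta_{ij}$, where $\{a,b\}=ab+ba$. $\mathfrak{F}$ is the exterior algebra on $\bigoplus_{i>0}\mathbb{Q}x_i$, with $x_i$ of degree $1$; $P_i$ acts by left wedging with $x_i$ and $Q_i$ by $\partial/\partial x_i$. $B=\mathbb{Q}[y_1,y_2,\dots]$; for $k>0$, $H_k$ acts by multiplication by $y_k$ and $H_{-k}$ by $-k\,\partial/\partial y_k$. Graded $\mathcal{C}$-modules have $P_i$ of degree $1$ and $Q_i$ of degree $-1$; morphisms preserve the grading. A graded $\mathcal{C}$-module $W=\bigoplus_{i\ge0}W_i$ is admissible if (1) for every $x\in W$, $Q_mx=0$ for $m\gg0$, and (2) $W_0=\bigcap_{i>0}\ker(Q_i)$.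 For a sequence $\lambda=(n_1,n_2,\dots)$ of non-negative integers, almost all zero, put $|\lambda|=\sum_i i\,n_i$ and $H_{-\lambda}=\prod_iH_{-i}^{n_i}$. An $\mathcal{H}$-module $W$ is admissible if for every $x\in W$ there is $N>0$ with $H_{-\lambda}x=0$ for all $|\lambda|>N$. *)

theory Defs
  imports
    "HOL-Algebra.Module"
    "HOL-Library.FuncSet"
    "HOL-Library.Poly_Mapping"
    "HOL-Library.Equipollence"
begin

section \<open>Categories, functors, equivalences, abelian categories\<close>

text \<open>
  Hom-sets of distinct pairs of objects need not be disjoint, so composition and the action of
  a functor on morphisms take the objects as arguments: \<open>Comp C X Y Z g f\<close> is the composite of
  \<open>f : X \<rightarrow> Y\<close> and \<open>g : Y \<rightarrow> Z\<close>.
\<close>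

record ('o, 'm) cat =
  Obj :: "'o set"
  Hom :: "'o \<Rightarrow> 'o \<Rightarrow> 'm set"
  Id :: "'o \<Rightarrow> 'm"
  Comp :: "'o \<Rightarrow> 'o \<Rightarrow> 'o \<Rightarrow> 'm \<Rightarrow> 'm \<Rightarrow> 'm"

definition category :: "('o, 'm) cat \<Rightarrow> bool" where
  "category C \<longleftrightarrow>
     (\<forall>X\<in>Obj C. Id C X \<in> Hom C X X) \<and>
     (\<forall>X\<in>Obj C. \<forall>Y\<in>Obj C. \<forall>Z\<in>Obj C. \<forall>f\<in>Hom C X Y. \<forall>g\<in>Hom C Y Z.
        Comp C X Y Z g f \<in> Hom C X Z) \<and>
     (\<forall>X\<in>Obj C. \<forall>Y\<in>Obj C. \<forall>f\<in>Hom C X Y.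
        Comp C X X Y f (Id C X) = f \<and> Comp C X Y Y (Id C Y) f = f) \<and>
     (\<forall>X\<in>Obj C. \<forall>Y\<in>Obj C. \<forall>Z\<in>Obj C. \<forall>T\<in>Obj C.
        \<forall>f\<in>Hom C X Y. \<forall>g\<in>Hom C Y Z. \<forall>h\<in>Hom C Z T.
          Comp C X Y T (Comp C Y Z T h g) f = Comp C X Z T h (Comp C X Y Z g f))"

definition op_cat :: "('o, 'm) cat \<Rightarrow> ('o, 'm) cat" where
  "op_cat C = \<lparr>Obj = Obj C, Hom = (\<lambda>X Y. Hom C Y X), Id = Id C,
                Comp = (\<lambda>X Y Z g f. Comp C Z Y X f g)\<rparr>"

definition iso_mor :: "('o, 'm) cat \<Rightarrow> 'o \<Rightarrow> 'o \<Rightarrow> 'm \<Rightarrow> bool" where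
  "iso_mor C X Y f \<longleftrightarrow> f \<in> Hom C X Y \<and>
     (\<exists>g\<in>Hom C Y X. Comp C X Y X g f = Id C X \<and> Comp C Y X Y f g = Id C Y)"

definition mono_mor :: "('o, 'm) cat \<Rightarrow> 'o \<Rightarrow> 'o \<Rightarrow> 'm \<Rightarrow> bool" where
  "mono_mor C X Y f \<longleftrightarrow> f \<in> Hom C X Y \<and>
     (\<forall>T\<in>Obj C. \<forall>g\<in>Hom C T X. \<forall>h\<in>Hom C T X. Comp C T X Y f g = Comp C T X Y f h \<longrightarrow> g = h)"

definition zero_object :: "('o, 'm) cat \<Rightarrow> 'o \<Rightarrow> bool" where
  "zero_object C Z \<longleftrightarrow> Z \<in> Obj C \<and>
     (\<forall>X\<in>Obj C. (\<exists>!f. f \<in> Hom C X Z) \<and> (\<exists>!f. f \<in> Hom C Z X))"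

definition zero_mor :: "('o, 'm) cat \<Rightarrow> 'o \<Rightarrow> 'o \<Rightarrow> 'm \<Rightarrow> bool" where
  "zero_mor C X Y f \<longleftrightarrow>
     (\<exists>Z g h. zero_object C Z \<and> g \<in> Hom C X Z \<and> h \<in> Hom C Z Y \<and> f = Comp C X Z Y h g)"

definition is_product :: "('o, 'm) cat \<Rightarrow> 'o \<Rightarrow> 'o \<Rightarrow> 'o \<Rightarrow> 'm \<Rightarrow> 'm \<Rightarrow> bool" where
  "is_product C X Y P p q \<longleftrightarrow> P \<in> Obj C \<and> p \<in> Hom C P X \<and> q \<in> Hom C P Y \<and>
     (\<forall>T\<in>Obj C. \<forall>f\<in>Hom C T X. \<forall>g\<in>Hom C T Y.
        \<exists>!u. u \<in> Hom C T P \<and> Comp C T P X p u = f \<and> Comp C T P Y q u = g)"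

definition is_kernel :: "('o, 'm) cat \<Rightarrow> 'o \<Rightarrow> 'o \<Rightarrow> 'm \<Rightarrow> 'o \<Rightarrow> 'm \<Rightarrow> bool" where
  "is_kernel C X Y f K k \<longleftrightarrow> K \<in> Obj C \<and> k \<in> Hom C K X \<and> zero_mor C K Y (Comp C K X Y f k) \<and>
     (\<forall>T\<in>Obj C. \<forall>g\<in>Hom C T X. zero_mor C T Y (Comp C T X Y f g) \<longrightarrow>
        (\<exists>!u. u \<in> Hom C T K \<and> Comp C T K X k u = g))"

definition products_kernels_normal :: "('o, 'm) cat \<Rightarrow> bool" where
  "products_kernels_normal C \<longleftrightarrow>
     (\<forall>X\<in>Obj C. \<forall>Y\<in>Obj C. \<exists>P p q. is_product C X Y P p q) \<and>
     (\<forall>X\<in>Obj C. \<forall>Y\<in>Obj C. \<forall>f\<in>Hom C X Y. \<exists>K k. is_kernel C X Y f K k) \<and>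
     (\<forall>X\<in>Obj C. \<forall>Y\<in>Obj C. \<forall>f. mono_mor C X Y f \<longrightarrow>
        (\<exists>Z\<in>Obj C. \<exists>g\<in>Hom C Y Z. is_kernel C Y Z g X f))"

text \<open>
  Freyd's definition of an abelian category: a zero object, binary products and coproducts,
  kernels and cokernels, every monomorphism a kernel, every epimorphism a cokernel.  The
  additive structure on the Hom-sets is determined by these data, and every equivalence
  between abelian categories is additive and exact.
\<close>

definition abelian_category :: "('o, 'm) cat \<Rightarrow> bool" where
  "abelian_category C \<longleftrightarrow> category C \<and> (\<exists>Z. zero_object C Z) \<and>
     products_kernels_normal C \<and> products_kernels_normal (op_cat C)"

record ('o, 'm, 'p, 'n) cat_functor =
  obj_map :: "'o \<Rightarrow> 'p"
  mor_map :: "'o \<Rightarrow> 'o \<Rightarrow> 'm \<Rightarrow> 'n"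

definition is_functor :: "('o, 'm) cat \<Rightarrow> ('p, 'n) cat \<Rightarrow> ('o, 'm, 'p, 'n) cat_functor \<Rightarrow> bool" where
  "is_functor C D F \<longleftrightarrow>
     (\<forall>X\<in>Obj C. obj_map F X \<in> Obj D) \<and>
     (\<forall>X\<in>Obj C. \<forall>Y\<in>Obj C. \<forall>f\<in>Hom C X Y.
        mor_map F X Y f \<in> Hom D (obj_map F X) (obj_map F Y)) \<and>
     (\<forall>X\<in>Obj C. mor_map F X X (Id C X) = Id D (obj_map F X)) \<and>
     (\<forall>X\<in>Obj C. \<forall>Y\<in>Obj C. \<forall>Z\<in>Obj C. \<forall>f\<in>Hom C X Y. \<forall>g\<in>Hom C Y Z.
        mor_map F X Z (Comp C X Y Z g f) =
          Comp D (obj_map F X) (obj_map F Y) (obj_map F Z) (mor_map F Y Z g) (mor_map F X Y f))"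

definition id_functor :: "('o, 'm, 'o, 'm) cat_functor" where
  "id_functor = \<lparr>obj_map = (\<lambda>X. X), mor_map = (\<lambda>X Y f. f)\<rparr>"

definition comp_functor ::
  "('p, 'n, 'q, 'r) cat_functor \<Rightarrow> ('o, 'm, 'p, 'n) cat_functor \<Rightarrow> ('o, 'm, 'q, 'r) cat_functor"
where
  "comp_functor G F = \<lparr>obj_map = (\<lambda>X. obj_map G (obj_map F X)),
     mor_map = (\<lambda>X Y f. mor_map G (obj_map F X) (obj_map F Y) (mor_map F X Y f))\<rparr>"

definition natural_iso :: "('o, 'm) cat \<Rightarrow> ('p, 'n) cat \<Rightarrow>
    ('o, 'm, 'p, 'n) cat_functor \<Rightarrow> ('o, 'm, 'p, 'n) cat_functor \<Rightarrow> ('o \<Rightarrow> 'n) \<Rightarrow> bool" where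
  "natural_iso C D F G \<tau> \<longleftrightarrow>
     (\<forall>X\<in>Obj C. iso_mor D (obj_map F X) (obj_map G X) (\<tau> X)) \<and>
     (\<forall>X\<in>Obj C. \<forall>Y\<in>Obj C. \<forall>f\<in>Hom C X Y.
        Comp D (obj_map F X) (obj_map G X) (obj_map G Y) (mor_map G X Y f) (\<tau> X) =
        Comp D (obj_map F X) (obj_map F Y) (obj_map G Y) (\<tau> Y) (mor_map F X Y f))"

definition equivalence_of_categories ::
  "('o, 'm) cat \<Rightarrow> ('p, 'n) cat \<Rightarrow> ('o, 'm, 'p, 'n) cat_functor \<Rightarrow> bool" where
  "equivalence_of_categories C D F \<longleftrightarrow> category C \<and> category D \<and> is_functor C D F \<and>
     (\<exists>G \<eta> \<epsilon>. is_functor D C G \<and>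
        natural_iso C C id_functor (comp_functor G F) \<eta> \<and>
        natural_iso D D (comp_functor F G) id_functor \<epsilon>)"


section \<open>Rational vector spaces\<close>

definition rat_field :: "rat ring" where
  "rat_field = \<lparr>carrier = UNIV, mult = (*), one = 1, zero = 0, add = (+)\<rparr>"

abbreviation rat_vector_space :: "(rat, 'v, 'c) module_scheme \<Rightarrow> bool" where
  "rat_vector_space V \<equiv> Module.module rat_field V"

definition linear_map ::
  "(rat, 'v, 'c) module_scheme \<Rightarrow> (rat, 'w, 'd) module_scheme \<Rightarrow> ('v \<Rightarrow> 'w) \<Rightarrow> bool" where
  "linear_map V W f \<longleftrightarrow> f \<in> carrier V \<rightarrow> carrier W \<and>
     (\<forall>x\<in>carrier V. \<forall>y\<in>carrier V. f (x \<oplus>\<^bsub>V\<^esub> y) = f x \<oplus>\<^bsub>W\<^esub> f y) \<and>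
     (\<forall>c. \<forall>x\<in>carrier V. f (c \<odot>\<^bsub>V\<^esub> x) = c \<odot>\<^bsub>W\<^esub> f x)"

text \<open>
  Morphisms are extensional (equal to \<open>undefined\<close> off the carrier), so that equality of
  morphisms is equality on the carrier.

  The set \<open>U\<close> is a size bound playing the role of a universe: the objects are the structures
  whose carrier injects into \<open>U\<close>.
\<close>

definition linear_maps ::
  "(rat, 'v, 'c) module_scheme \<Rightarrow> (rat, 'w, 'd) module_scheme \<Rightarrow> ('v \<Rightarrow> 'w) set" where
  "linear_maps V W = {f \<in> extensional (carrier V). linear_map V W f}"

definition vect_cat :: "'u set \<Rightarrow> ((rat, 'v) module, 'v \<Rightarrow> 'v) cat" where
  "vect_cat U = \<lparr>Obj = {V. rat_vector_space V \<and> carrier V \<lesssim> U},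
     Hom = linear_maps,
     Id = (\<lambda>V. \<lambda>x\<in>carrier V. x),
     Comp = (\<lambda>V V' V'' g f. compose (carrier V) g f)\<rparr>"


section \<open>Tensor products over the rationals\<close>

text \<open>
  The tensor product is the free vector space on \<open>carrier M \<times> carrier N\<close> modulo the subspace
  spanned by the bilinearity relations; its elements are cosets.
\<close>

definition pm_scale :: "rat \<Rightarrow> ('b \<Rightarrow>\<^sub>0 rat) \<Rightarrow> ('b \<Rightarrow>\<^sub>0 rat)" where
  "pm_scale c p = Poly_Mapping.map (\<lambda>a. c * a) p"

type_synonym ('m, 'n) tensor = "(('m \<times> 'n) \<Rightarrow>\<^sub>0 rat) set"

definition tensor_free ::
  "(rat, 'm, 'c) module_scheme \<Rightarrow> (rat, 'n, 'd) module_scheme \<Rightarrow> (('m \<times> 'n) \<Rightarrow>\<^sub>0 rat) set" where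
  "tensor_free M N = {p. Poly_Mapping.keys p \<subseteq> carrier M \<times> carrier N}"

inductive_set tensor_null ::
  "(rat, 'm, 'c) module_scheme \<Rightarrow> (rat, 'n, 'd) module_scheme \<Rightarrow> (('m \<times> 'n) \<Rightarrow>\<^sub>0 rat) set"
  for M :: "(rat, 'm, 'c) module_scheme" and N :: "(rat, 'n, 'd) module_scheme"
where
  null_zero: "0 \<in> tensor_null M N"
| null_add: "p \<in> tensor_null M N \<Longrightarrow> q \<in> tensor_null M N \<Longrightarrow> p + q \<in> tensor_null M N"
| null_scale: "p \<in> tensor_null M N \<Longrightarrow> pm_scale c p \<in> tensor_null M N"
| null_add_left: "m \<in> carrier M \<Longrightarrow> m' \<in> carrier M \<Longrightarrow> n \<in> carrier N \<Longrightarrow>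
    Poly_Mapping.single (m \<oplus>\<^bsub>M\<^esub> m', n) 1 - Poly_Mapping.single (m, n) 1
      - Poly_Mapping.single (m', n) 1 \<in> tensor_null M N"
| null_add_right: "m \<in> carrier M \<Longrightarrow> n \<in> carrier N \<Longrightarrow> n' \<in> carrier N \<Longrightarrow>
    Poly_Mapping.single (m, n \<oplus>\<^bsub>N\<^esub> n') 1 - Poly_Mapping.single (m, n) 1
      - Poly_Mapping.single (m, n') 1 \<in> tensor_null M N"
| null_scale_left: "m \<in> carrier M \<Longrightarrow> n \<in> carrier N \<Longrightarrow>
    Poly_Mapping.single (c \<odot>\<^bsub>M\<^esub> m, n) 1 - Poly_Mapping.single (m, n) c \<in> tensor_null M N"
| null_scale_right: "m \<in> carrier M \<Longrightarrow> n \<in> carrier N \<Longrightarrow>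
    Poly_Mapping.single (m, c \<odot>\<^bsub>N\<^esub> n) 1 - Poly_Mapping.single (m, n) c \<in> tensor_null M N"

definition tensor_class :: "(rat, 'm, 'c) module_scheme \<Rightarrow> (rat, 'n, 'd) module_scheme \<Rightarrow>
    (('m \<times> 'n) \<Rightarrow>\<^sub>0 rat) \<Rightarrow> ('m, 'n) tensor" where
  "tensor_class M N p = {q. q - p \<in> tensor_null M N}"

text \<open>
  Operations on cosets are unions over all representatives; these give equal cosets, so each
  union is a single coset.  The ring multiplication and unit of the \<open>module\<close> record are not
  part of a vector space structure.
\<close>

definition tensor_prod :: "(rat, 'm, 'c) module_scheme \<Rightarrow> (rat, 'n, 'd) module_scheme \<Rightarrow>
    (rat, ('m, 'n) tensor) module" where
  "tensor_prod M N = \<lparr>carrier = tensor_class M N ` tensor_free M N,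
     mult = undefined, one = undefined,
     zero = tensor_class M N 0,
     add = (\<lambda>X Y. \<Union>p\<in>X. \<Union>q\<in>Y. tensor_class M N (p + q)),
     smult = (\<lambda>c X. \<Union>p\<in>X. tensor_class M N (pm_scale c p))\<rparr>"

definition free_map :: "('b \<Rightarrow> 'd) \<Rightarrow> ('b \<Rightarrow>\<^sub>0 rat) \<Rightarrow> ('d \<Rightarrow>\<^sub>0 rat)" where
  "free_map h p =
     (\<Sum>k\<in>Poly_Mapping.keys p. Poly_Mapping.single (h k) (Poly_Mapping.lookup p k))"

text \<open>\<open>tensor_map M N M' N' f g\<close> is \<open>f \<otimes> g : M \<otimes> N \<rightarrow> M' \<otimes> N'\<close>.\<close>

definition tensor_map ::
  "(rat, 'm, 'c) module_scheme \<Rightarrow> (rat, 'n, 'd) module_scheme \<Rightarrow>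
   (rat, 'm2, 'c2) module_scheme \<Rightarrow> (rat, 'n2, 'd2) module_scheme \<Rightarrow>
   ('m \<Rightarrow> 'm2) \<Rightarrow> ('n \<Rightarrow> 'n2) \<Rightarrow> ('m, 'n) tensor \<Rightarrow> ('m2, 'n2) tensor" where
  "tensor_map M N M' N' f g =
     (\<lambda>X\<in>carrier (tensor_prod M N). \<Union>p\<in>X. tensor_class M' N' (free_map (map_prod f g) p))"


section \<open>Graded Clifford modules\<close>

text \<open>
  A module over the algebra given by generators and relations is a vector space with one linear
  operator for each generator such that the operators satisfy the relations.  Generators are
  indexed by \<open>i > 0\<close>; the values of \<open>cliff_P\<close> and \<open>cliff_Q\<close> at index 0 carry no meaning.
\<close>

record 'w clifford_module = "(rat, 'w) module" +
  cliff_P :: "nat \<Rightarrow> 'w \<Rightarrow> 'w"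
  cliff_Q :: "nat \<Rightarrow> 'w \<Rightarrow> 'w"
  cliff_grade :: "nat \<Rightarrow> 'w set"

definition clifford_relations :: "'w clifford_module \<Rightarrow> bool" where
  "clifford_relations W \<longleftrightarrow>
     (\<forall>i>0. linear_map W W (cliff_P W i) \<and> linear_map W W (cliff_Q W i)) \<and>
     (\<forall>i>0. \<forall>j>0. \<forall>x\<in>carrier W.
        cliff_P W i (cliff_P W j x) \<oplus>\<^bsub>W\<^esub> cliff_P W j (cliff_P W i x) = \<zero>\<^bsub>W\<^esub> \<and>
        cliff_Q W i (cliff_Q W j x) \<oplus>\<^bsub>W\<^esub> cliff_Q W j (cliff_Q W i x) = \<zero>\<^bsub>W\<^esub> \<and>
        cliff_P W i (cliff_Q W j x) \<oplus>\<^bsub>W\<^esub> cliff_Q W j (cliff_P W i x) =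
          (if i = j then x else \<zero>\<^bsub>W\<^esub>))"

definition direct_sum_decomposition ::
  "(rat, 'w, 'c) module_scheme \<Rightarrow> (nat \<Rightarrow> 'w set) \<Rightarrow> bool" where
  "direct_sum_decomposition W gr \<longleftrightarrow>
     (\<forall>n. submodule (gr n) rat_field W) \<and>
     (\<forall>x\<in>carrier W. \<exists>!c. (\<forall>n. c n \<in> gr n) \<and> finite {n. c n \<noteq> \<zero>\<^bsub>W\<^esub>} \<and>
        x = (\<Oplus>\<^bsub>W\<^esub>n\<in>{n. c n \<noteq> \<zero>\<^bsub>W\<^esub>}. c n))"

definition graded_clifford_module :: "'w clifford_module \<Rightarrow> bool" where
  "graded_clifford_module W \<longleftrightarrow> rat_vector_space W \<and> clifford_relations W \<and>
     direct_sum_decomposition W (cliff_grade W) \<and>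
     (\<forall>i>0. \<forall>n. cliff_P W i ` cliff_grade W n \<subseteq> cliff_grade W (Suc n)) \<and>
     (\<forall>i>0. \<forall>n. cliff_Q W i ` cliff_grade W (Suc n) \<subseteq> cliff_grade W n) \<and>
     (\<forall>i>0. cliff_Q W i ` cliff_grade W 0 \<subseteq> {\<zero>\<^bsub>W\<^esub>})"

definition admissible_clifford_module :: "'w clifford_module \<Rightarrow> bool" where
  "admissible_clifford_module W \<longleftrightarrow> graded_clifford_module W \<and>
     (\<forall>x\<in>carrier W. \<exists>N. \<forall>m>N. cliff_Q W m x = \<zero>\<^bsub>W\<^esub>) \<and>
     cliff_grade W 0 = {x \<in> carrier W. \<forall>i>0. cliff_Q W i x = \<zero>\<^bsub>W\<^esub>}"

definition clifford_homs ::
  "'v clifford_module \<Rightarrow> 'w clifford_module \<Rightarrow> ('v \<Rightarrow> 'w) set" where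
  "clifford_homs W W' = {f \<in> linear_maps W W'.
     (\<forall>i>0. \<forall>x\<in>carrier W.
        f (cliff_P W i x) = cliff_P W' i (f x) \<and> f (cliff_Q W i x) = cliff_Q W' i (f x)) \<and>
     (\<forall>n. f ` cliff_grade W n \<subseteq> cliff_grade W' n)}"

definition admissible_clifford_cat :: "'u set \<Rightarrow> ('w clifford_module, 'w \<Rightarrow> 'w) cat" where
  "admissible_clifford_cat U = \<lparr>Obj = {W. admissible_clifford_module W \<and> carrier W \<lesssim> U},
     Hom = clifford_homs,
     Id = (\<lambda>W. \<lambda>x\<in>carrier W. x),
     Comp = (\<lambda>W W' W'' g f. compose (carrier W) g f)\<rparr>"

text \<open>\<open>W \<otimes> V\<close> with \<open>P\<^sub>i \<otimes> id\<close>, \<open>Q\<^sub>i \<otimes> id\<close>, and the image of \<open>W\<^sub>n \<otimes> V\<close> in degree \<open>n\<close>.\<close>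

definition clifford_tensor ::
  "'w clifford_module \<Rightarrow> (rat, 'v) module \<Rightarrow> ('w, 'v) tensor clifford_module" where
  "clifford_tensor W V = module.extend (tensor_prod W V) (clifford_module.fields
     (\<lambda>i. tensor_map W V W V (cliff_P W i) id)
     (\<lambda>i. tensor_map W V W V (cliff_Q W i) id)
     (\<lambda>n. tensor_class W V ` {p. Poly_Mapping.keys p \<subseteq> cliff_grade W n \<times> carrier V}))"


section \<open>The Fermionic Fock space\<close>

text \<open>
  The exterior algebra on \<open>\<Oplus>\<^bsub>i>0\<^esub> \<rat> x\<^sub>i\<close>: a finite set \<open>S = {i\<^sub>1 < \<dots> < i\<^sub>k}\<close> of positive integers
  stands for the basis element \<open>x\<^sub>S = x\<^bsub>i\<^sub>1\<^esub> \<and> \<dots> \<and> x\<^bsub>i\<^sub>k\<^esub>\<close>.  Sorting \<open>x\<^sub>S \<and> x\<^sub>T\<close> costs one sign for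
  each pair \<open>(s, t)\<close> with \<open>s > t\<close>; and \<open>\<partial>/\<partial>x\<^sub>i\<close> is the antiderivation that moves \<open>x\<^sub>i\<close> to the
  front and deletes it.
\<close>

type_synonym fermion = "nat set \<Rightarrow>\<^sub>0 rat"

definition wedge_sign :: "nat set \<Rightarrow> nat set \<Rightarrow> rat" where
  "wedge_sign S T = (-1) ^ card {(s, t). s \<in> S \<and> t \<in> T \<and> t < s}"

definition wedge :: "fermion \<Rightarrow> fermion \<Rightarrow> fermion" where
  "wedge f g = (\<Sum>S\<in>Poly_Mapping.keys f. \<Sum>T\<in>Poly_Mapping.keys g.
     if S \<inter> T = {}
     then Poly_Mapping.single (S \<union> T)
            (wedge_sign S T * Poly_Mapping.lookup f S * Poly_Mapping.lookup g T)
     else 0)"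

definition ext_deriv :: "nat \<Rightarrow> fermion \<Rightarrow> fermion" where
  "ext_deriv i f = (\<Sum>S\<in>Poly_Mapping.keys f.
     if i \<in> S
     then Poly_Mapping.single (S - {i}) (wedge_sign {i} (S - {i}) * Poly_Mapping.lookup f S)
     else 0)"

definition fermionic_fock_space :: "fermion clifford_module" where
  "fermionic_fock_space =
     \<lparr>carrier = {f. \<forall>S\<in>Poly_Mapping.keys f. finite S \<and> 0 \<notin> S},
      mult = wedge, one = Poly_Mapping.single {} 1, zero = 0, add = (+), smult = pm_scale,
      cliff_P = (\<lambda>i f. wedge (Poly_Mapping.single {i} 1) f),
      cliff_Q = ext_deriv,
      cliff_grade = (\<lambda>n. {f. \<forall>S\<in>Poly_Mapping.keys f. finite S \<and> 0 \<notin> S \<and> card S = n})\<rparr>"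

definition fermionic_functor ::
  "((rat, 'v) module, 'v \<Rightarrow> 'v,
    (fermion, 'v) tensor clifford_module, (fermion, 'v) tensor \<Rightarrow> (fermion, 'v) tensor) cat_functor"
where
  "fermionic_functor =
     \<lparr>obj_map = (\<lambda>V. clifford_tensor fermionic_fock_space V),
      mor_map = (\<lambda>V V' f. tensor_map fermionic_fock_space V fermionic_fock_space V' id f)\<rparr>"


section \<open>Heisenberg modules\<close>

text \<open>The value of \<open>heis_H\<close> at index 0 carries no meaning.\<close>

record 'w heisenberg_module = "(rat, 'w) module" +
  heis_H :: "int \<Rightarrow> 'w \<Rightarrow> 'w"

definition heisenberg_module :: "'w heisenberg_module \<Rightarrow> bool" where
  "heisenberg_module W \<longleftrightarrow> rat_vector_space W \<and>
     (\<forall>i. i \<noteq> 0 \<longrightarrow> linear_map W W (heis_H W i)) \<and>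
     (\<forall>i j. i \<noteq> 0 \<longrightarrow> j \<noteq> 0 \<longrightarrow> (\<forall>x\<in>carrier W.
        heis_H W i (heis_H W j x) \<ominus>\<^bsub>W\<^esub> heis_H W j (heis_H W i x) =
          (if i = - j then rat_of_int i \<odot>\<^bsub>W\<^esub> x else \<zero>\<^bsub>W\<^esub>)))"

text \<open>
  A sequence \<open>\<lambda> = (n\<^sub>1, n\<^sub>2, \<dots>)\<close> is a finitely supported function whose support does not contain 0.
  The operators in \<open>H\<^bsub>-\<lambda>\<^esub>\<close> commute; they are composed in increasing order of the index.
\<close>

definition seq_weight :: "(nat \<Rightarrow>\<^sub>0 nat) \<Rightarrow> nat" where
  "seq_weight l = (\<Sum>i\<in>Poly_Mapping.keys l. i * Poly_Mapping.lookup l i)"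

definition heis_neg :: "'w heisenberg_module \<Rightarrow> (nat \<Rightarrow>\<^sub>0 nat) \<Rightarrow> 'w \<Rightarrow> 'w" where
  "heis_neg W l = foldr (\<lambda>i g. (heis_H W (- int i) ^^ Poly_Mapping.lookup l i) \<circ> g)
     (sorted_list_of_set (Poly_Mapping.keys l)) id"

definition admissible_heisenberg_module :: "'w heisenberg_module \<Rightarrow> bool" where
  "admissible_heisenberg_module W \<longleftrightarrow> heisenberg_module W \<and>
     (\<forall>x\<in>carrier W. \<exists>N>0. \<forall>l. 0 \<notin> Poly_Mapping.keys l \<longrightarrow> seq_weight l > N \<longrightarrow>
        heis_neg W l x = \<zero>\<^bsub>W\<^esub>)"

definition heisenberg_homs ::
  "'v heisenberg_module \<Rightarrow> 'w heisenberg_module \<Rightarrow> ('v \<Rightarrow> 'w) set" where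
  "heisenberg_homs W W' = {f \<in> linear_maps W W'.
     \<forall>i. i \<noteq> 0 \<longrightarrow> (\<forall>x\<in>carrier W. f (heis_H W i x) = heis_H W' i (f x))}"

definition admissible_heisenberg_cat :: "'u set \<Rightarrow> ('w heisenberg_module, 'w \<Rightarrow> 'w) cat" where
  "admissible_heisenberg_cat U = \<lparr>Obj = {W. admissible_heisenberg_module W \<and> carrier W \<lesssim> U},
     Hom = heisenberg_homs,
     Id = (\<lambda>W. \<lambda>x\<in>carrier W. x),
     Comp = (\<lambda>W W' W'' g f. compose (carrier W) g f)\<rparr>"

definition heisenberg_tensor ::
  "'w heisenberg_module \<Rightarrow> (rat, 'v) module \<Rightarrow> ('w, 'v) tensor heisenberg_module" where
  "heisenberg_tensor W V = module.extend (tensor_prod W V) (heisenberg_module.fields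
     (\<lambda>i. tensor_map W V W V (heis_H W i) id))"


section \<open>The Bosonic Fock space\<close>

text \<open>
  Polynomials in \<open>y\<^sub>1, y\<^sub>2, \<dots>\<close>: a monomial is its finitely supported exponent function, and the
  multiplication is that of the ring instance of \<open>\<Rightarrow>\<^sub>0\<close>.  Monomials in the carrier do not
  involve the variable with index 0.
\<close>

type_synonym boson = "(nat \<Rightarrow>\<^sub>0 nat) \<Rightarrow>\<^sub>0 rat"

definition boson_var :: "nat \<Rightarrow> boson" where
  "boson_var k = Poly_Mapping.single (Poly_Mapping.single k 1) 1"

definition boson_deriv :: "nat \<Rightarrow> boson \<Rightarrow> boson" where
  "boson_deriv k p = (\<Sum>m\<in>Poly_Mapping.keys p.
     Poly_Mapping.single (m - Poly_Mapping.single k 1)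
       (of_nat (Poly_Mapping.lookup m k) * Poly_Mapping.lookup p m))"

text \<open>For \<open>k = - m < 0\<close> the scalar \<open>- m\<close> in front of \<open>\<partial>/\<partial>y\<^sub>m\<close> is \<open>k\<close> itself.\<close>

definition bosonic_fock_space :: "boson heisenberg_module" where
  "bosonic_fock_space =
     \<lparr>carrier = {p. \<forall>m\<in>Poly_Mapping.keys p. 0 \<notin> Poly_Mapping.keys m},
      mult = (*), one = 1, zero = 0, add = (+), smult = pm_scale,
      heis_H = (\<lambda>k p. if k > 0 then boson_var (nat k) * p
                      else pm_scale (rat_of_int k) (boson_deriv (nat (- k)) p))\<rparr>"

definition bosonic_functor ::
  "((rat, 'v) module, 'v \<Rightarrow> 'v,
    (boson, 'v) tensor heisenberg_module, (boson, 'v) tensor \<Rightarrow> (boson, 'v) tensor) cat_functor"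
where
  "bosonic_functor =
     \<lparr>obj_map = (\<lambda>V. heisenberg_tensor bosonic_fock_space V),
      mor_map = (\<lambda>V V' f. tensor_map bosonic_fock_space V bosonic_fock_space V' id f)\<rparr>"

end

theory Submission
  imports Defs "HOL-Library.Countable_Set"
begin

text \<open>
  Both algebras are generated by creation operators \<open>P\<^sub>i\<close> (the \<open>P\<^sub>i\<close>, respectively the \<open>H\<^sub>i\<close>) and
  annihilation operators \<open>Q\<^sub>i\<close> (the \<open>Q\<^sub>i\<close>, respectively the \<open>H\<^bsub>-i\<^esub>\<close>).  The operators of one kind
  commute up to a sign \<open>\<epsilon>\<close>, and \<open>Q\<^sub>i P\<^sub>j = \<epsilon> P\<^sub>j Q\<^sub>i + \<delta>\<^sub>i\<^sub>j \<kappa>\<^sub>i\<close>; here \<open>\<epsilon> = -1\<close> and \<open>\<kappa>\<^sub>i = 1\<close> in the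
  Clifford case, \<open>\<epsilon> = 1\<close> and \<open>\<kappa>\<^sub>i = -i\<close> in the Heisenberg case.  On an admissible module every
  vector is killed by almost all \<open>Q\<^sub>i\<close> and by all sufficiently long words in the \<open>Q\<^sub>i\<close>.  The locale
  \<open>ladder\<close> records exactly these properties, so that both halves of the theorem have one proof.

  Let \<open>vac W\<close> be the common kernel of the \<open>Q\<^sub>i\<close> on such a module \<open>W\<close>.  The number operator
  \<open>N = \<Sum>\<^sub>i \<kappa>\<^sub>i\<^sup>-\<^sup>1 P\<^sub>i Q\<^sub>i\<close> satisfies \<open>[N, P\<^sub>i] = P\<^sub>i\<close> and \<open>[N, Q\<^sub>i] = - Q\<^sub>i\<close> and vanishes on \<open>vac W\<close>.
  Moving \<open>Q\<^sub>i\<close> through the product \<open>(1 - N) \<dots> (n - N)\<close> shows that it sends every vector killed by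
  all words of length \<open>n + 1\<close> into \<open>vac W\<close>; divided by \<open>n!\<close> it becomes independent of \<open>n\<close>, once \<open>n\<close>
  is large, and defines a projector onto \<open>vac W\<close> which kills the image of every \<open>P\<^sub>i\<close>.
  Two facts follow.  First, \<open>vac W\<close> generates \<open>W\<close> under the \<open>P\<^sub>i\<close> (\<open>vac_generates\<close>).  Second, every
  linear map \<open>\<iota>\<close> from \<open>vac W\<close> to \<open>vac W'\<close> extends, by the first fact in only one way, to a
  homomorphism \<open>W \<rightarrow> W'\<close> (\<open>hom_extension\<close>): the relation generated by the pairs
  \<open>(v, \<iota> v)\<close> under linear combinations and creation operators is stable under the \<open>Q\<^sub>i\<close>, and the
  projectors together with local nilpotency force it to be single valued.

  The vacuum of either Fock space \<open>\<FF>\<close> is spanned by the monomial 1, and by means of the projector the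
  vacuum of \<open>\<FF> \<otimes> V\<close> is found to be \<open>1 \<otimes> V\<close> (\<open>tensor_vac\<close>).  Hence homomorphisms
  \<open>\<FF> \<otimes> V \<rightarrow> \<FF> \<otimes> V'\<close> correspond to linear maps \<open>V \<rightarrow> V'\<close>, and every \<open>W\<close> is isomorphic to
  \<open>\<FF> \<otimes> vac W\<close>: the functor is fully faithful and essentially surjective (locale
  \<open>fock_equivalence\<close>).  In the Clifford case the grading carries no further information,
  because the degree is the eigenvalue of \<open>N\<close> (\<open>grade_num\<close>, \<open>clifford_hom_iff\<close>).  The size bound
  is respected because both Fock spaces are countable and \<open>U\<close> is infinite.

  It remains to pass from a fully faithful and essentially surjective functor to an equivalence,
  by a choice of preimages (\<open>quasi_inverse\<close>), and to transport abelianness from vector spaces, where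
  it is checked directly, along the quasi-inverse (\<open>abelian_category_transfer\<close>).
\<close>

section \<open>Fully faithful and essentially surjective functors\<close>

definition fully_faithful :: "('o, 'm) cat \<Rightarrow> ('p, 'n) cat \<Rightarrow> ('o, 'm, 'p, 'n) cat_functor \<Rightarrow> bool" where
  "fully_faithful C D F \<longleftrightarrow>
     (\<forall>X\<in>Obj C. \<forall>Y\<in>Obj C. bij_betw (mor_map F X Y) (Hom C X Y) (Hom D (obj_map F X) (obj_map F Y)))"

definition essentially_surjective ::
  "('o, 'm) cat \<Rightarrow> ('p, 'n) cat \<Rightarrow> ('o, 'm, 'p, 'n) cat_functor \<Rightarrow> bool" where
  "essentially_surjective C D F \<longleftrightarrow> (\<forall>Y\<in>Obj D. \<exists>X\<in>Obj C. \<exists>f. iso_mor D (obj_map F X) Y f)"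

definition weak_equivalence ::
  "('o, 'm) cat \<Rightarrow> ('p, 'n) cat \<Rightarrow> ('o, 'm, 'p, 'n) cat_functor \<Rightarrow> bool" where
  "weak_equivalence C D F \<longleftrightarrow> category C \<and> category D \<and> is_functor C D F \<and>
     fully_faithful C D F \<and> essentially_surjective C D F"

locale cat_loc =
  fixes C :: "('o, 'm) cat"
  assumes category: "category C"
begin

lemma Id_in [simp, intro]: "X \<in> Obj C \<Longrightarrow> Id C X \<in> Hom C X X"
  using category by (simp add: category_def)

lemma Comp_in [simp, intro]:
  "f \<in> Hom C X Y \<Longrightarrow> g \<in> Hom C Y Z \<Longrightarrow> X \<in> Obj C \<Longrightarrow> Y \<in> Obj C \<Longrightarrow> Z \<in> Obj C \<Longrightarrow>
     Comp C X Y Z g f \<in> Hom C X Z"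
  using category by (simp add: category_def)

lemma Comp_Id [simp]:
  "f \<in> Hom C X Y \<Longrightarrow> X \<in> Obj C \<Longrightarrow> Y \<in> Obj C \<Longrightarrow> Comp C X X Y f (Id C X) = f"
  "f \<in> Hom C X Y \<Longrightarrow> X \<in> Obj C \<Longrightarrow> Y \<in> Obj C \<Longrightarrow> Comp C X Y Y (Id C Y) f = f"
  using category by (simp_all add: category_def)

lemma Comp_assoc:
  "f \<in> Hom C X Y \<Longrightarrow> g \<in> Hom C Y Z \<Longrightarrow> h \<in> Hom C Z T \<Longrightarrow>
     X \<in> Obj C \<Longrightarrow> Y \<in> Obj C \<Longrightarrow> Z \<in> Obj C \<Longrightarrow> T \<in> Obj C \<Longrightarrow>
     Comp C X Y T (Comp C Y Z T h g) f = Comp C X Z T h (Comp C X Y Z g f)"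
  using category by (simp add: category_def)

definition inverses :: "'o \<Rightarrow> 'o \<Rightarrow> 'm \<Rightarrow> 'm \<Rightarrow> bool" where
  "inverses X Y f g \<longleftrightarrow> X \<in> Obj C \<and> Y \<in> Obj C \<and> f \<in> Hom C X Y \<and> g \<in> Hom C Y X \<and>
     Comp C X Y X g f = Id C X \<and> Comp C Y X Y f g = Id C Y"

lemma inverses_sym: "inverses X Y f g \<Longrightarrow> inverses Y X g f"
  by (auto simp: inverses_def)

lemma iso_mor_iff_inverses:
  "X \<in> Obj C \<Longrightarrow> Y \<in> Obj C \<Longrightarrow> iso_mor C X Y f \<longleftrightarrow> (\<exists>g. inverses X Y f g)"
  by (auto simp: iso_mor_def inverses_def)

lemma inversesD:
  assumes "inverses X Y f g"
  shows "X \<in> Obj C" "Y \<in> Obj C" "f \<in> Hom C X Y" "g \<in> Hom C Y X"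
    "Comp C X Y X g f = Id C X" "Comp C Y X Y f g = Id C Y"
  using assms by (auto simp: inverses_def)

lemma cancel_left:
  assumes "inverses X Y f g" "T \<in> Obj C"
  shows "h \<in> Hom C T X \<Longrightarrow> Comp C T Y X g (Comp C T X Y f h) = h"
    and "h \<in> Hom C T Y \<Longrightarrow> Comp C T X Y f (Comp C T Y X g h) = h"
  using assms(2) inversesD[OF assms(1)] by (simp_all flip: Comp_assoc)

lemma cancel_right:
  assumes "inverses X Y f g" "T \<in> Obj C"
  shows "h \<in> Hom C Y T \<Longrightarrow> Comp C Y X T (Comp C X Y T h f) g = h"
    and "h \<in> Hom C X T \<Longrightarrow> Comp C X Y T (Comp C Y X T h g) f = h"
  using assms(2) inversesD[OF assms(1)] by (simp_all add: Comp_assoc)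

text \<open>The universal properties of products and of kernels both assert \<open>\<exists>!u\<close> with a condition on the
  composites of \<open>u\<close>.  In this form they move along an isomorphism of the universal object.\<close>

lemma ex1_precompose_iso:
  assumes i: "inverses K' K i j" and T: "T \<in> Obj C"
    and "\<exists>!u. u \<in> Hom C T K \<and> R u"
  shows "\<exists>!u. u \<in> Hom C T K' \<and> R (Comp C T K' K i u)"
proof -
  note iD = inversesD[OF i]
  obtain u where u: "u \<in> Hom C T K" "R u" and uniq: "\<And>v. v \<in> Hom C T K \<Longrightarrow> R v \<Longrightarrow> v = u"
    using assms(3) by blast
  show ?thesis
  proof (rule ex1I[of _ "Comp C T K K' j u"])
    show "Comp C T K K' j u \<in> Hom C T K' \<and> R (Comp C T K' K i (Comp C T K K' j u))"
      using u iD T cancel_left[OF i T] by auto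
    fix v assume v: "v \<in> Hom C T K' \<and> R (Comp C T K' K i v)"
    then have "Comp C T K' K i v = u" using uniq iD T by auto
    then show "v = Comp C T K K' j u" using cancel_left(1)[OF i T] v by auto
  qed
qed

lemma is_product_iso:
  assumes P: "is_product C X Y P p q" and i: "inverses P' P i j" and "X \<in> Obj C" "Y \<in> Obj C"
  shows "is_product C X Y P' (Comp C P' P X p i) (Comp C P' P Y q i)"
proof -
  note iD = inversesD[OF i]
  have p: "p \<in> Hom C P X" "q \<in> Hom C P Y" using P by (auto simp: is_product_def)
  have "\<exists>!u. u \<in> Hom C T P' \<and> Comp C T P' X (Comp C P' P X p i) u = f \<and>
        Comp C T P' Y (Comp C P' P Y q i) u = g"
    if T: "T \<in> Obj C" and "f \<in> Hom C T X" "g \<in> Hom C T Y" for T f g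
  proof -
    have "\<exists>!u. u \<in> Hom C T P \<and> (Comp C T P X p u = f \<and> Comp C T P Y q u = g)"
      using P that by (auto simp: is_product_def)
    from ex1_precompose_iso[OF i T this] show ?thesis
      using p iD T assms by (simp add: Comp_assoc cong: conj_cong)
  qed
  then show ?thesis using p iD assms by (auto simp: is_product_def)
qed

lemma zero_mor_Comp_left:
  assumes "zero_mor C X Y f" "h \<in> Hom C Y Z" "X \<in> Obj C" "Y \<in> Obj C" "Z \<in> Obj C"
  shows "zero_mor C X Z (Comp C X Y Z h f)"
proof -
  obtain O' a b where O: "zero_object C O'" "a \<in> Hom C X O'" "b \<in> Hom C O' Y" "f = Comp C X O' Y b a"
    using assms(1) by (auto simp: zero_mor_def)
  have "O' \<in> Obj C" using O by (simp add: zero_object_def)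
  then have "Comp C O' Y Z h b \<in> Hom C O' Z \<and> Comp C X Y Z h f = Comp C X O' Z (Comp C O' Y Z h b) a"
    using O assms by (simp add: Comp_assoc)
  then show ?thesis using O unfolding zero_mor_def by blast
qed

lemma zero_mor_Comp_right:
  assumes "zero_mor C X Y f" "h \<in> Hom C W X" "X \<in> Obj C" "Y \<in> Obj C" "W \<in> Obj C"
  shows "zero_mor C W Y (Comp C W X Y f h)"
proof -
  obtain O' a b where O: "zero_object C O'" "a \<in> Hom C X O'" "b \<in> Hom C O' Y" "f = Comp C X O' Y b a"
    using assms(1) by (auto simp: zero_mor_def)
  have "O' \<in> Obj C" using O by (simp add: zero_object_def)
  then have "Comp C W X O' a h \<in> Hom C W O' \<and> Comp C W X Y f h = Comp C W O' Y b (Comp C W X O' a h)"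
    using O assms by (simp add: Comp_assoc)
  then show ?thesis using O unfolding zero_mor_def by blast
qed

lemma is_kernel_iso:
  assumes k: "is_kernel C X Y f K k" and i: "inverses K' K i j"
    and XY: "X \<in> Obj C" "Y \<in> Obj C" "f \<in> Hom C X Y"
  shows "is_kernel C X Y f K' (Comp C K' K X k i)"
proof -
  note iD = inversesD[OF i]
  have kh: "k \<in> Hom C K X" and z: "zero_mor C K Y (Comp C K X Y f k)"
    using k by (auto simp: is_kernel_def)
  have "\<exists>!u. u \<in> Hom C T K' \<and> Comp C T K' X (Comp C K' K X k i) u = g"
    if T: "T \<in> Obj C" and "g \<in> Hom C T X" "zero_mor C T Y (Comp C T X Y f g)" for T g
  proof -
    have "\<exists>!u. u \<in> Hom C T K \<and> Comp C T K X k u = g"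
      using k that by (auto simp: is_kernel_def)
    from ex1_precompose_iso[OF i T this] show ?thesis
      using kh iD T XY by (simp add: Comp_assoc cong: conj_cong)
  qed
  moreover have "zero_mor C K' Y (Comp C K' X Y f (Comp C K' K X k i))"
    using zero_mor_Comp_right[OF z iD(3)] kh iD XY by (simp add: Comp_assoc)
  ultimately show ?thesis using kh iD XY by (auto simp: is_kernel_def)
qed

text \<open>Composing with an isomorphism does not change which maps become zero.\<close>

lemma is_kernel_postcompose_iso:
  assumes k: "is_kernel C X Y f K k" and i: "inverses Y Y' i j"
    and X: "X \<in> Obj C" "f \<in> Hom C X Y"
  shows "is_kernel C X Y' (Comp C X Y Y' i f) K k"
proof -
  note iD = inversesD[OF i]
  have eq: "zero_mor C T Y' (Comp C T X Y' (Comp C X Y Y' i f) g) \<longleftrightarrow> zero_mor C T Y (Comp C T X Y f g)"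
    if g: "T \<in> Obj C" "g \<in> Hom C T X" for T g
  proof
    assume "zero_mor C T Y (Comp C T X Y f g)"
    then show "zero_mor C T Y' (Comp C T X Y' (Comp C X Y Y' i f) g)"
      using zero_mor_Comp_left[of T Y "Comp C T X Y f g" i Y'] iD X g by (simp add: Comp_assoc)
  next
    assume "zero_mor C T Y' (Comp C T X Y' (Comp C X Y Y' i f) g)"
    from zero_mor_Comp_left[OF this, of j Y] show "zero_mor C T Y (Comp C T X Y f g)"
      using iD X g cancel_left(1)[OF i g(1)] by (simp add: Comp_assoc)
  qed
  show ?thesis using k X iD by (auto simp: is_kernel_def eq)
qed

end

lemma category_op: "category C \<Longrightarrow> category (op_cat C)"
  by (simp add: category_def op_cat_def)

lemma iso_mor_op: "iso_mor (op_cat C) X Y f \<longleftrightarrow> iso_mor C Y X f"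
  by (auto simp: iso_mor_def op_cat_def)

lemma zero_object_op: "zero_object (op_cat C) Z \<longleftrightarrow> zero_object C Z"
  by (auto simp: zero_object_def op_cat_def)

definition op_functor :: "('o, 'm, 'p, 'n) cat_functor \<Rightarrow> ('o, 'm, 'p, 'n) cat_functor" where
  "op_functor F = \<lparr>obj_map = obj_map F, mor_map = (\<lambda>X Y. mor_map F Y X)\<rparr>"

lemma iso_mor_sym:
  assumes "iso_mor C X Y f"
  obtains g where "iso_mor C Y X g"
  using assms unfolding iso_mor_def by blast

text \<open>Cokernels, coproducts and epimorphisms are kernels, products and monomorphisms of the opposite
  category, so that with this lemma every result about the latter yields its dual.\<close>

lemma weak_equivalence_op:
  assumes "weak_equivalence C D F"
  shows "weak_equivalence (op_cat C) (op_cat D) (op_functor F)"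
proof -
  have "essentially_surjective (op_cat C) (op_cat D) (op_functor F)"
    unfolding essentially_surjective_def
  proof
    fix Y assume "Y \<in> Obj (op_cat D)"
    then obtain X f where "X \<in> Obj C" "iso_mor D (obj_map F X) Y f"
      using assms unfolding weak_equivalence_def essentially_surjective_def op_cat_def by auto
    then obtain g where "X \<in> Obj C" "iso_mor D Y (obj_map F X) g"
      by (blast elim: iso_mor_sym)
    then show "\<exists>X\<in>Obj (op_cat C). \<exists>f. iso_mor (op_cat D) (obj_map (op_functor F) X) Y f"
      by (auto simp: iso_mor_op op_functor_def op_cat_def[of C])
  qed
  moreover have "is_functor (op_cat C) (op_cat D) (op_functor F)"
    using assms unfolding weak_equivalence_def is_functor_def op_cat_def op_functor_def by simp
  moreover have "fully_faithful (op_cat C) (op_cat D) (op_functor F)"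
    using assms unfolding weak_equivalence_def fully_faithful_def op_cat_def op_functor_def by simp
  ultimately show ?thesis using assms by (simp add: weak_equivalence_def category_op)
qed

locale weak_equiv = C: cat_loc C + D: cat_loc D
  for C :: "('o, 'm) cat" and D :: "('p, 'n) cat" +
  fixes F :: "('o, 'm, 'p, 'n) cat_functor"
  assumes functorial: "is_functor C D F" and ff: "fully_faithful C D F"
    and es: "essentially_surjective C D F"
begin

lemma obj_in [simp, intro]: "X \<in> Obj C \<Longrightarrow> obj_map F X \<in> Obj D"
  using functorial by (simp add: is_functor_def)

lemma mor_in [simp, intro]:
  "f \<in> Hom C X Y \<Longrightarrow> X \<in> Obj C \<Longrightarrow> Y \<in> Obj C \<Longrightarrow> mor_map F X Y f \<in> Hom D (obj_map F X) (obj_map F Y)"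
  using functorial by (simp add: is_functor_def)

lemma mor_Id [simp]: "X \<in> Obj C \<Longrightarrow> mor_map F X X (Id C X) = Id D (obj_map F X)"
  using functorial by (simp add: is_functor_def)

lemma mor_Comp:
  "f \<in> Hom C X Y \<Longrightarrow> g \<in> Hom C Y Z \<Longrightarrow> X \<in> Obj C \<Longrightarrow> Y \<in> Obj C \<Longrightarrow> Z \<in> Obj C \<Longrightarrow>
     mor_map F X Z (Comp C X Y Z g f) =
       Comp D (obj_map F X) (obj_map F Y) (obj_map F Z) (mor_map F Y Z g) (mor_map F X Y f)"
  using functorial by (simp add: is_functor_def)

lemma mor_eq_iff:
  "f \<in> Hom C X Y \<Longrightarrow> g \<in> Hom C X Y \<Longrightarrow> X \<in> Obj C \<Longrightarrow> Y \<in> Obj C \<Longrightarrow>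
     mor_map F X Y f = mor_map F X Y g \<longleftrightarrow> f = g"
  using ff by (auto simp: fully_faithful_def bij_betw_def inj_on_def)

lemma mor_lift:
  assumes "h \<in> Hom D (obj_map F X) (obj_map F Y)" "X \<in> Obj C" "Y \<in> Obj C"
  obtains f where "f \<in> Hom C X Y" "mor_map F X Y f = h"
proof -
  have "mor_map F X Y ` Hom C X Y = Hom D (obj_map F X) (obj_map F Y)"
    using ff assms(2,3) unfolding fully_faithful_def bij_betw_def by blast
  then have "h \<in> mor_map F X Y ` Hom C X Y" using assms(1) by simp
  then show thesis using that by (auto elim: imageE)
qed

lemma obj_lift:
  assumes "Y \<in> Obj D"
  obtains X f g where "X \<in> Obj C" "D.inverses (obj_map F X) Y f g"
proof -
  obtain X f where "X \<in> Obj C" "iso_mor D (obj_map F X) Y f"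
    using es assms unfolding essentially_surjective_def by blast
  then show thesis using that D.iso_mor_iff_inverses assms by blast
qed

text \<open>Full faithfulness in the form in which it translates universal properties.\<close>

lemma ex1_mor_iff:
  assumes "X \<in> Obj C" "Y \<in> Obj C"
  shows "(\<exists>!h. h \<in> Hom D (obj_map F X) (obj_map F Y) \<and> R h) \<longleftrightarrow>
     (\<exists>!f. f \<in> Hom C X Y \<and> R (mor_map F X Y f))" (is "?A = ?B")
proof
  assume ?A
  then obtain h where h: "h \<in> Hom D (obj_map F X) (obj_map F Y)" "R h"
    and uniq: "\<And>h'. h' \<in> Hom D (obj_map F X) (obj_map F Y) \<Longrightarrow> R h' \<Longrightarrow> h' = h" by blast
  obtain f where f: "f \<in> Hom C X Y" "mor_map F X Y f = h" using mor_lift[OF h(1)] assms by blast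
  show ?B
  proof (rule ex1I[of _ f])
    show "f \<in> Hom C X Y \<and> R (mor_map F X Y f)" using f h by simp
    fix g assume "g \<in> Hom C X Y \<and> R (mor_map F X Y g)"
    then show "g = f" using uniq f mor_eq_iff assms mor_in by metis
  qed
next
  assume ?B
  then obtain f where f: "f \<in> Hom C X Y" "R (mor_map F X Y f)"
    and uniq: "\<And>f'. f' \<in> Hom C X Y \<Longrightarrow> R (mor_map F X Y f') \<Longrightarrow> f' = f" by blast
  show ?A
  proof (rule ex1I[of _ "mor_map F X Y f"])
    show "mor_map F X Y f \<in> Hom D (obj_map F X) (obj_map F Y) \<and> R (mor_map F X Y f)"
      using f assms by simp
    fix h assume "h \<in> Hom D (obj_map F X) (obj_map F Y) \<and> R h"
    then show "h = mor_map F X Y f" using uniq mor_lift assms by metis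
  qed
qed

lemma zero_object_image:
  assumes Z: "zero_object C Z"
  shows "zero_object D (obj_map F Z)"
proof -
  have ZC: "Z \<in> Obj C" using Z by (simp add: zero_object_def)
  have "(\<exists>!f. f \<in> Hom D X (obj_map F Z)) \<and> (\<exists>!f. f \<in> Hom D (obj_map F Z) X)" if X: "X \<in> Obj D" for X
  proof -
    obtain X' i j where X': "X' \<in> Obj C" and i: "D.inverses (obj_map F X') X i j" using obj_lift[OF X] .
    note iD = D.inversesD[OF i]
    have "\<exists>!f. f \<in> Hom C X' Z" "\<exists>!f. f \<in> Hom C Z X'" using Z X' by (auto simp: zero_object_def)
    then have "\<exists>!f. f \<in> Hom D (obj_map F X') (obj_map F Z)" "\<exists>!f. f \<in> Hom D (obj_map F Z) (obj_map F X')"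
      using ex1_mor_iff[of X' Z "\<lambda>_. True"] ex1_mor_iff[of Z X' "\<lambda>_. True"] X' ZC by auto
    then obtain a b where a: "a \<in> Hom D (obj_map F X') (obj_map F Z)"
        "\<And>f. f \<in> Hom D (obj_map F X') (obj_map F Z) \<Longrightarrow> f = a"
      and b: "b \<in> Hom D (obj_map F Z) (obj_map F X')"
        "\<And>f. f \<in> Hom D (obj_map F Z) (obj_map F X') \<Longrightarrow> f = b" by blast
    have "\<exists>!f. f \<in> Hom D X (obj_map F Z)"
    proof (rule ex1I)
      show "Comp D X (obj_map F X') (obj_map F Z) a j \<in> Hom D X (obj_map F Z)"
        using a(1) iD ZC X' by auto
      fix f assume f: "f \<in> Hom D X (obj_map F Z)"
      have "Comp D (obj_map F X') X (obj_map F Z) f i = a" by (rule a(2)) (use f iD ZC in auto)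
      then show "f = Comp D X (obj_map F X') (obj_map F Z) a j"
        using D.cancel_right(1)[OF i _ f] ZC by auto
    qed
    moreover have "\<exists>!f. f \<in> Hom D (obj_map F Z) X"
    proof (rule ex1I)
      show "Comp D (obj_map F Z) (obj_map F X') X i b \<in> Hom D (obj_map F Z) X"
        using b(1) iD ZC X' by auto
      fix f assume f: "f \<in> Hom D (obj_map F Z) X"
      have "Comp D (obj_map F Z) X (obj_map F X') j f = b" by (rule b(2)) (use f iD ZC in auto)
      then show "f = Comp D (obj_map F Z) (obj_map F X') X i b"
        using D.cancel_left(2)[OF i _ f] ZC by auto
    qed
    ultimately show ?thesis by blast
  qed
  then show ?thesis using ZC by (auto simp: zero_object_def)
qed

lemma zero_object_lift:
  assumes Z: "zero_object D (obj_map F Z)" and ZC: "Z \<in> Obj C"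
  shows "zero_object C Z"
  using Z ZC ex1_mor_iff[of _ Z "\<lambda>_. True"] ex1_mor_iff[of Z _ "\<lambda>_. True"]
  by (auto simp: zero_object_def)

lemma zero_object_iso:
  assumes Z: "zero_object D Z" and i: "D.inverses Z' Z i j"
  shows "zero_object D Z'"
proof -
  note iD = D.inversesD[OF i]
  have "(\<exists>!f. f \<in> Hom D X Z') \<and> (\<exists>!f. f \<in> Hom D Z' X)" if X: "X \<in> Obj D" for X
  proof -
    have "\<exists>!f. f \<in> Hom D X Z" "\<exists>!f. f \<in> Hom D Z X"
      using Z X by (simp_all add: zero_object_def)
    then obtain a b where a: "a \<in> Hom D X Z" "\<And>f. f \<in> Hom D X Z \<Longrightarrow> f = a"
      and b: "b \<in> Hom D Z X" "\<And>f. f \<in> Hom D Z X \<Longrightarrow> f = b"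
      by blast
    have "\<exists>!f. f \<in> Hom D X Z'"
    proof (rule ex1I)
      show "Comp D X Z Z' j a \<in> Hom D X Z'" using a(1) iD X by auto
      fix f assume f: "f \<in> Hom D X Z'"
      have "Comp D X Z' Z i f = a" by (rule a(2)) (use f iD X in auto)
      then show "f = Comp D X Z Z' j a" using D.cancel_left(1)[OF i X f] by simp
    qed
    moreover have "\<exists>!f. f \<in> Hom D Z' X"
    proof (rule ex1I)
      show "Comp D Z' Z X b i \<in> Hom D Z' X" using b(1) iD X by auto
      fix f assume f: "f \<in> Hom D Z' X"
      have "Comp D Z Z' X f j = b" by (rule b(2)) (use f iD X in auto)
      then show "f = Comp D Z' Z X b i" using D.cancel_right(2)[OF i X f] by simp
    qed
    ultimately show ?thesis by blast
  qed
  then show ?thesis using iD by (auto simp: zero_object_def)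
qed

text \<open>A zero morphism of \<open>D\<close> may factor through any zero object of \<open>D\<close>, which need not lie in the image
  of \<open>F\<close>; this lemma replaces it by one that does.\<close>

lemma zero_object_preimage:
  assumes "zero_object D Z'"
  obtains Z i j where "zero_object C Z" "Z \<in> Obj C" "D.inverses (obj_map F Z) Z' i j"
proof -
  have "Z' \<in> Obj D" using assms by (simp add: zero_object_def)
  then obtain Z i j where "Z \<in> Obj C" "D.inverses (obj_map F Z) Z' i j" using obj_lift by blast
  then show thesis using that zero_object_lift zero_object_iso assms by blast
qed

lemma zero_mor_iff:
  assumes XY: "X \<in> Obj C" "Y \<in> Obj C" and f: "f \<in> Hom C X Y"
  shows "zero_mor D (obj_map F X) (obj_map F Y) (mor_map F X Y f) \<longleftrightarrow> zero_mor C X Y f"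
proof
  assume "zero_mor C X Y f"
  then obtain Z a b where Z: "zero_object C Z" and ab: "a \<in> Hom C X Z" "b \<in> Hom C Z Y" "f = Comp C X Z Y b a"
    by (auto simp: zero_mor_def)
  have "Z \<in> Obj C" using Z by (simp add: zero_object_def)
  then have "zero_object D (obj_map F Z)" "mor_map F X Z a \<in> Hom D (obj_map F X) (obj_map F Z)"
    "mor_map F Z Y b \<in> Hom D (obj_map F Z) (obj_map F Y)"
    "mor_map F X Y f = Comp D (obj_map F X) (obj_map F Z) (obj_map F Y) (mor_map F Z Y b) (mor_map F X Z a)"
    using Z ab XY zero_object_image by (auto simp: mor_Comp)
  then show "zero_mor D (obj_map F X) (obj_map F Y) (mor_map F X Y f)"
    unfolding zero_mor_def by blast
next
  assume "zero_mor D (obj_map F X) (obj_map F Y) (mor_map F X Y f)"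
  then obtain Z' a b where Z': "zero_object D Z'" and ab: "a \<in> Hom D (obj_map F X) Z'"
    "b \<in> Hom D Z' (obj_map F Y)" "mor_map F X Y f = Comp D (obj_map F X) Z' (obj_map F Y) b a"
    by (auto simp: zero_mor_def)
  obtain Z i j where Z: "zero_object C Z" "Z \<in> Obj C" and i: "D.inverses (obj_map F Z) Z' i j"
    using zero_object_preimage[OF Z'] .
  note iD = D.inversesD[OF i]
  have "Comp D (obj_map F X) Z' (obj_map F Z) j a \<in> Hom D (obj_map F X) (obj_map F Z)"
    using ab iD XY Z by auto
  then obtain a' where a': "a' \<in> Hom C X Z" "mor_map F X Z a' = Comp D (obj_map F X) Z' (obj_map F Z) j a"
    using mor_lift XY Z by metis
  have "Comp D (obj_map F Z) Z' (obj_map F Y) b i \<in> Hom D (obj_map F Z) (obj_map F Y)"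
    using ab iD XY Z by auto
  then obtain b' where b': "b' \<in> Hom C Z Y" "mor_map F Z Y b' = Comp D (obj_map F Z) Z' (obj_map F Y) b i"
    using mor_lift XY Z by metis
  have "mor_map F X Y (Comp C X Z Y b' a') = mor_map F X Y f"
    using a' b' XY Z ab iD D.cancel_left(2)[OF i _ ab(1)] by (simp add: mor_Comp D.Comp_assoc)
  then have "Comp C X Z Y b' a' = f" using mor_eq_iff a' b' f XY Z by blast
  then show "zero_mor C X Y f" using a' b' Z unfolding zero_mor_def by blast
qed

end

context weak_equiv
begin

text \<open>A test object of \<open>D\<close> may be replaced by an isomorphic one of the form \<open>F T'\<close>, and morphisms
  between images of \<open>F\<close> come from \<open>C\<close>.\<close>

lemma mono_mor_image:
  assumes m: "mono_mor C X Y f" and XY: "X \<in> Obj C" "Y \<in> Obj C"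
  shows "mono_mor D (obj_map F X) (obj_map F Y) (mor_map F X Y f)"
proof -
  have f: "f \<in> Hom C X Y" using m by (simp add: mono_mor_def)
  have "g = h" if T: "T \<in> Obj D" and gh: "g \<in> Hom D T (obj_map F X)" "h \<in> Hom D T (obj_map F X)"
    and eq: "Comp D T (obj_map F X) (obj_map F Y) (mor_map F X Y f) g =
      Comp D T (obj_map F X) (obj_map F Y) (mor_map F X Y f) h" for T g h
  proof -
    obtain T' i j where T': "T' \<in> Obj C" and i: "D.inverses (obj_map F T') T i j" using obj_lift[OF T] .
    note iD = D.inversesD[OF i]
    obtain g' where g': "g' \<in> Hom C T' X" "mor_map F T' X g' = Comp D (obj_map F T') T (obj_map F X) g i"
      using mor_lift[of "Comp D (obj_map F T') T (obj_map F X) g i" T' X] gh iD XY T' by blast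
    obtain h' where h': "h' \<in> Hom C T' X" "mor_map F T' X h' = Comp D (obj_map F T') T (obj_map F X) h i"
      using mor_lift[of "Comp D (obj_map F T') T (obj_map F X) h i" T' X] gh iD XY T' by blast
    have "mor_map F T' Y (Comp C T' X Y f g') = mor_map F T' Y (Comp C T' X Y f h')"
      using g' h' f XY T' gh iD eq by (simp add: mor_Comp flip: D.Comp_assoc)
    then have "Comp C T' X Y f g' = Comp C T' X Y f h'" using mor_eq_iff g' h' f XY T' by blast
    then have "g' = h'" using m g' h' T' by (auto simp: mono_mor_def)
    then have "Comp D (obj_map F T') T (obj_map F X) g i = Comp D (obj_map F T') T (obj_map F X) h i"
      using g' h' by simp
    then have "Comp D T (obj_map F T') (obj_map F X) (Comp D (obj_map F T') T (obj_map F X) g i) j =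
        Comp D T (obj_map F T') (obj_map F X) (Comp D (obj_map F T') T (obj_map F X) h i) j" by simp
    then show "g = h" using gh XY by (simp add: D.cancel_right(1)[OF i])
  qed
  then show ?thesis using f XY by (auto simp: mono_mor_def)
qed

text \<open>To reflect a product it is enough to consider the test objects \<open>F T\<close>.\<close>

lemma is_product_lift:
  assumes pr: "is_product D (obj_map F X) (obj_map F Y) (obj_map F P) (mor_map F P X p) (mor_map F P Y q)"
    and C: "X \<in> Obj C" "Y \<in> Obj C" "P \<in> Obj C" "p \<in> Hom C P X" "q \<in> Hom C P Y"
  shows "is_product C X Y P p q"
proof -
  have "\<exists>!u. u \<in> Hom C T P \<and> Comp C T P X p u = f \<and> Comp C T P Y q u = g"
    if T: "T \<in> Obj C" and fg: "f \<in> Hom C T X" "g \<in> Hom C T Y" for T f g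
  proof -
    have "\<exists>!u. u \<in> Hom D (obj_map F T) (obj_map F P) \<and>
        (Comp D (obj_map F T) (obj_map F P) (obj_map F X) (mor_map F P X p) u = mor_map F T X f \<and>
         Comp D (obj_map F T) (obj_map F P) (obj_map F Y) (mor_map F P Y q) u = mor_map F T Y g)"
      using pr T fg C by (auto simp: is_product_def)
    then show ?thesis
      unfolding ex1_mor_iff[OF T C(3)] using T C fg by (simp add: mor_eq_iff flip: mor_Comp cong: conj_cong)
  qed
  then show ?thesis using C by (auto simp: is_product_def)
qed

lemma is_kernel_lift:
  assumes k: "is_kernel D (obj_map F X) (obj_map F Y) (mor_map F X Y f) (obj_map F K) (mor_map F K X k)"
    and C: "X \<in> Obj C" "Y \<in> Obj C" "K \<in> Obj C" "f \<in> Hom C X Y" "k \<in> Hom C K X"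
  shows "is_kernel C X Y f K k"
proof -
  have "\<exists>!u. u \<in> Hom C T K \<and> Comp C T K X k u = g"
    if T: "T \<in> Obj C" and g: "g \<in> Hom C T X" and z: "zero_mor C T Y (Comp C T X Y f g)" for T g
  proof -
    have "zero_mor D (obj_map F T) (obj_map F Y)
        (Comp D (obj_map F T) (obj_map F X) (obj_map F Y) (mor_map F X Y f) (mor_map F T X g))"
      using zero_mor_iff z T g C by (simp flip: mor_Comp)
    then have "\<exists>!u. u \<in> Hom D (obj_map F T) (obj_map F K) \<and>
        Comp D (obj_map F T) (obj_map F K) (obj_map F X) (mor_map F K X k) u = mor_map F T X g"
      using k T g C by (auto simp: is_kernel_def)
    then show ?thesis
      unfolding ex1_mor_iff[OF T C(3)] using T C g by (simp add: mor_eq_iff flip: mor_Comp cong: conj_cong)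
  qed
  moreover have "zero_mor C K Y (Comp C K X Y f k)"
    using k C zero_mor_iff[of K Y "Comp C K X Y f k"] by (simp add: is_kernel_def mor_Comp)
  ultimately show ?thesis using C by (auto simp: is_kernel_def)
qed

text \<open>The required product, kernel or cofactor exists in \<open>D\<close>; its vertex is isomorphic to an image
  \<open>F P\<close>, and the structure morphisms, corrected by this isomorphism, lift to \<open>C\<close>.\<close>

lemma products_kernels_normal_lift:
  assumes D: "products_kernels_normal D"
  shows "products_kernels_normal C"
  unfolding products_kernels_normal_def
proof (intro conjI ballI allI impI)
  fix X Y assume XY: "X \<in> Obj C" "Y \<in> Obj C"
  obtain P' p' q' where P': "is_product D (obj_map F X) (obj_map F Y) P' p' q'"
    using D XY unfolding products_kernels_normal_def by blast
  then have "P' \<in> Obj D" by (simp add: is_product_def)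
  then obtain P i j where P: "P \<in> Obj C" and i: "D.inverses (obj_map F P) P' i j" using obj_lift by blast
  let ?p = "Comp D (obj_map F P) P' (obj_map F X) p' i" and ?q = "Comp D (obj_map F P) P' (obj_map F Y) q' i"
  have pr: "is_product D (obj_map F X) (obj_map F Y) (obj_map F P) ?p ?q"
    using D.is_product_iso[OF P' i] XY by auto
  then have pq: "?p \<in> Hom D (obj_map F P) (obj_map F X)" "?q \<in> Hom D (obj_map F P) (obj_map F Y)"
    by (simp_all add: is_product_def)
  obtain p where "p \<in> Hom C P X" "mor_map F P X p = ?p" using mor_lift[OF pq(1) P XY(1)] .
  moreover obtain q where "q \<in> Hom C P Y" "mor_map F P Y q = ?q" using mor_lift[OF pq(2) P XY(2)] .
  ultimately show "\<exists>P p q. is_product C X Y P p q"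
    using is_product_lift[of X Y P p q] pr XY P by auto
next
  fix X Y f assume XY: "X \<in> Obj C" "Y \<in> Obj C" and f: "f \<in> Hom C X Y"
  obtain K' k' where K': "is_kernel D (obj_map F X) (obj_map F Y) (mor_map F X Y f) K' k'"
    using D XY f unfolding products_kernels_normal_def by blast
  then have "K' \<in> Obj D" by (simp add: is_kernel_def)
  then obtain K i j where K: "K \<in> Obj C" and i: "D.inverses (obj_map F K) K' i j" using obj_lift by blast
  let ?k = "Comp D (obj_map F K) K' (obj_map F X) k' i"
  have ker: "is_kernel D (obj_map F X) (obj_map F Y) (mor_map F X Y f) (obj_map F K) ?k"
    using D.is_kernel_iso[OF K' i] XY f by auto
  then have "?k \<in> Hom D (obj_map F K) (obj_map F X)" by (simp add: is_kernel_def)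
  then obtain k where "k \<in> Hom C K X" "mor_map F K X k = ?k" using mor_lift K XY(1) by metis
  then show "\<exists>K k. is_kernel C X Y f K k"
    using is_kernel_lift[of X Y f K k] ker XY K f by auto
next
  fix X Y f assume XY: "X \<in> Obj C" "Y \<in> Obj C" and m: "mono_mor C X Y f"
  have f: "f \<in> Hom C X Y" using m by (simp add: mono_mor_def)
  obtain Z' g' where Z': "Z' \<in> Obj D" and g': "g' \<in> Hom D (obj_map F Y) Z'"
    and ker': "is_kernel D (obj_map F Y) Z' g' (obj_map F X) (mor_map F X Y f)"
    using D XY mono_mor_image[OF m] unfolding products_kernels_normal_def by blast
  obtain Z i j where Z: "Z \<in> Obj C" and i: "D.inverses (obj_map F Z) Z' i j" using obj_lift[OF Z'] .
  let ?g = "Comp D (obj_map F Y) Z' (obj_map F Z) j g'"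
  have "is_kernel D (obj_map F Y) (obj_map F Z) ?g (obj_map F X) (mor_map F X Y f)"
    using D.is_kernel_postcompose_iso[OF ker' D.inverses_sym[OF i]] XY g' by auto
  moreover have gin: "?g \<in> Hom D (obj_map F Y) (obj_map F Z)"
    using XY Z Z' g' D.inversesD[OF i] by auto
  moreover obtain g where g: "g \<in> Hom C Y Z" and "mor_map F Y Z g = ?g" using mor_lift[OF gin XY(2) Z] .
  ultimately have "is_kernel C Y Z g X f"
    using is_kernel_lift[of Y Z g X f] XY Z f by simp
  then show "\<exists>Z\<in>Obj C. \<exists>g\<in>Hom C Y Z. is_kernel C Y Z g X f"
    using Z g by blast
qed

end

lemma weak_equiv_iff: "weak_equiv C D F \<longleftrightarrow> weak_equivalence C D F"
  by (auto simp: weak_equiv_def weak_equivalence_def weak_equiv_axioms_def cat_loc_def)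

lemma abelian_category_lift:
  assumes "weak_equivalence C D F" "abelian_category D"
  shows "abelian_category C"
proof -
  interpret F: weak_equiv C D F using assms(1) by (simp add: weak_equiv_iff)
  interpret op: weak_equiv "op_cat C" "op_cat D" "op_functor F"
    using weak_equivalence_op[OF assms(1)] by (simp add: weak_equiv_iff)
  show ?thesis
    using assms(2) F.C.category F.products_kernels_normal_lift op.products_kernels_normal_lift
      F.zero_object_preimage unfolding abelian_category_def by metis
qed

context weak_equiv
begin

text \<open>Each \<open>Y\<close> gets a chosen \<open>G Y\<close> with an isomorphism \<open>e Y : F (G Y) \<rightarrow> Y\<close>, and \<open>G\<close> sends \<open>h : X \<rightarrow> Y\<close> to
  the unique lift of \<open>(e Y)\<^sup>-\<^sup>1 \<circ> h \<circ> e X\<close>.  That \<open>G\<close> is again fully faithful and essentially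
  surjective allows properties of \<open>C\<close> to be transferred to \<open>D\<close>.\<close>

lemma quasi_inverse:
  obtains G \<eta> \<epsilon> where "weak_equivalence D C G"
    "natural_iso C C id_functor (comp_functor G F) \<eta>"
    "natural_iso D D (comp_functor F G) id_functor \<epsilon>"
proof -
  have "\<exists>X i j. X \<in> Obj C \<and> D.inverses (obj_map F X) Y i j" if "Y \<in> Obj D" for Y
    using obj_lift[OF that] by blast
  then obtain G0 e e' where G0: "\<And>Y. Y \<in> Obj D \<Longrightarrow> G0 Y \<in> Obj C"
    and inv: "\<And>Y. Y \<in> Obj D \<Longrightarrow> D.inverses (obj_map F (G0 Y)) Y (e Y) (e' Y)" by metis
  note eD = D.inversesD[OF inv]
  define lift where "lift X Y h = the_inv_into (Hom C X Y) (mor_map F X Y) h" for X Y h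
  have lift: "lift X Y h \<in> Hom C X Y" "mor_map F X Y (lift X Y h) = h"
    if "X \<in> Obj C" "Y \<in> Obj C" "h \<in> Hom D (obj_map F X) (obj_map F Y)" for X Y h
  proof -
    have bij: "bij_betw (mor_map F X Y) (Hom C X Y) (Hom D (obj_map F X) (obj_map F Y))"
      using ff that by (simp add: fully_faithful_def)
    show "lift X Y h \<in> Hom C X Y"
      using bij_betw_the_inv_into[OF bij] that(3) unfolding lift_def bij_betw_def by blast
    show "mor_map F X Y (lift X Y h) = h"
      using f_the_inv_into_f_bij_betw[OF bij] that(3) by (simp add: lift_def)
  qed
  define conj where "conj X Y h = Comp D (obj_map F (G0 X)) Y (obj_map F (G0 Y)) (e' Y)
     (Comp D (obj_map F (G0 X)) X Y h (e X))" for X Y h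
  have conj: "conj X Y h \<in> Hom D (obj_map F (G0 X)) (obj_map F (G0 Y))"
    "Comp D (obj_map F (G0 X)) (obj_map F (G0 Y)) Y (e Y) (conj X Y h) = Comp D (obj_map F (G0 X)) X Y h (e X)"
    if "X \<in> Obj D" "Y \<in> Obj D" "h \<in> Hom D X Y" for X Y h
    using that eD[of X] eD[of Y] G0 D.cancel_left(2)[OF inv[of Y], of "obj_map F (G0 X)"]
    unfolding conj_def by simp_all
  have cancel_e: "a = b" if "Comp D T (obj_map F (G0 Y)) Y (e Y) a = Comp D T (obj_map F (G0 Y)) Y (e Y) b"
    "a \<in> Hom D T (obj_map F (G0 Y))" "b \<in> Hom D T (obj_map F (G0 Y))" "Y \<in> Obj D" "T \<in> Obj D" for a b T Y
    using that D.cancel_left(1)[OF inv] by metis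
  define G where "G = \<lparr>obj_map = G0, mor_map = (\<lambda>X Y h. lift (G0 X) (G0 Y) (conj X Y h))\<rparr>"
  have Gin: "lift (G0 X) (G0 Y) (conj X Y h) \<in> Hom C (G0 X) (G0 Y)"
    and FG: "mor_map F (G0 X) (G0 Y) (lift (G0 X) (G0 Y) (conj X Y h)) = conj X Y h"
    if "X \<in> Obj D" "Y \<in> Obj D" "h \<in> Hom D X Y" for X Y h
    using lift[of "G0 X" "G0 Y" "conj X Y h"] conj that G0 by auto
  have "lift (G0 X) (G0 X) (conj X X (Id D X)) = Id C (G0 X)" if X: "X \<in> Obj D" for X
  proof -
    have "conj X X (Id D X) = Id D (obj_map F (G0 X))"
      using X eD[OF X] G0[OF X] by (simp add: conj_def)
    then show ?thesis using FG[of X X "Id D X"] Gin[of X X "Id D X"] X G0[OF X]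
        mor_eq_iff[of "lift (G0 X) (G0 X) (conj X X (Id D X))" "G0 X" "G0 X" "Id C (G0 X)"] by auto
  qed
  moreover have "lift (G0 X) (G0 Z) (conj X Z (Comp D X Y Z g f)) =
     Comp C (G0 X) (G0 Y) (G0 Z) (lift (G0 Y) (G0 Z) (conj Y Z g)) (lift (G0 X) (G0 Y) (conj X Y f))"
    if X: "X \<in> Obj D" "Y \<in> Obj D" "Z \<in> Obj D" and fg: "f \<in> Hom D X Y" "g \<in> Hom D Y Z" for X Y Z f g
  proof -
    let ?X = "obj_map F (G0 X)" and ?Y = "obj_map F (G0 Y)" and ?Z = "obj_map F (G0 Z)"
    have c: "conj X Z (Comp D X Y Z g f) = Comp D ?X ?Y ?Z (conj Y Z g) (conj X Y f)"
    proof (rule cancel_e)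
      have "Comp D ?X ?Z Z (e Z) (Comp D ?X ?Y ?Z (conj Y Z g) (conj X Y f)) =
          Comp D ?X ?Y Z (Comp D ?Y ?Z Z (e Z) (conj Y Z g)) (conj X Y f)"
        by (rule D.Comp_assoc[symmetric]) (use X fg conj(1) G0 eD[OF X(3)] in auto)
      also have "\<dots> = Comp D ?X Y Z g (Comp D ?X ?Y Y (e Y) (conj X Y f))"
        using X fg conj G0 eD[OF X(2)] by (simp add: D.Comp_assoc)
      also have "\<dots> = Comp D ?X X Z (Comp D X Y Z g f) (e X)"
        using X fg conj G0 eD[OF X(1)] by (simp add: D.Comp_assoc)
      finally show "Comp D ?X ?Z Z (e Z) (conj X Z (Comp D X Y Z g f)) =
          Comp D ?X ?Z Z (e Z) (Comp D ?X ?Y ?Z (conj Y Z g) (conj X Y f))"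
        using conj(2) X fg by simp
    qed (use X fg conj G0 in auto)
    have h: "Comp D X Y Z g f \<in> Hom D X Z" using X fg by simp
    have "mor_map F (G0 X) (G0 Z) (lift (G0 X) (G0 Z) (conj X Z (Comp D X Y Z g f))) =
      mor_map F (G0 X) (G0 Z)
        (Comp C (G0 X) (G0 Y) (G0 Z) (lift (G0 Y) (G0 Z) (conj Y Z g)) (lift (G0 X) (G0 Y) (conj X Y f)))"
      by (subst FG[OF X(1,3) h]) (use X fg Gin FG G0 c in \<open>simp add: mor_Comp\<close>)
    then show ?thesis using mor_eq_iff X fg Gin G0 h C.Comp_in by meson
  qed
  ultimately have functorG: "is_functor D C G"
    using G0 Gin by (auto simp: is_functor_def G_def)
  have "bij_betw (mor_map G X Y) (Hom D X Y) (Hom C (obj_map G X) (obj_map G Y))"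
    if XY: "X \<in> Obj D" "Y \<in> Obj D" for X Y
  proof (rule bij_betw_byWitness[where f' = "\<lambda>h. Comp D X (obj_map F (G0 Y)) Y (e Y)
      (Comp D X (obj_map F (G0 X)) (obj_map F (G0 Y)) (mor_map F (G0 X) (G0 Y) h) (e' X))"])
    let ?X = "obj_map F (G0 X)" and ?Y = "obj_map F (G0 Y)"
    let ?w = "\<lambda>h. Comp D X ?Y Y (e Y) (Comp D X ?X ?Y (mor_map F (G0 X) (G0 Y) h) (e' X))"
    show "\<forall>f\<in>Hom D X Y. ?w (mor_map G X Y f) = f"
      using XY G0 FG eD[OF XY(1)] eD[OF XY(2)] D.cancel_right(1)[OF inv[OF XY(1)]]
      by (simp add: G_def conj conj(2)  flip: D.Comp_assoc)
    show "mor_map G X Y ` Hom D X Y \<subseteq> Hom C (obj_map G X) (obj_map G Y)"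
      using Gin XY by (auto simp: G_def)
    show win: "?w ` Hom C (obj_map G X) (obj_map G Y) \<subseteq> Hom D X Y"
      using XY G0 eD[OF XY(1)] eD[OF XY(2)] by (auto simp: G_def)
    show "\<forall>h\<in>Hom C (obj_map G X) (obj_map G Y). mor_map G X Y (?w h) = h"
    proof
      fix h assume h: "h \<in> Hom C (obj_map G X) (obj_map G Y)"
      then have w: "?w h \<in> Hom D X Y" using win by blast
      have "conj X Y (?w h) = mor_map F (G0 X) (G0 Y) h"
        using h XY G0 eD[OF XY(1)] eD[OF XY(2)] D.cancel_left(1)[OF inv[OF XY(2)]]
        by (simp add: G_def conj_def D.Comp_assoc)
      then show "mor_map G X Y (?w h) = h"
        using FG[OF XY w] Gin[OF XY w] h mor_eq_iff G0 XY unfolding G_def by simp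
    qed
  qed
  then have ffG: "fully_faithful D C G" by (simp add: fully_faithful_def)
  define eta where "eta X = lift X (G0 (obj_map F X)) (e' (obj_map F X))" for X
  have etaF: "mor_map F X (G0 (obj_map F X)) (eta X) = e' (obj_map F X)"
    and eta_in: "eta X \<in> Hom C X (G0 (obj_map F X))" if "X \<in> Obj C" for X
    using lift[of X "G0 (obj_map F X)" "e' (obj_map F X)"] G0 that eD[of "obj_map F X"]
    by (auto simp: eta_def)
  \<comment> \<open>the inverse of \<open>eta X\<close> is the lift of \<open>e (F X)\<close>\<close>
  have eta_iso: "\<exists>j. C.inverses X (G0 (obj_map F X)) (eta X) j" if X: "X \<in> Obj C" for X
  proof -
    let ?X = "obj_map F X"
    have FX: "?X \<in> Obj D" using X by simp
    obtain j where j: "j \<in> Hom C (G0 ?X) X" "mor_map F (G0 ?X) X j = e ?X"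
      using mor_lift[OF eD(3)[OF FX] G0[OF FX] X] .
    have "mor_map F X X (Comp C X (G0 ?X) X j (eta X)) = mor_map F X X (Id C X)"
      using j etaF eta_in eD[OF FX] G0[OF FX] X by (simp add: mor_Comp)
    then have 1: "Comp C X (G0 ?X) X j (eta X) = Id C X"
      using mor_eq_iff j eta_in X G0[OF FX] by (meson C.Comp_in C.Id_in)
    have "mor_map F (G0 ?X) (G0 ?X) (Comp C (G0 ?X) X (G0 ?X) (eta X) j) = mor_map F (G0 ?X) (G0 ?X) (Id C (G0 ?X))"
      using j etaF eta_in eD[OF FX] G0[OF FX] X by (simp add: mor_Comp)
    then have "Comp C (G0 ?X) X (G0 ?X) (eta X) j = Id C (G0 ?X)"
      using mor_eq_iff j eta_in X G0[OF FX] by (meson C.Comp_in C.Id_in)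
    then show ?thesis using 1 j eta_in X G0[OF FX] by (auto simp: C.inverses_def)
  qed
  have "essentially_surjective D C G"
    unfolding essentially_surjective_def
  proof
    fix X assume X: "X \<in> Obj C"
    then obtain j where "C.inverses (G0 (obj_map F X)) X j (eta X)"
      using eta_iso C.inverses_sym by blast
    then have "iso_mor C (obj_map G (obj_map F X)) X j"
      using C.iso_mor_iff_inverses X G0[of "obj_map F X"] by (auto simp: G_def)
    then show "\<exists>Y\<in>Obj D. \<exists>f. iso_mor C (obj_map G Y) X f" using X by blast
  qed
  then have "weak_equivalence D C G"
    using functorG ffG C.category D.category by (simp add: weak_equivalence_def)
  moreover have "natural_iso D D (comp_functor F G) id_functor e"
    unfolding natural_iso_def
  proof (intro conjI ballI)
    fix X assume X: "X \<in> Obj D"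
    then show "iso_mor D (obj_map (comp_functor F G) X) (obj_map id_functor X) (e X)"
      using inv[OF X] D.iso_mor_iff_inverses[of "obj_map F (G0 X)" X] G0[OF X]
      by (auto simp: comp_functor_def id_functor_def G_def)
  next
    fix X Y f assume "X \<in> Obj D" "Y \<in> Obj D" "f \<in> Hom D X Y"
    then show "Comp D (obj_map (comp_functor F G) X) (obj_map id_functor X) (obj_map id_functor Y)
        (mor_map id_functor X Y f) (e X) =
      Comp D (obj_map (comp_functor F G) X) (obj_map (comp_functor F G) Y) (obj_map id_functor Y)
        (e Y) (mor_map (comp_functor F G) X Y f)"
      using conj(2) FG by (simp add: comp_functor_def id_functor_def G_def)
  qed
  moreover have "natural_iso C C id_functor (comp_functor G F) eta"
    unfolding natural_iso_def
  proof (intro conjI ballI)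
    fix X assume X: "X \<in> Obj C"
    then show "iso_mor C (obj_map id_functor X) (obj_map (comp_functor G F) X) (eta X)"
      using eta_iso[OF X] C.iso_mor_iff_inverses[of X "G0 (obj_map F X)"] G0[of "obj_map F X"]
      by (auto simp: comp_functor_def id_functor_def G_def)
  next
    fix X Y f assume X: "X \<in> Obj C" and Y: "Y \<in> Obj C" and f: "f \<in> Hom C X Y"
    let ?X = "obj_map F X" and ?Y = "obj_map F Y" and ?f = "mor_map F X Y f"
    let ?h = "lift (G0 ?X) (G0 ?Y) (conj ?X ?Y ?f)"
    have FX: "?X \<in> Obj D" "?Y \<in> Obj D" "?f \<in> Hom D ?X ?Y" using X Y f by auto
    note h = Gin[OF FX] and Fh = FG[OF FX]
    have "mor_map F X (G0 ?Y) (Comp C X (G0 ?X) (G0 ?Y) ?h (eta X)) =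
        mor_map F X (G0 ?Y) (Comp C X Y (G0 ?Y) (eta Y) f)"
      using X Y f FX h Fh eta_in etaF G0[OF FX(1)] G0[OF FX(2)] eD[OF FX(1)] eD[OF FX(2)]
      by (simp add: mor_Comp conj_def D.Comp_assoc)
    then have "Comp C X (G0 ?X) (G0 ?Y) ?h (eta X) = Comp C X Y (G0 ?Y) (eta Y) f"
      using mor_eq_iff X Y f h eta_in G0[OF FX(1)] G0[OF FX(2)] C.Comp_in by meson
    then show "Comp C (obj_map id_functor X) (obj_map (comp_functor G F) X) (obj_map (comp_functor G F) Y)
        (mor_map (comp_functor G F) X Y f) (eta X) =
      Comp C (obj_map id_functor X) (obj_map id_functor Y) (obj_map (comp_functor G F) Y)
        (eta Y) (mor_map id_functor X Y f)"
      by (simp add: comp_functor_def id_functor_def G_def)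
  qed
  ultimately show thesis using that by blast
qed

end

theorem weak_equivalence_imp_equivalence:
  assumes "weak_equivalence C D F"
  shows "equivalence_of_categories C D F"
proof -
  interpret F: weak_equiv C D F using assms by (simp add: weak_equiv_iff)
  obtain G \<eta> \<epsilon> where "weak_equivalence D C G"
    "natural_iso C C id_functor (comp_functor G F) \<eta>"
    "natural_iso D D (comp_functor F G) id_functor \<epsilon>"
    using F.quasi_inverse .
  then show ?thesis
    using assms unfolding equivalence_of_categories_def weak_equivalence_def by blast
qed

text \<open>Abelianness is reflected by fully faithful and essentially surjective functors, hence
  preserved by a functor whose quasi-inverse has these properties.\<close>

theorem abelian_category_transfer:
  assumes "weak_equivalence C D F" "abelian_category C"
  shows "abelian_category D"
proof -
  interpret F: weak_equiv C D F using assms by (simp add: weak_equiv_iff)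
  obtain G where "weak_equivalence D C G" using F.quasi_inverse by metis
  then show ?thesis using abelian_category_lift assms(2) by blast
qed

section \<open>Rational vector spaces\<close>

lemma rat_field_simps [simp]:
  "carrier rat_field = UNIV" "mult rat_field = (*)" "one rat_field = 1" "zero rat_field = 0"
  "add rat_field = (+)"
  by (simp_all add: rat_field_def)

lemma cring_rat_field: "cring rat_field"
proof (rule cringI)
  show "abelian_group rat_field"
    by (rule abelian_groupI) (auto simp: rat_field_def intro: exI[of _ "- x" for x :: rat])
  show "Group.comm_monoid rat_field"
    by (rule comm_monoidI) (auto simp: rat_field_def)
qed (simp add: rat_field_def distrib_right)

text \<open>The additive inverse of \<open>x\<close> is \<open>(-1) \<odot> x\<close>, so the existence of inverses follows from
  \<open>0 \<odot> x = \<zero>\<close> and distributivity.\<close>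

lemma rat_vector_spaceI:
  fixes V (structure)
  assumes "\<zero>\<^bsub>V\<^esub> \<in> carrier V"
    and "\<And>x y. x \<in> carrier V \<Longrightarrow> y \<in> carrier V \<Longrightarrow> x \<oplus> y \<in> carrier V"
    and "\<And>c x. x \<in> carrier V \<Longrightarrow> c \<odot> x \<in> carrier V"
    and "\<And>x y z. x \<in> carrier V \<Longrightarrow> y \<in> carrier V \<Longrightarrow> z \<in> carrier V \<Longrightarrow> (x \<oplus> y) \<oplus> z = x \<oplus> (y \<oplus> z)"
    and "\<And>x y. x \<in> carrier V \<Longrightarrow> y \<in> carrier V \<Longrightarrow> x \<oplus> y = y \<oplus> x"
    and "\<And>x. x \<in> carrier V \<Longrightarrow> \<zero>\<^bsub>V\<^esub> \<oplus> x = x"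
    and "\<And>x. x \<in> carrier V \<Longrightarrow> 0 \<odot> x = \<zero>\<^bsub>V\<^esub>"
    and "\<And>a b x. x \<in> carrier V \<Longrightarrow> (a + b) \<odot> x = a \<odot> x \<oplus> b \<odot> x"
    and "\<And>a x y. x \<in> carrier V \<Longrightarrow> y \<in> carrier V \<Longrightarrow> a \<odot> (x \<oplus> y) = a \<odot> x \<oplus> a \<odot> y"
    and "\<And>a b x. x \<in> carrier V \<Longrightarrow> (a * b) \<odot> x = a \<odot> (b \<odot> x)"
    and "\<And>x. x \<in> carrier V \<Longrightarrow> 1 \<odot> x = x"
  shows "rat_vector_space V"
proof (rule moduleI)
  show "abelian_group V"
  proof (rule abelian_groupI)
    fix x assume x: "x \<in> carrier V"
    have "(-1) \<odot> x \<oplus> x = (-1 + 1) \<odot> x" using assms(8)[of x "-1" 1] assms(11) x by simp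
    then have "(-1) \<odot> x \<oplus> x = \<zero>\<^bsub>V\<^esub>" using assms(7) x by simp
    then show "\<exists>y\<in>carrier V. y \<oplus> x = \<zero>\<^bsub>V\<^esub>" using assms(3) x by blast
  qed (use assms in auto)
qed (use assms cring_rat_field in auto)

text \<open>The facts of this locale restate the axioms with the operations of type \<^typ>\<open>rat\<close>, so that the simplifier
  can compute with scalars.\<close>

locale rat_vs =
  fixes V :: "(rat, 'v, 'c) module_scheme" (structure)
  assumes vector_space: "rat_vector_space V"
begin

interpretation module rat_field V by (fact vector_space)

lemma zero_in [simp, intro]: "\<zero> \<in> carrier V" by simp

lemma add_in [simp, intro]: "x \<in> carrier V \<Longrightarrow> y \<in> carrier V \<Longrightarrow> x \<oplus> y \<in> carrier V" by simp

lemma scale_in [simp, intro]: "x \<in> carrier V \<Longrightarrow> c \<odot> x \<in> carrier V"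
  using smult_closed[of c x] by simp

lemma zero_add [simp]: "x \<in> carrier V \<Longrightarrow> \<zero> \<oplus> x = x"
  and add_zero [simp]: "x \<in> carrier V \<Longrightarrow> x \<oplus> \<zero> = x"
  by simp_all

lemma add_ac:
  "x \<in> carrier V \<Longrightarrow> y \<in> carrier V \<Longrightarrow> z \<in> carrier V \<Longrightarrow> (x \<oplus> y) \<oplus> z = x \<oplus> (y \<oplus> z)"
  "x \<in> carrier V \<Longrightarrow> y \<in> carrier V \<Longrightarrow> x \<oplus> y = y \<oplus> x"
  "x \<in> carrier V \<Longrightarrow> y \<in> carrier V \<Longrightarrow> z \<in> carrier V \<Longrightarrow> x \<oplus> (y \<oplus> z) = y \<oplus> (x \<oplus> z)"
  by (simp_all add: a_ac)

lemma one_scale [simp]: "x \<in> carrier V \<Longrightarrow> 1 \<odot> x = x"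
  using smult_one[of x] by simp

lemma zero_scale [simp]: "x \<in> carrier V \<Longrightarrow> 0 \<odot> x = \<zero>"
  using smult_l_null[of x] by simp

lemma scale_zero [simp]: "c \<odot> \<zero> = \<zero>"
  using smult_r_null[of c] by simp

lemma scale_add [simp]:
  "x \<in> carrier V \<Longrightarrow> y \<in> carrier V \<Longrightarrow> c \<odot> (x \<oplus> y) = c \<odot> x \<oplus> c \<odot> y"
  using smult_r_distr[of c x y] by simp

lemma scale_scale [simp]: "x \<in> carrier V \<Longrightarrow> a \<odot> (b \<odot> x) = (a * b) \<odot> x"
  using smult_assoc1[of a b x] by simp

lemma add_scale: "x \<in> carrier V \<Longrightarrow> (a + b) \<odot> x = a \<odot> x \<oplus> b \<odot> x"
  using smult_l_distr[of a b x] by simp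

text \<open>Multiples of the same vector are merged; together with \<open>add_ac\<close> these equations normalise
  linear combinations.\<close>

lemma add_collect:
  "x \<in> carrier V \<Longrightarrow> a \<odot> x \<oplus> b \<odot> x = (a + b) \<odot> x"
  "x \<in> carrier V \<Longrightarrow> y \<in> carrier V \<Longrightarrow> a \<odot> x \<oplus> (b \<odot> x \<oplus> y) = (a + b) \<odot> x \<oplus> y"
  by (simp_all add: add_scale flip: add_ac(1))

lemma add_collect1:
  "x \<in> carrier V \<Longrightarrow> x \<oplus> b \<odot> x = (1 + b) \<odot> x"
  "x \<in> carrier V \<Longrightarrow> b \<odot> x \<oplus> x = (b + 1) \<odot> x"
  "x \<in> carrier V \<Longrightarrow> y \<in> carrier V \<Longrightarrow> x \<oplus> (b \<odot> x \<oplus> y) = (1 + b) \<odot> x \<oplus> y"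
  "x \<in> carrier V \<Longrightarrow> y \<in> carrier V \<Longrightarrow> b \<odot> x \<oplus> (x \<oplus> y) = (b + 1) \<odot> x \<oplus> y"
  using add_collect(2)[of x y 1 b] add_collect(2)[of x y b 1] add_collect(1)[of x 1 b]
    add_collect(1)[of x b 1] by simp_all

lemma minus_eq: "x \<in> carrier V \<Longrightarrow> y \<in> carrier V \<Longrightarrow> x \<ominus> y = x \<oplus> (-1) \<odot> y"
  using minus_equality[of "(-1) \<odot> y" y] by (simp add: a_minus_def add_collect1)

lemma eq_iff_diff_zero:
  "x \<in> carrier V \<Longrightarrow> y \<in> carrier V \<Longrightarrow> x = y \<longleftrightarrow> x \<oplus> (-1) \<odot> y = \<zero>"
proof
  assume *: "x \<in> carrier V" "y \<in> carrier V" and "x \<oplus> (-1) \<odot> y = \<zero>"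
  then have "(x \<oplus> (-1) \<odot> y) \<oplus> y = y" by simp
  then show "x = y" using * by (simp add: add_ac(1) add_collect1)
qed (simp add: add_collect1)

end

definition subspace :: "(rat, 'v, 'c) module_scheme \<Rightarrow> 'v set \<Rightarrow> bool" where
  "subspace V S \<longleftrightarrow> S \<subseteq> carrier V \<and> \<zero>\<^bsub>V\<^esub> \<in> S \<and> (\<forall>x\<in>S. \<forall>y\<in>S. x \<oplus>\<^bsub>V\<^esub> y \<in> S) \<and>
     (\<forall>c. \<forall>x\<in>S. c \<odot>\<^bsub>V\<^esub> x \<in> S)"

lemma subspaceD:
  assumes "subspace V S"
  shows "S \<subseteq> carrier V" "\<zero>\<^bsub>V\<^esub> \<in> S" "x \<in> S \<Longrightarrow> y \<in> S \<Longrightarrow> x \<oplus>\<^bsub>V\<^esub> y \<in> S" "x \<in> S \<Longrightarrow> c \<odot>\<^bsub>V\<^esub> x \<in> S"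
  using assms by (auto simp: subspace_def)

lemma subspace_vector_space:
  assumes "rat_vector_space V" "subspace V S"
  shows "rat_vector_space (V\<lparr>carrier := S\<rparr>)"
proof -
  interpret rat_vs V by (rule rat_vs.intro[OF assms(1)])
  note S = subspaceD[OF assms(2)]
  have [simp]: "x \<in> carrier V" if "x \<in> S" for x using that S(1) by blast
  show ?thesis by (rule rat_vector_spaceI) (use S in \<open>auto simp: add_scale add_ac\<close>)
qed

text \<open>All laws hold in \<open>W\<close> because they hold for representatives in \<open>V\<close>.  Quotients, tensor products
  and copies of a space on another type are obtained in this way.\<close>

lemma rat_vector_space_image:
  assumes V: "rat_vector_space V" and c: "carrier W = r ` carrier V"
    and a: "\<And>x y. x \<in> carrier V \<Longrightarrow> y \<in> carrier V \<Longrightarrow> r x \<oplus>\<^bsub>W\<^esub> r y = r (x \<oplus>\<^bsub>V\<^esub> y)"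
    and s: "\<And>k x. x \<in> carrier V \<Longrightarrow> k \<odot>\<^bsub>W\<^esub> r x = r (k \<odot>\<^bsub>V\<^esub> x)"
    and z: "\<zero>\<^bsub>W\<^esub> = r \<zero>\<^bsub>V\<^esub>"
  shows "rat_vector_space W" "linear_map V W r"
proof -
  interpret rat_vs V by (rule rat_vs.intro[OF V])
  show "rat_vector_space W"
    by (rule rat_vector_spaceI) (auto simp: c a s z add_scale add_ac)
  show "linear_map V W r" by (auto simp: linear_map_def c a s)
qed

lemma linear_mapD:
  assumes "linear_map V W f"
  shows "x \<in> carrier V \<Longrightarrow> f x \<in> carrier W"
    "x \<in> carrier V \<Longrightarrow> y \<in> carrier V \<Longrightarrow> f (x \<oplus>\<^bsub>V\<^esub> y) = f x \<oplus>\<^bsub>W\<^esub> f y"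
    "x \<in> carrier V \<Longrightarrow> f (c \<odot>\<^bsub>V\<^esub> x) = c \<odot>\<^bsub>W\<^esub> f x"
  using assms by (auto simp: linear_map_def)

lemma linear_map_zero:
  assumes "linear_map V W f" "rat_vector_space V" "rat_vector_space W"
  shows "f \<zero>\<^bsub>V\<^esub> = \<zero>\<^bsub>W\<^esub>"
proof -
  interpret V: rat_vs V by (rule rat_vs.intro[OF assms(2)])
  interpret W: rat_vs W by (rule rat_vs.intro[OF assms(3)])
  show ?thesis using linear_mapD[OF assms(1)] V.zero_scale[of "\<zero>\<^bsub>V\<^esub>"] W.zero_scale V.zero_in by metis
qed

lemma linear_map_comp:
  "linear_map V W f \<Longrightarrow> linear_map W X g \<Longrightarrow> linear_map V X (\<lambda>x. g (f x))"
  by (auto simp: linear_map_def Pi_def)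

lemma linear_map_id: "linear_map V V (\<lambda>x. x)"
  by (auto simp: linear_map_def)

lemma linear_map_cong:
  assumes "rat_vector_space V" "linear_map V W f" "\<And>x. x \<in> carrier V \<Longrightarrow> f x = g x"
  shows "linear_map V W g"
proof -
  interpret rat_vs V by (rule rat_vs.intro[OF assms(1)])
  show ?thesis using assms(2,3) by (auto simp: linear_map_def Pi_def)
qed

lemma linear_map_const_zero: "rat_vector_space W \<Longrightarrow> linear_map V W (\<lambda>x. \<zero>\<^bsub>W\<^esub>)"
proof -
  assume "rat_vector_space W"
  then interpret rat_vs W by (rule rat_vs.intro)
  show ?thesis by (auto simp: linear_map_def)
qed

lemma linear_map_add:
  assumes "rat_vector_space W" "linear_map V W f" "linear_map V W g"
  shows "linear_map V W (\<lambda>x. f x \<oplus>\<^bsub>W\<^esub> g x)"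
proof -
  interpret rat_vs W by (rule rat_vs.intro[OF assms(1)])
  show ?thesis using assms(2,3) by (auto simp: linear_map_def Pi_def add_ac)
qed

lemma linear_map_scale:
  assumes "rat_vector_space W" "linear_map V W f"
  shows "linear_map V W (\<lambda>x. c \<odot>\<^bsub>W\<^esub> f x)"
proof -
  interpret rat_vs W by (rule rat_vs.intro[OF assms(1)])
  show ?thesis using assms(2) by (auto simp: linear_map_def Pi_def mult.commute)
qed

lemma restrict_in_linear_maps:
  "rat_vector_space V \<Longrightarrow> linear_map V W f \<Longrightarrow> restrict f (carrier V) \<in> linear_maps V W"
  unfolding linear_maps_def using linear_map_cong[of V W f "restrict f (carrier V)"] by simp

lemma linear_maps_eqI:
  "f \<in> linear_maps V W \<Longrightarrow> g \<in> linear_maps V W' \<Longrightarrow> (\<And>x. x \<in> carrier V \<Longrightarrow> f x = g x) \<Longrightarrow> f = g"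
  unfolding linear_maps_def by (auto intro: extensionalityI)

lemma linear_mapsD: "f \<in> linear_maps V W \<Longrightarrow> linear_map V W f"
  by (simp add: linear_maps_def)

lemma linear_maps_compose:
  "rat_vector_space V \<Longrightarrow> f \<in> linear_maps V W \<Longrightarrow> g \<in> linear_maps W X \<Longrightarrow>
     compose (carrier V) g f \<in> linear_maps V X"
  unfolding compose_def
  by (rule restrict_in_linear_maps, assumption, rule linear_map_comp[OF linear_mapsD linear_mapsD])

lemma linear_map_kernel_subspace:
  assumes "rat_vector_space V" "rat_vector_space W" "linear_map V W f"
  shows "subspace V {x \<in> carrier V. f x = \<zero>\<^bsub>W\<^esub>}"
proof -
  interpret V: rat_vs V by (rule rat_vs.intro[OF assms(1)])
  interpret W: rat_vs W by (rule rat_vs.intro[OF assms(2)])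
  show ?thesis using linear_mapD[OF assms(3)] linear_map_zero[OF assms(3,1,2)] by (auto simp: subspace_def)
qed

lemma linear_map_image_subspace:
  assumes "rat_vector_space V" "rat_vector_space W" "linear_map V W f"
  shows "subspace W (f ` carrier V)"
proof -
  interpret V: rat_vs V by (rule rat_vs.intro[OF assms(1)])
  interpret W: rat_vs W by (rule rat_vs.intro[OF assms(2)])
  note f = linear_mapD[OF assms(3)]
  show ?thesis
    unfolding subspace_def
  proof (intro conjI ballI allI)
    show "f ` carrier V \<subseteq> carrier W" using f(1) by blast
    show "\<zero>\<^bsub>W\<^esub> \<in> f ` carrier V"
      using imageI[of "\<zero>\<^bsub>V\<^esub>" "carrier V" f] linear_map_zero[OF assms(3,1,2)] by simp
    fix x assume "x \<in> f ` carrier V"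
    then obtain a where a: "a \<in> carrier V" "x = f a" by blast
    show "c \<odot>\<^bsub>W\<^esub> x \<in> f ` carrier V" for c
      by (rule image_eqI[of _ _ "c \<odot>\<^bsub>V\<^esub> a"]) (use a f in simp_all)
    fix y assume "y \<in> f ` carrier V"
    then obtain b where b: "b \<in> carrier V" "y = f b" by blast
    show "x \<oplus>\<^bsub>W\<^esub> y \<in> f ` carrier V"
      by (rule image_eqI[of _ _ "a \<oplus>\<^bsub>V\<^esub> b"]) (use a b f in simp_all)
  qed
qed

lemma linear_map_inverse:
  assumes "rat_vector_space V" "linear_map V W f" "bij_betw f (carrier V) (carrier W)"
  shows "linear_map W V (inv_into (carrier V) f)"
proof -
  interpret rat_vs V by (rule rat_vs.intro[OF assms(1)])
  note f = linear_mapD[OF assms(2)]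
  have inj: "inj_on f (carrier V)" and im: "f ` carrier V = carrier W"
    using assms(3) by (auto simp: bij_betw_def)
  have inv: "inv_into (carrier V) f (f x) = x" if "x \<in> carrier V" for x
    using inj that by simp
  show ?thesis
    unfolding linear_map_def
  proof (intro conjI ballI allI funcsetI)
    fix x assume "x \<in> carrier W"
    then obtain a where a: "a \<in> carrier V" "x = f a" using im by blast
    show "inv_into (carrier V) f x \<in> carrier V" using a inv by simp
    show "inv_into (carrier V) f (c \<odot>\<^bsub>W\<^esub> x) = c \<odot>\<^bsub>V\<^esub> inv_into (carrier V) f x" for c
      using inv[of "c \<odot>\<^bsub>V\<^esub> a"] a inv f by simp
    fix y assume "y \<in> carrier W"
    then obtain b where b: "b \<in> carrier V" "y = f b" using im by blast
    show "inv_into (carrier V) f (x \<oplus>\<^bsub>W\<^esub> y) = inv_into (carrier V) f x \<oplus>\<^bsub>V\<^esub> inv_into (carrier V) f y"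
      using inv[of "a \<oplus>\<^bsub>V\<^esub> b"] a b inv f by simp
  qed
qed

lemma infinite_times_lepoll:
  assumes "infinite U" "A \<lesssim> U" "B \<lesssim> U"
  shows "A \<times> B \<lesssim> U"
proof -
  have "U \<times> U \<approx> U"
    using card_of_Times_same_infinite[OF assms(1)] by (simp add: eqpoll_iff_card_of_ordIso)
  then show ?thesis using times_lepoll_mono[OF assms(2,3)] by (meson lepoll_trans2)
qed

text \<open>The objects of the category of vector spaces live on one fixed type.  Spaces built on
  another type, such as products or vacua of modules, enter it by transport of structure
  along an injection into \<open>U\<close>.\<close>

lemma vector_space_copy:
  fixes M :: "(rat, 'm, 'c) module_scheme" and U :: "'a set"
  assumes M: "rat_vector_space M" and U: "carrier M \<lesssim> U"
  obtains V :: "(rat, 'a) module" and h k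
  where "rat_vector_space V" "carrier V \<lesssim> U" "linear_map M V h" "linear_map V M k"
    "\<forall>x\<in>carrier M. k (h x) = x" "\<forall>y\<in>carrier V. h (k y) = y"
proof -
  interpret M: rat_vs M by (rule rat_vs.intro[OF M])
  obtain h where h: "inj_on h (carrier M)" "h ` carrier M \<subseteq> U" using U by (auto simp: lepoll_def)
  define k where "k = inv_into (carrier M) h"
  have kh: "k (h x) = x" if "x \<in> carrier M" for x using that h(1) by (simp add: k_def)
  define V :: "(rat, 'a) module" where
    "V = \<lparr>carrier = h ` carrier M, mult = undefined, one = undefined, zero = h \<zero>\<^bsub>M\<^esub>,
      add = (\<lambda>a b. h (k a \<oplus>\<^bsub>M\<^esub> k b)), smult = (\<lambda>c a. h (c \<odot>\<^bsub>M\<^esub> k a))\<rparr>"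
  have V: "rat_vector_space V" "linear_map M V h"
    using rat_vector_space_image[OF M, of V h] by (simp_all add: V_def kh)
  have bij: "bij_betw h (carrier M) (carrier V)" using h(1) by (simp add: V_def bij_betw_def)
  have "carrier V \<lesssim> U" using h(2) by (simp add: V_def subset_imp_lepoll)
  moreover have "linear_map V M k" unfolding k_def by (rule linear_map_inverse[OF M V(2) bij])
  moreover have "h (k y) = y" if "y \<in> carrier V" for y using that kh by (auto simp: V_def)
  ultimately show thesis using that V kh by blast
qed

section \<open>The abelian category of vector spaces\<close>

lemma lepoll_subset: "A \<subseteq> B \<Longrightarrow> B \<lesssim> U \<Longrightarrow> A \<lesssim> U"
  by (rule lepoll_trans[OF subset_imp_lepoll])

text \<open>For extensional maps the category axioms are properties of \<^const>\<open>compose\<close>, so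
  only closure under identities and composition is left to prove.\<close>

lemma concrete_category:
  assumes vs: "\<And>V. V \<in> Obj D \<Longrightarrow> rat_vector_space V"
    and hom: "\<And>V W. V \<in> Obj D \<Longrightarrow> W \<in> Obj D \<Longrightarrow> Hom D V W \<subseteq> linear_maps V W"
    and idm: "\<And>V. V \<in> Obj D \<Longrightarrow> (\<lambda>x\<in>carrier V. x) \<in> Hom D V V"
    and cmp: "\<And>V W X f g. V \<in> Obj D \<Longrightarrow> W \<in> Obj D \<Longrightarrow> X \<in> Obj D \<Longrightarrow> f \<in> Hom D V W \<Longrightarrow>
        g \<in> Hom D W X \<Longrightarrow> compose (carrier V) g f \<in> Hom D V X"
    and Id: "Id D = (\<lambda>V. \<lambda>x\<in>carrier V. x)"
    and Comp: "Comp D = (\<lambda>V W X g f. compose (carrier V) g f)"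
  shows "category D"
proof -
  have f: "f \<in> carrier V \<rightarrow> carrier W" "f \<in> extensional (carrier V)"
    if "V \<in> Obj D" "W \<in> Obj D" "f \<in> Hom D V W" for V W f
    using hom[OF that(1,2)] that(3) by (auto simp: linear_maps_def linear_map_def)
  show ?thesis
    unfolding category_def Id Comp
  proof (intro conjI ballI)
    fix X Y Z T g h k assume "X \<in> Obj D" "Y \<in> Obj D" "g \<in> Hom D X Y"
    then show "compose (carrier X) (compose (carrier Y) k h) g = compose (carrier X) k (compose (carrier X) h g)"
      using compose_assoc[OF f(1)] by metis
  qed (auto simp: idm cmp f Id_compose[OF f(1) f(2)] compose_Id[OF f(1) f(2)])
qed

lemma vect_cat_sel [simp]:
  "Obj (vect_cat U) = {V. rat_vector_space V \<and> carrier V \<lesssim> U}" "Hom (vect_cat U) = linear_maps"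
  "Id (vect_cat U) = (\<lambda>V. \<lambda>x\<in>carrier V. x)"
  "Comp (vect_cat U) = (\<lambda>V W X g f. compose (carrier V) g f)"
  by (simp_all add: vect_cat_def)

lemma category_vect_cat: "category (vect_cat U)"
  by (rule concrete_category)
    (auto simp: linear_maps_compose linear_map_id intro: restrict_in_linear_maps)

lemma op_cat_sel [simp]:
  "Obj (op_cat C) = Obj C" "Hom (op_cat C) X Y = Hom C Y X" "Id (op_cat C) = Id C"
  "Comp (op_cat C) X Y Z g f = Comp C Z Y X f g"
  by (simp_all add: op_cat_def)

lemma zero_mor_op: "zero_mor (op_cat C) X Y f \<longleftrightarrow> zero_mor C Y X f"
  unfolding zero_mor_def zero_object_op op_cat_sel by blast

definition zero_space :: "'a \<Rightarrow> (rat, 'a) module" where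
  "zero_space u = \<lparr>carrier = {u}, mult = undefined, one = undefined, zero = u,
     add = (\<lambda>_ _. u), smult = (\<lambda>_ _. u)\<rparr>"

lemma zero_space_vector_space: "rat_vector_space (zero_space u)"
  by (rule rat_vector_spaceI) (auto simp: zero_space_def)

lemma zero_object_zero_space:
  assumes "u \<in> U"
  shows "zero_object (vect_cat U) (zero_space u)"
proof -
  have "carrier (zero_space u) \<lesssim> U" using assms by (auto simp: zero_space_def intro: subset_imp_lepoll)
  then have "zero_space u \<in> Obj (vect_cat U)" by (simp add: zero_space_vector_space)
  moreover have "(\<exists>!f. f \<in> linear_maps X (zero_space u)) \<and> (\<exists>!f. f \<in> linear_maps (zero_space u) X)"
    if X: "rat_vector_space X" for X :: "(rat, 'a) module"
  proof (intro conjI ex1I)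
    show "restrict (\<lambda>x. \<zero>\<^bsub>zero_space u\<^esub>) (carrier X) \<in> linear_maps X (zero_space u)"
      by (intro restrict_in_linear_maps X linear_map_const_zero zero_space_vector_space)
    show "restrict (\<lambda>x. \<zero>\<^bsub>X\<^esub>) (carrier (zero_space u)) \<in> linear_maps (zero_space u) X"
      by (intro restrict_in_linear_maps X linear_map_const_zero zero_space_vector_space)
  next
    fix f assume f: "f \<in> linear_maps X (zero_space u)"
    show "f = restrict (\<lambda>x. \<zero>\<^bsub>zero_space u\<^esub>) (carrier X)"
      using f linear_mapD(1)[OF linear_mapsD[OF f]]
      by (intro extensionalityI[of f "carrier X"]) (auto simp: linear_maps_def zero_space_def)
  next
    fix f assume f: "f \<in> linear_maps (zero_space u) X"
    have "f u = \<zero>\<^bsub>X\<^esub>"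
      using linear_map_zero[OF linear_mapsD[OF f] zero_space_vector_space X] by (simp add: zero_space_def)
    then show "f = restrict (\<lambda>x. \<zero>\<^bsub>X\<^esub>) (carrier (zero_space u))"
      using f by (intro extensionalityI[of f "{u}"]) (auto simp: linear_maps_def zero_space_def)
  qed
  ultimately show ?thesis by (simp add: zero_object_def)
qed

text \<open>A zero object has only one vector, because its identity and its zero endomorphism coincide.\<close>

lemma zero_mor_vect_iff:
  fixes U :: "'a set" and X Y :: "(rat, 'a) module"
  assumes "U \<noteq> {}" and X: "X \<in> Obj (vect_cat U)" and Y: "Y \<in> Obj (vect_cat U)"
    and f: "f \<in> linear_maps X Y"
  shows "zero_mor (vect_cat U) X Y f \<longleftrightarrow> (\<forall>x\<in>carrier X. f x = \<zero>\<^bsub>Y\<^esub>)"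
proof
  assume "zero_mor (vect_cat U) X Y f"
  then obtain Z :: "(rat, 'a) module" and g h where Z: "zero_object (vect_cat U) Z" and g: "g \<in> linear_maps X Z"
    and h: "h \<in> linear_maps Z Y" and feq: "f = compose (carrier X) h g"
    unfolding zero_mor_def vect_cat_sel by blast
  have ZO: "rat_vector_space Z" using Z by (simp add: zero_object_def)
  have "\<exists>!e. e \<in> linear_maps Z Z" using Z unfolding zero_object_def by auto
  moreover have "restrict (\<lambda>x. \<zero>\<^bsub>Z\<^esub>) (carrier Z) \<in> linear_maps Z Z" "restrict (\<lambda>x. x) (carrier Z) \<in> linear_maps Z Z"
    by (intro restrict_in_linear_maps ZO linear_map_const_zero linear_map_id)+
  ultimately have eq: "restrict (\<lambda>x. \<zero>\<^bsub>Z\<^esub>) (carrier Z) = restrict (\<lambda>x. x) (carrier Z)" by blast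
  have Zz: "z = \<zero>\<^bsub>Z\<^esub>" if "z \<in> carrier Z" for z using fun_cong[OF eq, of z] that by simp
  show "\<forall>x\<in>carrier X. f x = \<zero>\<^bsub>Y\<^esub>"
  proof
    fix x assume x: "x \<in> carrier X"
    then have "g x = \<zero>\<^bsub>Z\<^esub>" using linear_mapD(1)[OF linear_mapsD[OF g]] Zz by blast
    then show "f x = \<zero>\<^bsub>Y\<^esub>"
      using x feq linear_map_zero[OF linear_mapsD[OF h] ZO] Y by (simp add: compose_def)
  qed
next
  assume z: "\<forall>x\<in>carrier X. f x = \<zero>\<^bsub>Y\<^esub>"
  obtain u where "u \<in> U" using assms(1) by blast
  note Z = zero_object_zero_space[OF this]
  have ZO: "rat_vector_space (zero_space u)" by (rule zero_space_vector_space)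
  have XY: "rat_vector_space X" "rat_vector_space Y" using X Y by auto
  let ?g = "restrict (\<lambda>x. \<zero>\<^bsub>zero_space u\<^esub>) (carrier X)"
    and ?h = "restrict (\<lambda>x. \<zero>\<^bsub>Y\<^esub>) (carrier (zero_space u))"
  have "?g \<in> linear_maps X (zero_space u)" "?h \<in> linear_maps (zero_space u) Y"
    by (intro restrict_in_linear_maps XY ZO linear_map_const_zero)+
  moreover have "f = compose (carrier X) ?h ?g"
    using f z by (intro extensionalityI[of f "carrier X"]) (auto simp: linear_maps_def compose_def zero_space_def)
  ultimately show "zero_mor (vect_cat U) X Y f" using Z unfolding zero_mor_def vect_cat_sel by blast
qed

text \<open>Cosets would be sets of vectors.  Selecting one representative in each coset keeps the
  quotient on the same type and, being a subset of \<open>V\<close>, within the size bound.\<close>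

lemma quotient_space:
  fixes V :: "(rat, 'a) module"
  assumes V: "rat_vector_space V" and S: "subspace V S"
  obtains Q :: "(rat, 'a) module" and q
  where "rat_vector_space Q" "carrier Q \<subseteq> carrier V" "linear_map V Q q"
    "q ` carrier V = carrier Q" "\<And>x. x \<in> carrier V \<Longrightarrow> q x = \<zero>\<^bsub>Q\<^esub> \<longleftrightarrow> x \<in> S"
proof -
  interpret rat_vs V by (rule rat_vs.intro[OF V])
  note SD = subspaceD[OF S]
  have SV [simp]: "x \<in> carrier V" if "x \<in> S" for x using that SD by blast
  define r where "r x y \<longleftrightarrow> x \<in> carrier V \<and> y \<in> carrier V \<and> x \<oplus>\<^bsub>V\<^esub> (-1) \<odot>\<^bsub>V\<^esub> y \<in> S" for x y
  have refl: "r x x" if "x \<in> carrier V" for x using that SD by (simp add: r_def add_collect1)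
  have sym: "r y x" if "r x y" for x y
    using SD(4)[of "x \<oplus>\<^bsub>V\<^esub> (-1) \<odot>\<^bsub>V\<^esub> y" "-1"] that by (simp add: r_def add_ac)
  have addr: "r (x \<oplus>\<^bsub>V\<^esub> x') (y \<oplus>\<^bsub>V\<^esub> y')" if "r x y" "r x' y'" for x y x' y'
    using SD(3)[of "x \<oplus>\<^bsub>V\<^esub> (-1) \<odot>\<^bsub>V\<^esub> y" "x' \<oplus>\<^bsub>V\<^esub> (-1) \<odot>\<^bsub>V\<^esub> y'"] that by (simp add: r_def add_ac)
  have scaler: "r (c \<odot>\<^bsub>V\<^esub> x) (c \<odot>\<^bsub>V\<^esub> y)" if "r x y" for c x y
    using SD(4)[of "x \<oplus>\<^bsub>V\<^esub> (-1) \<odot>\<^bsub>V\<^esub> y" c] that by (simp add: r_def)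
  have trans: "r x z" if "r x y" "r y z" for x y z
    using SD(3)[of "x \<oplus>\<^bsub>V\<^esub> (-1) \<odot>\<^bsub>V\<^esub> y" "y \<oplus>\<^bsub>V\<^esub> (-1) \<odot>\<^bsub>V\<^esub> z"] that
    by (simp add: r_def add_ac add_collect add_collect1)
  define q where "q x = (SOME y. r x y)" for x
  have rq: "r x (q x)" if "x \<in> carrier V" for x
    unfolding q_def by (rule someI[of _ x]) (rule refl[OF that])
  have q_cong: "q x = q y" if "r x y" for x y
  proof -
    have "r x = r y" using that sym trans by blast
    then show ?thesis by (simp add: q_def)
  qed
  have q_iff: "q x = q y \<longleftrightarrow> r x y" if "x \<in> carrier V" "y \<in> carrier V" for x y
    using q_cong rq[OF that(1)] rq[OF that(2)] sym trans by metis
  define Q :: "(rat, 'a) module" where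
    "Q = \<lparr>carrier = q ` carrier V, mult = undefined, one = undefined, zero = q \<zero>\<^bsub>V\<^esub>,
      add = (\<lambda>x y. q (x \<oplus>\<^bsub>V\<^esub> y)), smult = (\<lambda>c x. q (c \<odot>\<^bsub>V\<^esub> x))\<rparr>"
  have a: "q (q x \<oplus>\<^bsub>V\<^esub> q y) = q (x \<oplus>\<^bsub>V\<^esub> y)" if "x \<in> carrier V" "y \<in> carrier V" for x y
    by (rule q_cong[OF sym[OF addr[OF rq[OF that(1)] rq[OF that(2)]]]])
  have s: "q (c \<odot>\<^bsub>V\<^esub> q x) = q (c \<odot>\<^bsub>V\<^esub> x)" if "x \<in> carrier V" for c x
    by (rule q_cong[OF sym[OF scaler[OF rq[OF that]]]])
  have Q: "rat_vector_space Q" "linear_map V Q q"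
    using rat_vector_space_image[OF V, of Q q] by (simp_all add: Q_def a s)
  have "q x \<in> carrier V" if "x \<in> carrier V" for x using rq[OF that] by (simp add: r_def)
  then have "carrier Q \<subseteq> carrier V" by (auto simp: Q_def)
  moreover have "q x = \<zero>\<^bsub>Q\<^esub> \<longleftrightarrow> x \<in> S" if "x \<in> carrier V" for x
    using q_iff[OF that zero_in] that by (simp add: Q_def r_def)
  moreover have "q ` carrier V = carrier Q" by (simp add: Q_def)
  ultimately show thesis using that Q by blast
qed

text \<open>The cartesian product, copied into \<open>U\<close>, which is possible because \<open>U\<close> is infinite.  Projections,
  injections and the equations between them give the product and the coproduct.\<close>

lemma biproduct:
  fixes U :: "'a set" and X Y :: "(rat, 'a) module"
  assumes U: "infinite U" and X: "X \<in> Obj (vect_cat U)" and Y: "Y \<in> Obj (vect_cat U)"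
  obtains B :: "(rat, 'a) module" and p q i j
  where "rat_vector_space B" "carrier B \<lesssim> U" "linear_map B X p" "linear_map B Y q"
    "linear_map X B i" "linear_map Y B j"
    "\<forall>x\<in>carrier X. p (i x) = x" "\<forall>x\<in>carrier X. q (i x) = \<zero>\<^bsub>Y\<^esub>"
    "\<forall>y\<in>carrier Y. q (j y) = y" "\<forall>y\<in>carrier Y. p (j y) = \<zero>\<^bsub>X\<^esub>"
    "\<forall>b\<in>carrier B. i (p b) \<oplus>\<^bsub>B\<^esub> j (q b) = b"
proof -
  have XV: "rat_vector_space X" and YV: "rat_vector_space Y" using X Y by auto
  interpret X: rat_vs X by (rule rat_vs.intro[OF XV])
  interpret Y: rat_vs Y by (rule rat_vs.intro[OF YV])
  define M :: "(rat, 'a \<times> 'a) module" where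
    "M = \<lparr>carrier = carrier X \<times> carrier Y, mult = undefined, one = undefined,
      zero = (\<zero>\<^bsub>X\<^esub>, \<zero>\<^bsub>Y\<^esub>), add = (\<lambda>a b. (fst a \<oplus>\<^bsub>X\<^esub> fst b, snd a \<oplus>\<^bsub>Y\<^esub> snd b)),
      smult = (\<lambda>c a. (c \<odot>\<^bsub>X\<^esub> fst a, c \<odot>\<^bsub>Y\<^esub> snd a))\<rparr>"
  have M: "rat_vector_space M"
    by (rule rat_vector_spaceI) (auto simp: M_def X.add_ac Y.add_ac X.add_scale Y.add_scale)
  have "carrier X \<lesssim> U" "carrier Y \<lesssim> U" using X Y by auto
  then have cM: "carrier M \<lesssim> U" by (simp add: M_def infinite_times_lepoll[OF U])
  obtain B :: "(rat, 'a) module" and h k where B: "rat_vector_space B" "carrier B \<lesssim> U"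
    "linear_map M B h" "linear_map B M k"
    "\<forall>x\<in>carrier M. k (h x) = x" "\<forall>y\<in>carrier B. h (k y) = y"
    using vector_space_copy[OF M cM] .
  note hD = linear_mapD[OF B(3)] and kD = linear_mapD[OF B(4)]
  have l: "linear_map M X fst" "linear_map M Y snd"
    "linear_map X M (\<lambda>x. (x, \<zero>\<^bsub>Y\<^esub>))" "linear_map Y M (\<lambda>y. (\<zero>\<^bsub>X\<^esub>, y))"
    by (auto simp: linear_map_def M_def)
  have [simp]: "(x, y) \<in> carrier M \<longleftrightarrow> x \<in> carrier X \<and> y \<in> carrier Y" for x y by (simp add: M_def)
  have km: "fst (k b) \<in> carrier X \<and> snd (k b) \<in> carrier Y" if "b \<in> carrier B" for b
    using kD(1)[OF that] by (auto simp: M_def)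
  show thesis
  proof (rule that[OF B(1,2) linear_map_comp[OF B(4) l(1)] linear_map_comp[OF B(4) l(2)]
        linear_map_comp[OF l(3) B(3)] linear_map_comp[OF l(4) B(3)]])
    show "\<forall>b\<in>carrier B. h (fst (k b), \<zero>\<^bsub>Y\<^esub>) \<oplus>\<^bsub>B\<^esub> h (\<zero>\<^bsub>X\<^esub>, snd (k b)) = b"
    proof
      fix b assume b: "b \<in> carrier B"
      have "(fst (k b), \<zero>\<^bsub>Y\<^esub>) \<oplus>\<^bsub>M\<^esub> (\<zero>\<^bsub>X\<^esub>, snd (k b)) = k b" using km[OF b] by (simp add: M_def)
      then show "h (fst (k b), \<zero>\<^bsub>Y\<^esub>) \<oplus>\<^bsub>B\<^esub> h (\<zero>\<^bsub>X\<^esub>, snd (k b)) = b"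
        using B(6) b km[OF b] hD(2)[of "(fst (k b), \<zero>\<^bsub>Y\<^esub>)" "(\<zero>\<^bsub>X\<^esub>, snd (k b))"] by simp
    qed
  qed (simp_all add: B(5))
qed

lemma compose_eq_iff:
  assumes "f \<in> extensional A"
  shows "compose A g h = f \<longleftrightarrow> (\<forall>x\<in>A. g (h x) = f x)"
proof
  assume "\<forall>x\<in>A. g (h x) = f x"
  then show "compose A g h = f"
    by (intro extensionalityI[of _ A]) (use assms in \<open>auto simp: compose_def\<close>)
qed (auto simp: compose_def)

lemma linear_maps_ext: "f \<in> linear_maps V W \<Longrightarrow> f \<in> extensional (carrier V)"
  by (simp add: linear_maps_def)

text \<open>Every map killed by \<open>f\<close> takes its values in the image of \<open>k\<close>, where \<open>k\<close> has a linear inverse.\<close>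

lemma vect_kernelI:
  fixes U :: "'a set" and X Y K :: "(rat, 'a) module"
  assumes U: "U \<noteq> {}" and X: "X \<in> Obj (vect_cat U)" and Y: "Y \<in> Obj (vect_cat U)"
    and K: "K \<in> Obj (vect_cat U)" and f: "f \<in> linear_maps X Y" and k: "k \<in> linear_maps K X"
    and inj: "inj_on k (carrier K)" and im: "k ` carrier K = {x \<in> carrier X. f x = \<zero>\<^bsub>Y\<^esub>}"
  shows "is_kernel (vect_cat U) X Y f K k"
proof -
  have KV: "rat_vector_space K" using K by simp
  note kD = linear_mapD[OF linear_mapsD[OF k]]
  have zero: "zero_mor (vect_cat U) K Y (compose (carrier K) f k)"
    using zero_mor_vect_iff[OF U K Y linear_maps_compose[OF KV k f]] im by (auto simp: compose_def)
  have "linear_map K (X\<lparr>carrier := k ` carrier K\<rparr>) k" using kD by (auto simp: linear_map_def)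
  from linear_map_inverse[OF KV this] inj
  have inv: "linear_map (X\<lparr>carrier := k ` carrier K\<rparr>) K (inv_into (carrier K) k)"
    by (simp add: bij_betw_def)
  have "\<exists>!u. u \<in> linear_maps T K \<and> compose (carrier T) k u = g"
    if T: "T \<in> Obj (vect_cat U)" and g: "g \<in> linear_maps T X"
      and z: "zero_mor (vect_cat U) T Y (compose (carrier T) f g)" for T :: "(rat, 'a) module" and g
  proof -
    have TV: "rat_vector_space T" using T by simp
    note gD = linear_mapD[OF linear_mapsD[OF g]]
    have "g t \<in> k ` carrier K" if t: "t \<in> carrier T" for t
    proof -
      have "compose (carrier T) f g t = \<zero>\<^bsub>Y\<^esub>"
        using z zero_mor_vect_iff[OF U T Y linear_maps_compose[OF TV g f]] t by blast
      then show ?thesis using t gD(1)[OF t] im by (simp add: compose_def)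
    qed
    then have gi: "linear_map T (X\<lparr>carrier := k ` carrier K\<rparr>) g" using gD by (auto simp: linear_map_def)
    let ?u = "\<lambda>t\<in>carrier T. inv_into (carrier K) k (g t)"
    have u: "?u \<in> linear_maps T K" by (intro restrict_in_linear_maps TV linear_map_comp[OF gi inv])
    show ?thesis
    proof (rule ex1I[of _ ?u])
      show "?u \<in> linear_maps T K \<and> compose (carrier T) k ?u = g"
        using u linear_mapD(1)[OF gi]
        by (auto simp: compose_eq_iff[OF linear_maps_ext[OF g]] f_inv_into_f)
      fix v assume v: "v \<in> linear_maps T K \<and> compose (carrier T) k v = g"
      have "v t = ?u t" if t: "t \<in> carrier T" for t
      proof -
        have kv: "k (v t) = g t" using v t by (auto simp: compose_def)
        have "v t \<in> carrier K" using v linear_mapD(1)[OF linear_mapsD t] by blast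
        then show ?thesis using inj t by (simp flip: kv)
      qed
      then show "v = ?u" using v u by (intro linear_maps_eqI[of v T K ?u K]) auto
    qed
  qed
  then show ?thesis using K k zero unfolding is_kernel_def vect_cat_sel by blast
qed

text \<open>A map that vanishes on the image of \<open>f\<close> is constant on the fibres of \<open>q\<close>, so it factors through \<open>q\<close>
  by choosing preimages.\<close>

lemma vect_cokernelI:
  fixes U :: "'a set" and X Y Q :: "(rat, 'a) module"
  assumes U: "U \<noteq> {}" and X: "X \<in> Obj (vect_cat U)" and Y: "Y \<in> Obj (vect_cat U)"
    and Q: "Q \<in> Obj (vect_cat U)" and f: "f \<in> linear_maps X Y" and q: "q \<in> linear_maps Y Q"
    and surj: "q ` carrier Y = carrier Q" and ker: "{y \<in> carrier Y. q y = \<zero>\<^bsub>Q\<^esub>} = f ` carrier X"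
  shows "is_kernel (op_cat (vect_cat U)) Y X f Q q"
proof -
  have XV: "rat_vector_space X" and YV: "rat_vector_space Y" and QV: "rat_vector_space Q"
    using X Y Q by auto
  interpret Q: rat_vs Q by (rule rat_vs.intro[OF QV])
  interpret Y: rat_vs Y by (rule rat_vs.intro[OF YV])
  note fD = linear_mapD[OF linear_mapsD[OF f]] and qD = linear_mapD[OF linear_mapsD[OF q]]
  have zero: "zero_mor (vect_cat U) X Q (compose (carrier X) q f)"
    using zero_mor_vect_iff[OF U X Q linear_maps_compose[OF XV f q]] ker by (auto simp: compose_def)
  have "\<exists>!u. u \<in> linear_maps Q T \<and> compose (carrier Y) u q = g"
    if T: "T \<in> Obj (vect_cat U)" and g: "g \<in> linear_maps Y T"
      and z: "zero_mor (vect_cat U) X T (compose (carrier X) g f)" for T :: "(rat, 'a) module" and g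
  proof -
    have TV: "rat_vector_space T" using T by simp
    interpret T: rat_vs T by (rule rat_vs.intro[OF TV])
    note gD = linear_mapD[OF linear_mapsD[OF g]]
    have gf: "g (f x) = \<zero>\<^bsub>T\<^esub>" if x: "x \<in> carrier X" for x
    proof -
      have "compose (carrier X) g f x = \<zero>\<^bsub>T\<^esub>"
        using z zero_mor_vect_iff[OF U X T linear_maps_compose[OF XV f g]] x by blast
      then show ?thesis using x by (simp add: compose_def)
    qed
    have gq: "g y = g y'" if y: "y \<in> carrier Y" "y' \<in> carrier Y" "q y = q y'" for y y'
    proof -
      have "q (y \<oplus>\<^bsub>Y\<^esub> (-1) \<odot>\<^bsub>Y\<^esub> y') = \<zero>\<^bsub>Q\<^esub>" using qD y by (simp add: Q.add_collect1)
      then have "y \<oplus>\<^bsub>Y\<^esub> (-1) \<odot>\<^bsub>Y\<^esub> y' \<in> f ` carrier X" unfolding ker[symmetric] using y by simp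
      then have "g (y \<oplus>\<^bsub>Y\<^esub> (-1) \<odot>\<^bsub>Y\<^esub> y') = \<zero>\<^bsub>T\<^esub>" using gf by auto
      then have "g y \<oplus>\<^bsub>T\<^esub> (-1) \<odot>\<^bsub>T\<^esub> g y' = \<zero>\<^bsub>T\<^esub>" using gD y by simp
      then show ?thesis using T.eq_iff_diff_zero gD(1) y by blast
    qed
    let ?u = "\<lambda>z\<in>carrier Q. g (inv_into (carrier Y) q z)"
    have uq: "?u (q y) = g y" if y: "y \<in> carrier Y" for y
    proof -
      have "q y \<in> q ` carrier Y" using y by simp
      then have "g (inv_into (carrier Y) q (q y)) = g y"
        by (intro gq inv_into_into f_inv_into_f y)
      then show ?thesis using qD(1)[OF y] by simp
    qed
    have "linear_map Q T ?u"
      unfolding linear_map_def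
    proof (intro conjI ballI allI funcsetI)
      fix a assume "a \<in> carrier Q"
      then obtain x where x: "x \<in> carrier Y" "a = q x" using surj by blast
      show "?u a \<in> carrier T" using x uq gD by simp
      show "?u (c \<odot>\<^bsub>Q\<^esub> a) = c \<odot>\<^bsub>T\<^esub> ?u a" for c
        using x uq[of x] uq[of "c \<odot>\<^bsub>Y\<^esub> x"] gD qD by simp
      fix b assume "b \<in> carrier Q"
      then obtain y where y: "y \<in> carrier Y" "b = q y" using surj by blast
      show "?u (a \<oplus>\<^bsub>Q\<^esub> b) = ?u a \<oplus>\<^bsub>T\<^esub> ?u b"
        using x y uq[of x] uq[of y] uq[of "x \<oplus>\<^bsub>Y\<^esub> y"] gD qD by simp
    qed
    then have u: "?u \<in> linear_maps Q T" by (simp add: linear_maps_def)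
    show ?thesis
    proof (rule ex1I[of _ ?u])
      show "?u \<in> linear_maps Q T \<and> compose (carrier Y) ?u q = g"
        using u uq by (simp add: compose_eq_iff[OF linear_maps_ext[OF g]])
      fix v assume v: "v \<in> linear_maps Q T \<and> compose (carrier Y) v q = g"
      show "v = ?u"
      proof (rule linear_maps_eqI[of v Q T ?u T])
        fix a assume "a \<in> carrier Q"
        then obtain x where x: "x \<in> carrier Y" "a = q x" using surj by blast
        then have "v a = g x" using v by (auto simp: compose_def)
        then show "v a = ?u a" using uq x by simp
      qed (use u v in auto)
    qed
  qed
  then show ?thesis using Q q zero unfolding is_kernel_def op_cat_sel zero_mor_op vect_cat_sel by blast
qed

lemma kernel_inclusion:
  fixes U :: "'a set" and X Y :: "(rat, 'a) module"
  assumes X: "X \<in> Obj (vect_cat U)" and Y: "Y \<in> Obj (vect_cat U)" and f: "f \<in> linear_maps X Y"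
  obtains K :: "(rat, 'a) module" and k where "K \<in> Obj (vect_cat U)" "k \<in> linear_maps K X"
    "inj_on k (carrier K)" "k ` carrier K = {x \<in> carrier X. f x = \<zero>\<^bsub>Y\<^esub>}"
proof (rule that)
  let ?K = "X\<lparr>carrier := {x \<in> carrier X. f x = \<zero>\<^bsub>Y\<^esub>}\<rparr>"
  have K: "rat_vector_space ?K"
    using X Y by (intro subspace_vector_space linear_map_kernel_subspace[OF _ _ linear_mapsD[OF f]]) auto
  moreover have "carrier ?K \<lesssim> U" by (rule lepoll_subset[of _ "carrier X"]) (use X in auto)
  ultimately show "?K \<in> Obj (vect_cat U)" by simp
  show "restrict (\<lambda>x. x) (carrier ?K) \<in> linear_maps ?K X"
    by (rule restrict_in_linear_maps[OF K]) (auto simp: linear_map_def)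
qed (auto simp: inj_on_def)

lemma quotient_map:
  fixes U :: "'a set" and X Y :: "(rat, 'a) module"
  assumes X: "X \<in> Obj (vect_cat U)" and Y: "Y \<in> Obj (vect_cat U)" and f: "f \<in> linear_maps X Y"
  obtains Q :: "(rat, 'a) module" and q where "Q \<in> Obj (vect_cat U)" "q \<in> linear_maps Y Q"
    "q ` carrier Y = carrier Q" "{y \<in> carrier Y. q y = \<zero>\<^bsub>Q\<^esub>} = f ` carrier X"
proof -
  have XV: "rat_vector_space X" and YV: "rat_vector_space Y" using X Y by auto
  note sub = linear_map_image_subspace[OF XV YV linear_mapsD[OF f]]
  obtain Q :: "(rat, 'a) module" and q where Q: "rat_vector_space Q" "carrier Q \<subseteq> carrier Y"
    and q: "linear_map Y Q q" "q ` carrier Y = carrier Q"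
    and q0: "\<And>y. y \<in> carrier Y \<Longrightarrow> q y = \<zero>\<^bsub>Q\<^esub> \<longleftrightarrow> y \<in> f ` carrier X"
    using quotient_space[OF YV sub] by metis
  have "carrier Q \<lesssim> U" by (rule lepoll_subset[OF Q(2)]) (use Y in simp)
  show thesis
  proof (rule that)
    show "Q \<in> Obj (vect_cat U)" using Q(1) \<open>carrier Q \<lesssim> U\<close> by simp
    show "restrict q (carrier Y) \<in> linear_maps Y Q" by (rule restrict_in_linear_maps[OF YV q(1)])
    show "restrict q (carrier Y) ` carrier Y = carrier Q" using q(2) by auto
    show "{y \<in> carrier Y. restrict q (carrier Y) y = \<zero>\<^bsub>Q\<^esub>} = f ` carrier X"
      using q0 subspaceD(1)[OF sub] by auto
  qed
qed

text \<open>The inclusion of the kernel of \<open>f\<close> and the zero map have the same composite with \<open>f\<close>.\<close>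

lemma mono_vect_injective:
  fixes U :: "'a set" and X Y :: "(rat, 'a) module"
  assumes m: "mono_mor (vect_cat U) X Y f" and X: "X \<in> Obj (vect_cat U)" and Y: "Y \<in> Obj (vect_cat U)"
  shows "inj_on f (carrier X)"
proof -
  have f: "f \<in> linear_maps X Y" using m by (simp add: mono_mor_def)
  note fD = linear_mapD[OF linear_mapsD[OF f]]
  have XV: "rat_vector_space X" and YV: "rat_vector_space Y" using X Y by auto
  interpret X: rat_vs X by (rule rat_vs.intro[OF XV])
  interpret Y: rat_vs Y by (rule rat_vs.intro[OF YV])
  obtain K :: "(rat, 'a) module" and k where K: "K \<in> Obj (vect_cat U)" and k: "k \<in> linear_maps K X"
    and im: "k ` carrier K = {x \<in> carrier X. f x = \<zero>\<^bsub>Y\<^esub>}"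
    by (rule kernel_inclusion[OF X Y f]) blast
  let ?z = "restrict (\<lambda>x. \<zero>\<^bsub>X\<^esub>) (carrier K)"
  have "?z \<in> linear_maps K X" using K by (intro restrict_in_linear_maps linear_map_const_zero XV) simp
  moreover have "compose (carrier K) f k = compose (carrier K) f ?z"
    unfolding compose_def
    by (rule restrict_ext) (use im linear_map_zero[OF linear_mapsD[OF f] XV YV] in auto)
  ultimately have kz: "k = ?z" using m K k unfolding mono_mor_def vect_cat_sel by blast
  show ?thesis
  proof (rule inj_onI)
    fix x y assume xy: "x \<in> carrier X" "y \<in> carrier X" "f x = f y"
    then have "f (x \<oplus>\<^bsub>X\<^esub> (-1) \<odot>\<^bsub>X\<^esub> y) = \<zero>\<^bsub>Y\<^esub>" using fD by (simp add: Y.add_collect1)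
    then have "x \<oplus>\<^bsub>X\<^esub> (-1) \<odot>\<^bsub>X\<^esub> y \<in> k ` carrier K" using xy im by simp
    then have "x \<oplus>\<^bsub>X\<^esub> (-1) \<odot>\<^bsub>X\<^esub> y = \<zero>\<^bsub>X\<^esub>" using kz by auto
    then show "x = y" using X.eq_iff_diff_zero xy by blast
  qed
qed

text \<open>The projection modulo the image of \<open>f\<close> and the zero map have the same composite with \<open>f\<close>.\<close>

lemma epi_vect_surjective:
  fixes U :: "'a set" and X Y :: "(rat, 'a) module"
  assumes m: "mono_mor (op_cat (vect_cat U)) Y X f" and X: "X \<in> Obj (vect_cat U)" and Y: "Y \<in> Obj (vect_cat U)"
  shows "f ` carrier X = carrier Y"
proof -
  have f: "f \<in> linear_maps X Y" using m by (simp add: mono_mor_def)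
  note fD = linear_mapD[OF linear_mapsD[OF f]]
  obtain Q :: "(rat, 'a) module" and q where Q: "Q \<in> Obj (vect_cat U)" and q: "q \<in> linear_maps Y Q"
    and ker: "{y \<in> carrier Y. q y = \<zero>\<^bsub>Q\<^esub>} = f ` carrier X"
    by (rule quotient_map[OF X Y f]) blast
  let ?z = "restrict (\<lambda>y. \<zero>\<^bsub>Q\<^esub>) (carrier Y)"
  have "?z \<in> linear_maps Y Q" using Y Q by (intro restrict_in_linear_maps linear_map_const_zero) auto
  moreover have "compose (carrier X) q f = compose (carrier X) ?z f"
    unfolding compose_def by (rule restrict_ext) (use fD(1) ker in auto)
  ultimately have "q = ?z" using m Q q unfolding mono_mor_def op_cat_sel vect_cat_sel by blast
  then show ?thesis using ker by auto
qed

text \<open>A monomorphism is injective and therefore the kernel of the projection modulo its image.\<close>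

lemma products_kernels_normal_vect:
  fixes U :: "'a set"
  assumes U: "infinite U"
  shows "products_kernels_normal (vect_cat U :: ((rat, 'a) module, 'a \<Rightarrow> 'a) cat)"
  unfolding products_kernels_normal_def
proof (intro conjI ballI allI impI)
  fix X Y :: "(rat, 'a) module" assume X: "X \<in> Obj (vect_cat U)" and Y: "Y \<in> Obj (vect_cat U)"
  obtain B :: "(rat, 'a) module" and p q i j where B: "rat_vector_space B" "carrier B \<lesssim> U"
    and lin: "linear_map B X p" "linear_map B Y q" "linear_map X B i" "linear_map Y B j"
    and eq0: "\<forall>x\<in>carrier X. p (i x) = x" "\<forall>x\<in>carrier X. q (i x) = \<zero>\<^bsub>Y\<^esub>"
    "\<forall>y\<in>carrier Y. q (j y) = y" "\<forall>y\<in>carrier Y. p (j y) = \<zero>\<^bsub>X\<^esub>"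
    "\<forall>b\<in>carrier B. i (p b) \<oplus>\<^bsub>B\<^esub> j (q b) = b"
    using biproduct[OF U X Y] .
  note eq = eq0[rule_format]
  interpret B: rat_vs B by (rule rat_vs.intro[OF B(1)])
  interpret X: rat_vs X by (rule rat_vs.intro) (use X in simp)
  interpret Y: rat_vs Y by (rule rat_vs.intro) (use Y in simp)
  note pD = linear_mapD[OF lin(1)] and qD = linear_mapD[OF lin(2)]
    and iD = linear_mapD[OF lin(3)] and jD = linear_mapD[OF lin(4)]
  have "\<exists>!u. u \<in> linear_maps T B \<and> compose (carrier T) (restrict p (carrier B)) u = f \<and>
      compose (carrier T) (restrict q (carrier B)) u = g"
    if T: "rat_vector_space T" and f: "f \<in> linear_maps T X" and g: "g \<in> linear_maps T Y"
    for T :: "(rat, 'a) module" and f g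
  proof (rule ex1I)
    note fD = linear_mapD[OF linear_mapsD[OF f]] and gD = linear_mapD[OF linear_mapsD[OF g]]
    let ?u = "\<lambda>t\<in>carrier T. i (f t) \<oplus>\<^bsub>B\<^esub> j (g t)"
    have u: "?u \<in> linear_maps T B"
      by (intro restrict_in_linear_maps T linear_map_add B(1)
          linear_map_comp[OF linear_mapsD[OF f] lin(3)] linear_map_comp[OF linear_mapsD[OF g] lin(4)])
    then show "?u \<in> linear_maps T B \<and> compose (carrier T) (restrict p (carrier B)) ?u = f \<and>
      compose (carrier T) (restrict q (carrier B)) ?u = g"
      using eq pD qD iD jD fD gD
      by (simp add: compose_eq_iff linear_maps_ext[OF f] linear_maps_ext[OF g])
    fix v assume v: "v \<in> linear_maps T B \<and> compose (carrier T) (restrict p (carrier B)) v = f \<and>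
      compose (carrier T) (restrict q (carrier B)) v = g"
    then have vB: "v t \<in> carrier B" if "t \<in> carrier T" for t
      using linear_mapD(1)[OF linear_mapsD that] by blast
    have "p (v t) = f t" "q (v t) = g t" if "t \<in> carrier T" for t
      using v vB[OF that] that by (auto simp: compose_def)
    then show "v = ?u" using v u vB eq(5) by (intro linear_maps_eqI[of v T B ?u B]) (auto, metis)
  qed
  moreover have "restrict p (carrier B) \<in> linear_maps B X" "restrict q (carrier B) \<in> linear_maps B Y"
    by (intro restrict_in_linear_maps B lin)+
  ultimately have "is_product (vect_cat U) X Y B (restrict p (carrier B)) (restrict q (carrier B))"
    using B by (simp add: is_product_def)
  then show "\<exists>P p q. is_product (vect_cat U) X Y P p q" by blast
next
  fix X Y :: "(rat, 'a) module" and f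
  assume X: "X \<in> Obj (vect_cat U)" and Y: "Y \<in> Obj (vect_cat U)" and "f \<in> Hom (vect_cat U) X Y"
  then have f: "f \<in> linear_maps X Y" by simp
  obtain K :: "(rat, 'a) module" and k where "K \<in> Obj (vect_cat U)" "k \<in> linear_maps K X" "inj_on k (carrier K)"
    "k ` carrier K = {x \<in> carrier X. f x = \<zero>\<^bsub>Y\<^esub>}"
    by (rule kernel_inclusion[OF X Y f]) blast
  then have "is_kernel (vect_cat U) X Y f K k"
    by (rule vect_kernelI[OF infinite_imp_nonempty[OF U] X Y _ f])
  then show "\<exists>K k. is_kernel (vect_cat U) X Y f K k" by blast
next
  fix X Y :: "(rat, 'a) module" and f
  assume X: "X \<in> Obj (vect_cat U)" and Y: "Y \<in> Obj (vect_cat U)" and m: "mono_mor (vect_cat U) X Y f"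
  then have f: "f \<in> linear_maps X Y" by (simp add: mono_mor_def)
  obtain Q :: "(rat, 'a) module" and q where Q: "Q \<in> Obj (vect_cat U)" and q: "q \<in> linear_maps Y Q"
    and ker: "{y \<in> carrier Y. q y = \<zero>\<^bsub>Q\<^esub>} = f ` carrier X"
    by (rule quotient_map[OF X Y f]) blast
  have "is_kernel (vect_cat U) Y Q q X f"
    by (rule vect_kernelI[OF infinite_imp_nonempty[OF U] Y Q X q f mono_vect_injective[OF m X Y] ker[symmetric]])
  then show "\<exists>Z\<in>Obj (vect_cat U). \<exists>g\<in>Hom (vect_cat U) Y Z. is_kernel (vect_cat U) Y Z g X f"
    using Q q by auto
qed

text \<open>An epimorphism is surjective and therefore the cokernel of the inclusion of its kernel.\<close>

lemma products_kernels_normal_vect_op: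
  fixes U :: "'a set"
  assumes U: "infinite U"
  shows "products_kernels_normal (op_cat (vect_cat U :: ((rat, 'a) module, 'a \<Rightarrow> 'a) cat))"
  unfolding products_kernels_normal_def
proof (intro conjI ballI allI impI)
  fix X Y :: "(rat, 'a) module" assume "X \<in> Obj (op_cat (vect_cat U))" "Y \<in> Obj (op_cat (vect_cat U))"
  then have X: "X \<in> Obj (vect_cat U)" and Y: "Y \<in> Obj (vect_cat U)" by simp_all
  obtain B :: "(rat, 'a) module" and p q i j where B: "rat_vector_space B" "carrier B \<lesssim> U"
    and lin: "linear_map B X p" "linear_map B Y q" "linear_map X B i" "linear_map Y B j"
    and eq0: "\<forall>x\<in>carrier X. p (i x) = x" "\<forall>x\<in>carrier X. q (i x) = \<zero>\<^bsub>Y\<^esub>"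
    "\<forall>y\<in>carrier Y. q (j y) = y" "\<forall>y\<in>carrier Y. p (j y) = \<zero>\<^bsub>X\<^esub>"
    "\<forall>b\<in>carrier B. i (p b) \<oplus>\<^bsub>B\<^esub> j (q b) = b"
    using biproduct[OF U X Y] .
  note eq = eq0[rule_format]
  have XV: "rat_vector_space X" and YV: "rat_vector_space Y" using X Y by auto
  note pD = linear_mapD[OF lin(1)] and qD = linear_mapD[OF lin(2)]
    and iD = linear_mapD[OF lin(3)] and jD = linear_mapD[OF lin(4)]
  have "\<exists>!u. u \<in> linear_maps B T \<and> compose (carrier X) u (restrict i (carrier X)) = f \<and>
      compose (carrier Y) u (restrict j (carrier Y)) = g"
    if TO: "T \<in> Obj (vect_cat U)" and f: "f \<in> linear_maps X T" and g: "g \<in> linear_maps Y T"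
    for T :: "(rat, 'a) module" and f g
  proof (rule ex1I)
    have T: "rat_vector_space T" using TO by simp
    interpret T: rat_vs T by (rule rat_vs.intro[OF T])
    note fl = linear_mapsD[OF f] and gl = linear_mapsD[OF g]
    note fD = linear_mapD[OF fl] and gD = linear_mapD[OF gl]
    let ?u = "\<lambda>b\<in>carrier B. f (p b) \<oplus>\<^bsub>T\<^esub> g (q b)"
    have u: "?u \<in> linear_maps B T"
      by (intro restrict_in_linear_maps T linear_map_add B(1) linear_map_comp[OF lin(1) fl]
          linear_map_comp[OF lin(2) gl])
    then show "?u \<in> linear_maps B T \<and> compose (carrier X) ?u (restrict i (carrier X)) = f \<and>
      compose (carrier Y) ?u (restrict j (carrier Y)) = g"
      using eq pD qD iD jD fD gD linear_map_zero[OF fl XV T] linear_map_zero[OF gl YV T]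
      by (simp add: compose_eq_iff linear_maps_ext[OF f] linear_maps_ext[OF g])
    fix v assume v: "v \<in> linear_maps B T \<and> compose (carrier X) v (restrict i (carrier X)) = f \<and>
      compose (carrier Y) v (restrict j (carrier Y)) = g"
    then have vD: "linear_map B T v" by (simp add: linear_maps_def)
    have vi: "v (i x) = f x" if "x \<in> carrier X" for x using v that by (auto simp: compose_def)
    have vj: "v (j x) = g x" if "x \<in> carrier Y" for x using v that by (auto simp: compose_def)
    show "v = ?u"
    proof (rule linear_maps_eqI[of v B T ?u T])
      fix b assume b: "b \<in> carrier B"
      have "v b = v (i (p b) \<oplus>\<^bsub>B\<^esub> j (q b))" using eq(5)[OF b] by simp
      also have "\<dots> = f (p b) \<oplus>\<^bsub>T\<^esub> g (q b)"
        using linear_mapD(2)[OF vD iD(1) jD(1)] pD(1)[OF b] qD(1)[OF b] vi vj by simp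
      finally show "v b = ?u b" using b by simp
    qed (use u v in auto)
  qed
  moreover have "restrict i (carrier X) \<in> linear_maps X B" "restrict j (carrier Y) \<in> linear_maps Y B"
    by (intro restrict_in_linear_maps XV YV lin)+
  ultimately have "is_product (op_cat (vect_cat U)) X Y B (restrict i (carrier X)) (restrict j (carrier Y))"
    using B unfolding is_product_def op_cat_sel vect_cat_sel by blast
  then show "\<exists>P p q. is_product (op_cat (vect_cat U)) X Y P p q" by blast
next
  fix Y X :: "(rat, 'a) module" and f
  assume "Y \<in> Obj (op_cat (vect_cat U))" "X \<in> Obj (op_cat (vect_cat U))" "f \<in> Hom (op_cat (vect_cat U)) Y X"
  then have X: "X \<in> Obj (vect_cat U)" and Y: "Y \<in> Obj (vect_cat U)" and f: "f \<in> linear_maps X Y" by auto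
  obtain Q :: "(rat, 'a) module" and q where "Q \<in> Obj (vect_cat U)" "q \<in> linear_maps Y Q" "q ` carrier Y = carrier Q"
    "{y \<in> carrier Y. q y = \<zero>\<^bsub>Q\<^esub>} = f ` carrier X"
    by (rule quotient_map[OF X Y f]) blast
  then have "is_kernel (op_cat (vect_cat U)) Y X f Q q"
    by (rule vect_cokernelI[OF infinite_imp_nonempty[OF U] X Y _ f])
  then show "\<exists>K k. is_kernel (op_cat (vect_cat U)) Y X f K k" by blast
next
  fix Y X :: "(rat, 'a) module" and f
  assume "Y \<in> Obj (op_cat (vect_cat U))" "X \<in> Obj (op_cat (vect_cat U))" and m: "mono_mor (op_cat (vect_cat U)) Y X f"
  then have X: "X \<in> Obj (vect_cat U)" and Y: "Y \<in> Obj (vect_cat U)" and f: "f \<in> linear_maps X Y"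
    by (auto simp: mono_mor_def)
  obtain K :: "(rat, 'a) module" and k where K: "K \<in> Obj (vect_cat U)" and k: "k \<in> linear_maps K X"
    and im: "k ` carrier K = {x \<in> carrier X. f x = \<zero>\<^bsub>Y\<^esub>}"
    by (rule kernel_inclusion[OF X Y f]) blast
  have "is_kernel (op_cat (vect_cat U)) X K k Y f"
    by (rule vect_cokernelI[OF infinite_imp_nonempty[OF U] K X Y k f epi_vect_surjective[OF m X Y] im[symmetric]])
  then show "\<exists>Z\<in>Obj (op_cat (vect_cat U)). \<exists>g\<in>Hom (op_cat (vect_cat U)) X Z.
      is_kernel (op_cat (vect_cat U)) X Z g Y f"
    using K k by auto
qed

theorem abelian_category_vect_cat:
  fixes U :: "'a set"
  assumes "infinite U"
  shows "abelian_category (vect_cat U :: ((rat, 'a) module, 'a \<Rightarrow> 'a) cat)"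
proof -
  obtain u where u: "u \<in> U" using infinite_imp_nonempty[OF assms] by blast
  show ?thesis
    unfolding abelian_category_def
    by (intro conjI exI[of _ "zero_space u"] category_vect_cat products_kernels_normal_vect[OF assms]
        products_kernels_normal_vect_op[OF assms] zero_object_zero_space[OF u])
qed

section \<open>Modules over creation and annihilation operators\<close>

text \<open>All words of length \<open>n\<close> in the operators \<open>Q i\<close> kill \<open>x\<close>.\<close>

primrec qnil :: "(rat, 'w, 'c) module_scheme \<Rightarrow> (nat \<Rightarrow> 'w \<Rightarrow> 'w) \<Rightarrow> nat \<Rightarrow> 'w \<Rightarrow> bool" where
  "qnil W Q 0 x \<longleftrightarrow> x = \<zero>\<^bsub>W\<^esub>"
| "qnil W Q (Suc n) x \<longleftrightarrow> (\<forall>i. qnil W Q n (Q i x))"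

locale lowering = rat_vs W for W :: "(rat, 'w, 'c) module_scheme" (structure) +
  fixes Q :: "nat \<Rightarrow> 'w \<Rightarrow> 'w"
  assumes Q_linear: "linear_map W W (Q i)"
begin

lemmas Q_simps [simp] = linear_mapD[OF Q_linear]

lemma Q_zero [simp]: "Q i \<zero> = \<zero>"
  by (rule linear_map_zero[OF Q_linear vector_space vector_space])

lemma qnil_zero: "qnil W Q n \<zero>"
  by (induction n) auto

lemma qnil_Suc: "qnil W Q n x \<Longrightarrow> qnil W Q (Suc n) x"
  by (induction n arbitrary: x) auto

lemma qnil_add: "x \<in> carrier W \<Longrightarrow> y \<in> carrier W \<Longrightarrow> qnil W Q n x \<Longrightarrow> qnil W Q n y \<Longrightarrow> qnil W Q n (x \<oplus> y)"
  by (induction n arbitrary: x y) auto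

lemma qnil_scale: "x \<in> carrier W \<Longrightarrow> qnil W Q n x \<Longrightarrow> qnil W Q n (c \<odot> x)"
  by (induction n arbitrary: x) auto

lemma qnil_mono: "qnil W Q n x \<Longrightarrow> qnil W Q (n + k) x"
proof (induction k)
  case (Suc k)
  show ?case unfolding add_Suc_right by (rule qnil_Suc[OF Suc.IH[OF Suc.prems]])
qed simp

lemma nilpotent_subspace: "subspace W {x \<in> carrier W. \<exists>n. qnil W Q n x}"
  unfolding subspace_def
proof (intro conjI ballI allI)
  show "\<zero> \<in> {x \<in> carrier W. \<exists>n. qnil W Q n x}" using qnil_zero by auto
  fix x y assume x: "x \<in> {x \<in> carrier W. \<exists>n. qnil W Q n x}"
  then obtain n where n: "qnil W Q n x" by blast
  then show "c \<odot> x \<in> {x \<in> carrier W. \<exists>n. qnil W Q n x}" for c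
    using x qnil_scale by blast
  assume y: "y \<in> {x \<in> carrier W. \<exists>n. qnil W Q n x}"
  then obtain m where m: "qnil W Q m y" by blast
  have "qnil W Q (n + m) (x \<oplus> y)"
    using qnil_mono[OF n, of m] qnil_mono[OF m, of n] x y by (intro qnil_add) (auto simp: add.commute)
  then show "x \<oplus> y \<in> {x \<in> carrier W. \<exists>n. qnil W Q n x}" using x y by blast
qed auto

lemma finite_subspace: "subspace W {x \<in> carrier W. \<exists>b. \<forall>m\<ge>b. Q m x = \<zero>}"
  unfolding subspace_def
proof (intro conjI ballI allI)
  fix x y assume x: "x \<in> {x \<in> carrier W. \<exists>b. \<forall>m\<ge>b. Q m x = \<zero>}"
  then obtain b where b: "\<forall>m\<ge>b. Q m x = \<zero>" by blast
  then show "c \<odot> x \<in> {x \<in> carrier W. \<exists>b. \<forall>m\<ge>b. Q m x = \<zero>}" for c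
    using x by (auto intro!: exI[of _ b])
  assume y: "y \<in> {x \<in> carrier W. \<exists>b. \<forall>m\<ge>b. Q m x = \<zero>}"
  then obtain b' where "\<forall>m\<ge>b'. Q m y = \<zero>" by blast
  then show "x \<oplus> y \<in> {x \<in> carrier W. \<exists>b. \<forall>m\<ge>b. Q m x = \<zero>}"
    using x y b by (auto intro!: exI[of _ "max b b'"])
qed auto

end

text \<open>The common features of admissible modules over the Clifford algebra (\<open>\<epsilon> = -1\<close>, \<open>\<kappa> i = 1\<close>) and
  over the Heisenberg algebra (\<open>\<epsilon> = 1\<close>, \<open>\<kappa> i = - (i + 1)\<close>).  The generators with index \<open>i + 1\<close>
  appear here with index \<open>i\<close>, so that indices range over all natural numbers.\<close>

locale ladder = lowering W Q for W :: "(rat, 'w, 'c) module_scheme" (structure)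
    and P Q :: "nat \<Rightarrow> 'w \<Rightarrow> 'w" +
  fixes \<epsilon> :: rat and \<kappa> :: "nat \<Rightarrow> rat"
  assumes P_linear: "linear_map W W (P i)"
    and eps [simp]: "\<epsilon> * \<epsilon> = 1" and kappa [simp]: "\<kappa> i \<noteq> 0"
    and PP: "x \<in> carrier W \<Longrightarrow> P i (P j x) = \<epsilon> \<odot> P j (P i x)"
    and QQ: "x \<in> carrier W \<Longrightarrow> Q i (Q j x) = \<epsilon> \<odot> Q j (Q i x)"
    and QP: "x \<in> carrier W \<Longrightarrow> Q i (P j x) = \<epsilon> \<odot> P j (Q i x) \<oplus> (if i = j then \<kappa> i else 0) \<odot> x"
    and Q_finite: "x \<in> carrier W \<Longrightarrow> \<exists>b. \<forall>m\<ge>b. Q m x = \<zero>"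
    and Q_nilpotent: "x \<in> carrier W \<Longrightarrow> \<exists>n. qnil W Q n x"
begin

lemmas P_simps [simp] = linear_mapD[OF P_linear]

lemma P_zero [simp]: "P i \<zero> = \<zero>"
  by (rule linear_map_zero[OF P_linear vector_space vector_space])

definition vac :: "'w set" where
  "vac = {x \<in> carrier W. \<forall>i. Q i x = \<zero>}"

lemma vacD: "x \<in> vac \<Longrightarrow> x \<in> carrier W" "x \<in> vac \<Longrightarrow> Q i x = \<zero>"
  by (auto simp: vac_def)

lemma vac_subspace: "subspace W vac"
  by (auto simp: subspace_def vac_def)

lemmas vac_closed = subspaceD[OF vac_subspace]

lemma vac_space: "rat_vector_space (W\<lparr>carrier := vac\<rparr>)"
  by (rule subspace_vector_space[OF vector_space vac_subspace])

primrec num_upto :: "nat \<Rightarrow> 'w \<Rightarrow> 'w" where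
  "num_upto 0 x = \<zero>"
| "num_upto (Suc b) x = num_upto b x \<oplus> (1 / \<kappa> b) \<odot> P b (Q b x)"

text \<open>The number operator \<open>\<Sum>\<^sub>b (\<kappa> b)\<^sup>-\<^sup>1 P\<^sub>b Q\<^sub>b\<close>.  Only finitely many summands are nonzero on a
  given vector; the bound used here is one admissible choice among many (\<open>num_eq_num_upto\<close>).\<close>

definition num :: "'w \<Rightarrow> 'w" where
  "num x = num_upto (LEAST b. \<forall>m\<ge>b. Q m x = \<zero>) x"

lemma num_upto_in [simp]: "x \<in> carrier W \<Longrightarrow> num_upto b x \<in> carrier W"
  by (induction b) auto

lemma num_upto_add: "x \<in> carrier W \<Longrightarrow> y \<in> carrier W \<Longrightarrow> num_upto b (x \<oplus> y) = num_upto b x \<oplus> num_upto b y"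
  by (induction b) (auto simp: add_ac)

lemma num_upto_scale: "x \<in> carrier W \<Longrightarrow> num_upto b (c \<odot> x) = c \<odot> num_upto b x"
  by (induction b) (auto simp: mult.commute)

lemma num_upto_stable: "x \<in> carrier W \<Longrightarrow> \<forall>m\<ge>b. Q m x = \<zero> \<Longrightarrow> num_upto (b + k) x = num_upto b x"
  by (induction k) auto

lemma num_eq_num_upto:
  assumes "x \<in> carrier W" "\<forall>m\<ge>b. Q m x = \<zero>"
  shows "num x = num_upto b x"
proof -
  let ?l = "LEAST b. \<forall>m\<ge>b. Q m x = \<zero>"
  have l: "\<forall>m\<ge>?l. Q m x = \<zero>" by (rule LeastI[of "\<lambda>b. \<forall>m\<ge>b. Q m x = \<zero>", OF assms(2)])
  have "?l \<le> b" by (rule Least_le[of "\<lambda>b. \<forall>m\<ge>b. Q m x = \<zero>", OF assms(2)])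
  then show ?thesis using num_upto_stable[OF assms(1) l, of "b - ?l"] by (simp add: num_def)
qed

lemma Q_finite2:
  assumes "x \<in> carrier W" "y \<in> carrier W"
  obtains b where "\<forall>m\<ge>b. Q m x = \<zero>" "\<forall>m\<ge>b. Q m y = \<zero>" "j < b"
proof -
  obtain b c where "\<forall>m\<ge>b. Q m x = \<zero>" "\<forall>m\<ge>c. Q m y = \<zero>" using Q_finite assms by meson
  then show thesis using that[of "max (Suc j) (max b c)"] by auto
qed

lemma num_in [simp]: "x \<in> carrier W \<Longrightarrow> num x \<in> carrier W"
  by (simp add: num_def)

lemma num_add [simp]:
  assumes "x \<in> carrier W" "y \<in> carrier W"
  shows "num (x \<oplus> y) = num x \<oplus> num y"
proof -
  obtain b where b: "\<forall>m\<ge>b. Q m x = \<zero>" "\<forall>m\<ge>b. Q m y = \<zero>" using Q_finite2[OF assms] .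
  then have "\<forall>m\<ge>b. Q m (x \<oplus> y) = \<zero>" using assms by simp
  from num_eq_num_upto[OF add_in[OF assms] this] show ?thesis
    using num_eq_num_upto[OF assms(1) b(1)] num_eq_num_upto[OF assms(2) b(2)] num_upto_add[OF assms] by simp
qed

lemma num_scale [simp]:
  assumes "x \<in> carrier W"
  shows "num (c \<odot> x) = c \<odot> num x"
proof -
  obtain b where b: "\<forall>m\<ge>b. Q m x = \<zero>" using Q_finite[OF assms] by blast
  then have "\<forall>m\<ge>b. Q m (c \<odot> x) = \<zero>" using assms by simp
  from num_eq_num_upto[OF scale_in[OF assms] this] show ?thesis
    using num_eq_num_upto[OF assms b] num_upto_scale[OF assms] by simp
qed

text \<open>Moving \<open>P j\<close> past \<open>P b\<close> and past \<open>Q b\<close> produces two factors \<open>\<epsilon>\<close>, which cancel, so that only the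
  summand with \<open>b = j\<close> fails to commute with \<open>P j\<close>.\<close>

lemma num_upto_P:
  assumes "x \<in> carrier W"
  shows "num_upto b (P j x) = P j (num_upto b x) \<oplus> (if j < b then 1 else 0) \<odot> P j x"
proof (induction b)
  case (Suc b)
  have "P b (Q b (P j x)) = \<epsilon> \<odot> P b (P j (Q b x)) \<oplus> (if b = j then \<kappa> b else 0) \<odot> P b x"
    using assms by (simp add: QP)
  also have "P b (P j (Q b x)) = \<epsilon> \<odot> P j (P b (Q b x))" by (rule PP) (simp add: assms)
  finally have "P b (Q b (P j x)) = P j (P b (Q b x)) \<oplus> (if b = j then \<kappa> b else 0) \<odot> P b x"
    using assms by simp
  then have "num_upto (Suc b) (P j x) = (P j (num_upto b x) \<oplus> (if j < b then 1 else 0) \<odot> P j x) \<oplus>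
      (1 / \<kappa> b) \<odot> (P j (P b (Q b x)) \<oplus> (if b = j then \<kappa> b else 0) \<odot> P b x)"
    using Suc by simp
  also have "\<dots> = P j (num_upto (Suc b) x) \<oplus> (if j < Suc b then 1 else 0) \<odot> P j x"
    using assms by (auto simp: add_ac less_Suc_eq)
  finally show ?case .
qed (use assms in simp)

lemma num_P:
  assumes x: "x \<in> carrier W"
  shows "num (P j x) = P j (num x) \<oplus> P j x"
proof -
  obtain b where b: "\<forall>m\<ge>b. Q m x = \<zero>" "j < b" using Q_finite2[OF x x] .
  then have "\<forall>m\<ge>b. Q m (P j x) = \<zero>" using x by (auto simp: QP)
  then show ?thesis using num_upto_P[OF x, of b j] b x num_eq_num_upto by simp
qed

lemma Q_num_upto:
  assumes "x \<in> carrier W"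
  shows "Q j (num_upto b x) = num_upto b (Q j x) \<oplus> (if j < b then 1 else 0) \<odot> Q j x"
proof (induction b)
  case (Suc b)
  have "Q j (P b (Q b x)) = \<epsilon> \<odot> P b (Q j (Q b x)) \<oplus> (if j = b then \<kappa> j else 0) \<odot> Q b x"
    using assms by (simp add: QP)
  also have "Q j (Q b x) = \<epsilon> \<odot> Q b (Q j x)" by (rule QQ[OF assms])
  finally have "Q j (P b (Q b x)) = P b (Q b (Q j x)) \<oplus> (if j = b then \<kappa> j else 0) \<odot> Q b x"
    using assms by simp
  then have "Q j (num_upto (Suc b) x) = (num_upto b (Q j x) \<oplus> (if j < b then 1 else 0) \<odot> Q j x) \<oplus>
      (1 / \<kappa> b) \<odot> (P b (Q b (Q j x)) \<oplus> (if j = b then \<kappa> j else 0) \<odot> Q b x)"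
    using Suc assms by simp
  also have "\<dots> = num_upto (Suc b) (Q j x) \<oplus> (if j < Suc b then 1 else 0) \<odot> Q j x"
    using assms by (auto simp: add_ac less_Suc_eq)
  finally show ?case .
qed (use assms in simp)

lemma Q_num:
  assumes x: "x \<in> carrier W"
  shows "Q j (num x) = num (Q j x) \<oplus> Q j x"
proof -
  obtain b where b: "\<forall>m\<ge>b. Q m x = \<zero>" "j < b" using Q_finite2[OF x x] .
  then have "\<forall>m\<ge>b. Q m (Q j x) = \<zero>" using x QQ[OF x, of _ j] by simp
  then show ?thesis using Q_num_upto[OF x, of j b] b x num_eq_num_upto by simp
qed

lemma num_vac: "x \<in> vac \<Longrightarrow> num x = \<zero>"
  using num_eq_num_upto[of x 0] vacD by simp

text \<open>The linear algebra of the induction steps of \<open>Q_lower\<close> and \<open>lower_P\<close>.\<close>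

lemma collect_commutator:
  assumes "t \<in> carrier W" "u \<in> carrier W"
  shows "(m + 1) \<odot> ((-1) \<odot> t) \<oplus> (-1) \<odot> ((-1) \<odot> u \<oplus> (-1) \<odot> t) = (- m) \<odot> t \<oplus> u"
    and "(m + 1) \<odot> ((-1) \<odot> t) \<oplus> (-1) \<odot> ((-1) \<odot> (u \<oplus> t)) = (- m) \<odot> t \<oplus> u"
  using assms by (simp_all add: add_ac(2)[of u t] add_collect1)

text \<open>The product \<open>(1 - N) (2 - N) \<dots> (n - N)\<close> of the commuting operators \<open>k - N\<close>.\<close>

primrec lower :: "nat \<Rightarrow> 'w \<Rightarrow> 'w" where
  "lower 0 x = x"
| "lower (Suc n) x = of_nat (Suc n) \<odot> lower n x \<oplus> (-1) \<odot> num (lower n x)"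

lemma lower_in [simp]: "x \<in> carrier W \<Longrightarrow> lower n x \<in> carrier W"
  by (induction n) auto

lemma lower_add: "x \<in> carrier W \<Longrightarrow> y \<in> carrier W \<Longrightarrow> lower n (x \<oplus> y) = lower n x \<oplus> lower n y"
  by (induction n) (auto simp: add_ac)

lemma lower_scale: "x \<in> carrier W \<Longrightarrow> lower n (c \<odot> x) = c \<odot> lower n x"
  by (induction n) (auto simp: mult.commute)

text \<open>From \<open>Q\<^sub>i (k - N) = (k - 1 - N) Q\<^sub>i\<close>: the product from 1 to \<open>n + 1\<close> becomes the product from 0 to
  \<open>n\<close>, which has the extra factor \<open>- N\<close>.\<close>

lemma Q_lower:
  assumes x: "x \<in> carrier W"
  shows "Q i (lower (Suc n) x) = (-1) \<odot> num (lower n (Q i x))"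
proof (induction n)
  case 0
  then show ?case using x by (simp add: Q_num add_ac add_collect1)
next
  case (Suc n)
  let ?y = "lower n (Q i x)" and ?m = "of_nat (Suc n) :: rat"
  have "Q i (lower (Suc (Suc n)) x) = (?m + 1) \<odot> Q i (lower (Suc n) x) \<oplus>
      (-1) \<odot> (num (Q i (lower (Suc n) x)) \<oplus> Q i (lower (Suc n) x))"
    unfolding lower.simps(2)[of "Suc n"] using x by (simp add: Q_num add.commute del: lower.simps)
  also have "\<dots> = (- ?m) \<odot> num ?y \<oplus> num (num ?y)"
    unfolding Suc.IH using collect_commutator(1)[of "num ?y" "num (num ?y)" ?m] x
    by (simp only: num_scale num_in lower_in Q_simps(1))
  also have "\<dots> = (-1) \<odot> num (lower (Suc n) (Q i x))"
    using x by simp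
  finally show ?case .
qed

text \<open>The dual of the previous identity, from \<open>(k - N) P\<^sub>i = P\<^sub>i (k - 1 - N)\<close>.\<close>

lemma lower_P:
  assumes x: "x \<in> carrier W"
  shows "lower (Suc n) (P i x) = (-1) \<odot> P i (num (lower n x))"
proof (induction n)
  case 0
  then show ?case using x by (simp add: num_P add_ac add_collect1)
next
  case (Suc n)
  let ?y = "lower n x" and ?m = "of_nat (Suc n) :: rat"
  have "lower (Suc (Suc n)) (P i x) = (?m + 1) \<odot> lower (Suc n) (P i x) \<oplus>
      (-1) \<odot> num (lower (Suc n) (P i x))"
    by (simp add: add.commute)
  also have "\<dots> = (- ?m) \<odot> P i (num ?y) \<oplus> P i (num (num ?y))"
    unfolding Suc.IH using collect_commutator(2)[of "P i (num ?y)" "P i (num (num ?y))" ?m] x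
    by (simp only: num_scale num_P num_in lower_in P_simps(1))
  also have "\<dots> = (-1) \<odot> P i (num (lower (Suc n) x))"
    using x by simp
  finally show ?case .
qed

text \<open>By induction \<open>lower n (Q\<^sub>i x)\<close> is a vacuum vector, and the extra factor \<open>N\<close> kills it.\<close>

lemma lower_in_vac: "x \<in> carrier W \<Longrightarrow> qnil W Q (Suc n) x \<Longrightarrow> lower n x \<in> vac"
proof (induction n arbitrary: x)
  case (Suc n)
  have "Q i (lower (Suc n) x) = \<zero>" for i
  proof -
    have "lower n (Q i x) \<in> vac" by (rule Suc.IH) (use Suc.prems in auto)
    then show ?thesis using Q_lower[OF Suc.prems(1), of i n] num_vac by simp
  qed
  then show ?case using Suc.prems(1) lower_in[of x "Suc n"] unfolding vac_def by blast
qed (simp add: vac_def)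

lemma qnil_num: "x \<in> carrier W \<Longrightarrow> qnil W Q n x \<Longrightarrow> qnil W Q n (num x)"
proof (induction n arbitrary: x)
  case 0
  then show ?case using num_vac[of \<zero>] by (simp add: vac_def)
next
  case (Suc n)
  then show ?case by (simp add: Q_num qnil_add)
qed

text \<open>On the vacuum \<open>k - N\<close> is multiplication by \<open>k\<close>.\<close>

lemma lower_stable:
  assumes "lower n x \<in> vac"
  shows "lower (n + k) x \<in> vac \<and> (1 / fact (n + k)) \<odot> lower (n + k) x = (1 / fact n) \<odot> lower n x"
proof (induction k)
  case (Suc k)
  then have v: "lower (n + k) x \<in> vac" by simp
  then have l: "lower (Suc (n + k)) x = of_nat (Suc (n + k)) \<odot> lower (n + k) x"
    using num_vac[OF v] vacD(1)[OF v] by simp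
  have "of_nat (Suc (n + k)) / fact (Suc (n + k)) = (1 / fact (n + k) :: rat)"
    by (simp add: divide_simps)
  then show ?case using Suc v l vac_closed(4)[OF v] vacD(1)[OF v] by (simp del: lower.simps)
qed (use assms in simp)

text \<open>The projector onto the vacuum, the stable value of \<open>lower n x / n!\<close>.\<close>

definition proj :: "'w \<Rightarrow> 'w" where
  "proj x = (let n = LEAST n. lower n x \<in> vac in (1 / fact n) \<odot> lower n x)"

lemma proj_eq:
  assumes "lower n x \<in> vac"
  shows "proj x = (1 / fact n) \<odot> lower n x"
proof -
  let ?l = "LEAST n. lower n x \<in> vac"
  have l: "lower ?l x \<in> vac" by (rule LeastI[of "\<lambda>n. lower n x \<in> vac", OF assms])
  have "?l \<le> n" by (rule Least_le[of "\<lambda>n. lower n x \<in> vac", OF assms])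
  then show ?thesis using lower_stable[OF l, of "n - ?l"] by (simp add: proj_def Let_def)
qed

lemma lower_ex: "x \<in> carrier W \<Longrightarrow> \<exists>n. lower n x \<in> vac"
  using Q_nilpotent qnil_Suc lower_in_vac by blast

lemma proj_in_vac [simp]: "x \<in> carrier W \<Longrightarrow> proj x \<in> vac"
  using lower_ex[of x] proj_eq[of _ x] vac_closed(4) by metis

lemma proj_vac [simp]: "x \<in> vac \<Longrightarrow> proj x = x"
  using proj_eq[of 0 x] vacD(1) by simp

lemma lower_ex2:
  assumes "x \<in> carrier W" "y \<in> carrier W"
  obtains n where "lower n x \<in> vac" "lower n y \<in> vac"
proof -
  obtain a b where "lower a x \<in> vac" "lower b y \<in> vac" using lower_ex assms by meson
  then have "lower (a + b) x \<in> vac" "lower (b + a) y \<in> vac" using lower_stable by auto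
  then show thesis using that[of "a + b"] by (simp add: add.commute)
qed

lemma proj_add:
  assumes "x \<in> carrier W" "y \<in> carrier W"
  shows "proj (x \<oplus> y) = proj x \<oplus> proj y"
proof -
  obtain n where n: "lower n x \<in> vac" "lower n y \<in> vac" using lower_ex2[OF assms] .
  then have "lower n (x \<oplus> y) \<in> vac" using lower_add assms vac_closed(3) by simp
  then show ?thesis using n proj_eq assms by (simp add: lower_add)
qed

lemma proj_scale:
  assumes "x \<in> carrier W"
  shows "proj (c \<odot> x) = c \<odot> proj x"
proof -
  obtain n where n: "lower n x \<in> vac" using lower_ex[OF assms] by blast
  then have "lower n (c \<odot> x) \<in> vac" using lower_scale assms vac_closed(4) by simp
  then show ?thesis using n proj_eq assms by (simp add: lower_scale mult.commute)
qed

text \<open>By \<open>lower_P\<close> one further factor makes \<open>lower\<close> of \<open>P\<^sub>i x\<close> a multiple of \<open>P\<^sub>i N v\<close> for a vacuum vector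
  \<open>v\<close>, and \<open>N v = 0\<close>.\<close>

lemma proj_P:
  assumes "x \<in> carrier W"
  shows "proj (P i x) = \<zero>"
proof -
  obtain n where n: "lower n x \<in> vac" using lower_ex[OF assms] by blast
  then have "lower (Suc n) (P i x) = \<zero>" using lower_P[OF assms] num_vac by simp
  then show ?thesis using proj_eq[of "Suc n" "P i x"] vac_closed(2) by (simp del: lower.simps)
qed

text \<open>Induction on the length \<open>n + 1\<close> of the words that kill \<open>x\<close>.  The vectors \<open>Q\<^sub>b y\<close>, for \<open>y\<close> killed by
  words of the same length, belong to \<open>M\<close> by induction, and hence so does \<open>N y\<close>.  Thus \<open>N\<close> acts as zero
  modulo \<open>M\<close>, and \<open>lower n x\<close> is congruent to \<open>n! x\<close>; but it is also a vacuum vector.\<close>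

theorem vac_generates:
  assumes M: "subspace W M" and vac: "vac \<subseteq> M" and P: "\<And>i x. x \<in> M \<Longrightarrow> P i x \<in> M"
    and x: "x \<in> carrier W"
  shows "x \<in> M"
proof -
  note MD = subspaceD[OF M]
  have "x \<in> M" if "x \<in> carrier W" "qnil W Q n x" for n x
    using that
  proof (induction n arbitrary: x)
    case 0
    then show ?case using MD by simp
  next
    case (Suc n)
    have num_M: "num y \<in> M" if y: "y \<in> carrier W" "qnil W Q (Suc n) y" for y
    proof -
      have "Q b y \<in> M" for b using Suc.IH[of "Q b y"] y by simp
      then have "num_upto b y \<in> M" for b by (induction b) (simp_all add: MD P)
      then show ?thesis by (simp add: num_def)
    qed
    have "qnil W Q (Suc n) (lower k x) \<and> lower k x \<oplus> (- fact k) \<odot> x \<in> M" for k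
    proof (induction k)
      case 0
      then show ?case using Suc.prems MD by (simp add: add_collect1)
    next
      case (Suc k)
      let ?y = "lower k x"
      have y: "?y \<in> carrier W" "qnil W Q (Suc n) ?y" using Suc \<open>x \<in> carrier W\<close> by auto
      have "qnil W Q (Suc n) (lower (Suc k) x)"
        unfolding lower.simps by (intro qnil_add qnil_scale qnil_num scale_in num_in y)
      moreover have "lower (Suc k) x \<oplus> (- fact (Suc k)) \<odot> x =
          of_nat (Suc k) \<odot> (?y \<oplus> (- fact k) \<odot> x) \<oplus> (-1) \<odot> num ?y"
        using y \<open>x \<in> carrier W\<close> by (simp add: add_ac)
      moreover have "\<dots> \<in> M"
        by (rule MD(3)[OF MD(4) MD(4)]) (use Suc num_M[OF y] in blast)+
      ultimately show ?case by simp
    qed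
    then have m1: "lower n x \<oplus> (- fact n) \<odot> x \<in> M" by blast
    have m2: "lower n x \<in> M" using lower_in_vac[OF Suc.prems] vac by blast
    have "(1 / fact n) \<odot> (lower n x \<oplus> (-1) \<odot> (lower n x \<oplus> (- fact n) \<odot> x)) \<in> M"
      by (rule MD(4)[OF MD(3)[OF m2 MD(4)[OF m1]]])
    moreover have "(1 / fact n) \<odot> (lower n x \<oplus> (-1) \<odot> (lower n x \<oplus> (- fact n) \<odot> x)) = x"
      using Suc.prems(1) by (simp add: add_ac add_collect1 add_collect)
    ultimately show ?case by simp
  qed
  then show ?thesis using Q_nilpotent x by blast
qed

end

definition ladder_hom ::
  "(rat, 'w, 'c) module_scheme \<Rightarrow> (nat \<Rightarrow> 'w \<Rightarrow> 'w) \<Rightarrow> (nat \<Rightarrow> 'w \<Rightarrow> 'w) \<Rightarrow>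
   (rat, 'x, 'd) module_scheme \<Rightarrow> (nat \<Rightarrow> 'x \<Rightarrow> 'x) \<Rightarrow> (nat \<Rightarrow> 'x \<Rightarrow> 'x) \<Rightarrow> ('w \<Rightarrow> 'x) \<Rightarrow> bool" where
  "ladder_hom W P Q W' P' Q' f \<longleftrightarrow> linear_map W W' f \<and>
     (\<forall>i. \<forall>x\<in>carrier W. f (P i x) = P' i (f x) \<and> f (Q i x) = Q' i (f x))"

lemma ladder_homD:
  assumes "ladder_hom W P Q W' P' Q' f"
  shows "linear_map W W' f" "x \<in> carrier W \<Longrightarrow> f (P i x) = P' i (f x)"
    "x \<in> carrier W \<Longrightarrow> f (Q i x) = Q' i (f x)"
  using assms by (auto simp: ladder_hom_def)

locale ladder_pair = A: ladder W P Q \<epsilon> \<kappa> + B: ladder W' P' Q' \<epsilon> \<kappa>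
  for W :: "(rat, 'w, 'c) module_scheme" and P Q and W' :: "(rat, 'x, 'd) module_scheme" and P' Q'
    and \<epsilon> \<kappa>
begin

lemma hom_vac:
  assumes "ladder_hom W P Q W' P' Q' f" "x \<in> A.vac"
  shows "f x \<in> B.vac"
proof -
  note fD = ladder_homD[OF assms(1)] and x = A.vacD[OF assms(2)]
  have "Q' i (f x) = \<zero>\<^bsub>W'\<^esub>" for i
    using fD(3)[OF x(1), of i] x(2)[of i] linear_map_zero[OF fD(1) A.vector_space B.vector_space] by simp
  then show ?thesis using linear_mapD(1)[OF fD(1) x(1)] by (simp add: B.vac_def)
qed

lemma hom_unique:
  assumes f: "ladder_hom W P Q W' P' Q' f" and g: "ladder_hom W P Q W' P' Q' g"
    and eq: "\<And>x. x \<in> A.vac \<Longrightarrow> f x = g x" and x: "x \<in> carrier W"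
  shows "f x = g x"
proof -
  note fD = ladder_homD[OF f] and gD = ladder_homD[OF g]
  note fl = linear_mapD[OF fD(1)] and gl = linear_mapD[OF gD(1)]
  have z: "f \<zero>\<^bsub>W\<^esub> = g \<zero>\<^bsub>W\<^esub>"
    using linear_map_zero[OF fD(1)] linear_map_zero[OF gD(1)] A.vector_space B.vector_space by simp
  have "x \<in> {x \<in> carrier W. f x = g x}"
  proof (rule A.vac_generates[OF _ _ _ x])
    show "subspace W {x \<in> carrier W. f x = g x}"
      by (auto simp: subspace_def z fl gl)
    show "A.vac \<subseteq> {x \<in> carrier W. f x = g x}" using eq A.vacD by blast
    fix i y assume "y \<in> {x \<in> carrier W. f x = g x}"
    then show "P i y \<in> {x \<in> carrier W. f x = g x}" by (simp add: fD gD)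
  qed
  then show ?thesis by simp
qed

text \<open>The smallest linear relation that contains the graph of \<open>\<iota>\<close> and is stable under the creation
  operators.\<close>

inductive_set gen_graph :: "('w \<Rightarrow> 'x) \<Rightarrow> ('w \<times> 'x) set" for \<iota> where
  base: "v \<in> A.vac \<Longrightarrow> (v, \<iota> v) \<in> gen_graph \<iota>"
| add: "(x, y) \<in> gen_graph \<iota> \<Longrightarrow> (x', y') \<in> gen_graph \<iota> \<Longrightarrow> (x \<oplus>\<^bsub>W\<^esub> x', y \<oplus>\<^bsub>W'\<^esub> y') \<in> gen_graph \<iota>"
| scale: "(x, y) \<in> gen_graph \<iota> \<Longrightarrow> (c \<odot>\<^bsub>W\<^esub> x, c \<odot>\<^bsub>W'\<^esub> y) \<in> gen_graph \<iota>"
| creation: "(x, y) \<in> gen_graph \<iota> \<Longrightarrow> (P i x, P' i y) \<in> gen_graph \<iota>"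

text \<open>The relation \<open>gen_graph \<iota>\<close> is total because the vacuum generates \<open>W\<close>.  The point is that it is
  single valued, that is, \<open>(0, y)\<close> belongs to it only for \<open>y = 0\<close>.  Since it is stable under the
  annihilation operators, induction on the length of words killing \<open>y\<close> reduces to the case of a
  vacuum vector \<open>y\<close>, and on related pairs the two projectors correspond under \<open>\<iota>\<close>.\<close>

theorem hom_extension:
  assumes \<iota>: "linear_map (W\<lparr>carrier := A.vac\<rparr>) (W'\<lparr>carrier := B.vac\<rparr>) \<iota>"
  obtains f where "ladder_hom W P Q W' P' Q' f" "\<forall>x\<in>A.vac. f x = \<iota> x"
proof -
  have i_in: "\<iota> v \<in> B.vac" if "v \<in> A.vac" for v using linear_mapD(1)[OF \<iota>] that by simp
  have i_add: "\<iota> (v \<oplus>\<^bsub>W\<^esub> w) = \<iota> v \<oplus>\<^bsub>W'\<^esub> \<iota> w" if "v \<in> A.vac" "w \<in> A.vac" for v w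
    using linear_mapD(2)[OF \<iota>] that by simp
  have i_scale: "\<iota> (c \<odot>\<^bsub>W\<^esub> v) = c \<odot>\<^bsub>W'\<^esub> \<iota> v" if "v \<in> A.vac" for c v
    using linear_mapD(3)[OF \<iota>] that by simp
  have i_zero: "\<iota> \<zero>\<^bsub>W\<^esub> = \<zero>\<^bsub>W'\<^esub>"
    using i_scale[of "\<zero>\<^bsub>W\<^esub>" 0] i_in[of "\<zero>\<^bsub>W\<^esub>"] A.vac_closed(2) B.vacD(1) by simp
  let ?R = "gen_graph \<iota>"
  have in_carrier: "x \<in> carrier W \<and> y \<in> carrier W'" if "(x, y) \<in> ?R" for x y
    using that by induction (auto simp: A.vacD B.vacD[OF i_in])
  have R_zero: "(\<zero>\<^bsub>W\<^esub>, \<zero>\<^bsub>W'\<^esub>) \<in> ?R"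
    using gen_graph.base[OF A.vac_closed(2), of \<iota>] by (simp add: i_zero)
  have R_Q: "(Q i x, Q' i y) \<in> ?R" if "(x, y) \<in> ?R" for i x y
    using that
  proof induction
    case (base v)
    then show ?case using R_zero by (simp add: A.vacD(2) B.vacD(2)[OF i_in])
  next
    case (add x y x' y')
    then show ?case using in_carrier gen_graph.add by simp
  next
    case (scale x y c)
    then show ?case using in_carrier gen_graph.scale by simp
  next
    case (creation x y j)
    \<comment> \<open>the commutation relation expresses \<open>Q\<^sub>i P\<^sub>j\<close> in the same way on both sides\<close>
    then have "(\<epsilon> \<odot>\<^bsub>W\<^esub> P j (Q i x) \<oplus>\<^bsub>W\<^esub> (if i = j then \<kappa> i else 0) \<odot>\<^bsub>W\<^esub> x,
        \<epsilon> \<odot>\<^bsub>W'\<^esub> P' j (Q' i y) \<oplus>\<^bsub>W'\<^esub> (if i = j then \<kappa> i else 0) \<odot>\<^bsub>W'\<^esub> y) \<in> ?R"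
      by (intro gen_graph.add gen_graph.scale gen_graph.creation)
    then show ?case using in_carrier[OF creation(1)] by (simp only: A.QP B.QP)
  qed
  have R_proj: "B.proj y = \<iota> (A.proj x)" if "(x, y) \<in> ?R" for x y
    using that
  proof induction
    case (add x y x' y')
    then show ?case using in_carrier[of x y] in_carrier[of x' y']
      by (simp add: A.proj_add B.proj_add i_add)
  next
    case (scale x y c)
    then show ?case using in_carrier[of x y] by (simp add: A.proj_scale B.proj_scale i_scale)
  next
    case (creation x y j)
    then show ?case using in_carrier[of x y] by (simp add: A.proj_P B.proj_P i_zero)
  qed (simp add: i_in)
  have R_zero_unique: "y = \<zero>\<^bsub>W'\<^esub>" if "(\<zero>\<^bsub>W\<^esub>, y) \<in> ?R" "qnil W' Q' n y" for n y
    using that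
  proof (induction n arbitrary: y)
    case (Suc n)
    have "Q' i y = \<zero>\<^bsub>W'\<^esub>" for i
      using Suc.IH[of "Q' i y"] R_Q[OF Suc.prems(1), of i] Suc.prems(2) by simp
    then have "y \<in> B.vac" using in_carrier[OF Suc.prems(1)] by (simp add: B.vac_def)
    \<comment> \<open>the projector fixes the vacuum vector \<open>y\<close>, and also maps it to \<open>\<iota> \<zero>\<close>\<close>
    then show ?case using R_proj[OF Suc.prems(1)] A.vac_closed(2) by (simp add: i_zero)
  qed simp
  have R_unique: "y = y'" if "(x, y) \<in> ?R" "(x, y') \<in> ?R" for x y y'
  proof -
    have c: "x \<in> carrier W" "y \<in> carrier W'" "y' \<in> carrier W'" using in_carrier that by blast+
    have "(x \<oplus>\<^bsub>W\<^esub> (-1) \<odot>\<^bsub>W\<^esub> x, y \<oplus>\<^bsub>W'\<^esub> (-1) \<odot>\<^bsub>W'\<^esub> y') \<in> ?R"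
      by (intro gen_graph.add gen_graph.scale that)
    then have "(\<zero>\<^bsub>W\<^esub>, y \<oplus>\<^bsub>W'\<^esub> (-1) \<odot>\<^bsub>W'\<^esub> y') \<in> ?R" using c by (simp add: A.add_collect1)
    then have "y \<oplus>\<^bsub>W'\<^esub> (-1) \<odot>\<^bsub>W'\<^esub> y' = \<zero>\<^bsub>W'\<^esub>"
      using R_zero_unique B.Q_nilpotent in_carrier by blast
    then show ?thesis using B.eq_iff_diff_zero c by blast
  qed
  have R_total: "\<exists>y. (x, y) \<in> ?R" if x: "x \<in> carrier W" for x
  proof -
    have "x \<in> {x \<in> carrier W. \<exists>y. (x, y) \<in> ?R}"
    proof (rule A.vac_generates[OF _ _ _ x])
      show "subspace W {x \<in> carrier W. \<exists>y. (x, y) \<in> ?R}"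
        unfolding subspace_def
      proof (intro conjI ballI allI)
        show "\<zero>\<^bsub>W\<^esub> \<in> {x \<in> carrier W. \<exists>y. (x, y) \<in> ?R}" using R_zero by auto
        fix a assume "a \<in> {x \<in> carrier W. \<exists>y. (x, y) \<in> ?R}"
        then obtain a' where a: "a \<in> carrier W" "(a, a') \<in> ?R" by blast
        show "c \<odot>\<^bsub>W\<^esub> a \<in> {x \<in> carrier W. \<exists>y. (x, y) \<in> ?R}" for c
          using gen_graph.scale[OF a(2)] a(1) by auto
        fix b assume "b \<in> {x \<in> carrier W. \<exists>y. (x, y) \<in> ?R}"
        then obtain b' where b: "b \<in> carrier W" "(b, b') \<in> ?R" by blast
        show "a \<oplus>\<^bsub>W\<^esub> b \<in> {x \<in> carrier W. \<exists>y. (x, y) \<in> ?R}"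
          using gen_graph.add[OF a(2) b(2)] a(1) b(1) by auto
      qed auto
      show "A.vac \<subseteq> {x \<in> carrier W. \<exists>y. (x, y) \<in> ?R}" using gen_graph.base A.vacD(1) by blast
      fix i y assume "y \<in> {x \<in> carrier W. \<exists>y. (x, y) \<in> ?R}"
      then obtain z where z: "y \<in> carrier W" "(y, z) \<in> ?R" by blast
      then show "P i y \<in> {x \<in> carrier W. \<exists>y. (x, y) \<in> ?R}"
        using gen_graph.creation[OF z(2), of i] by auto
    qed
    then show ?thesis by simp
  qed
  define f where "f x = (THE y. (x, y) \<in> ?R)" for x
  have f_eq: "f x = y" if "(x, y) \<in> ?R" for x y
    unfolding f_def by (rule the_equality) (use that R_unique in auto)
  have fR: "(x, f x) \<in> ?R" if "x \<in> carrier W" for x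
    using R_total[OF that] f_eq by metis
  have "linear_map W W' f"
    unfolding linear_map_def
  proof (intro conjI ballI allI funcsetI)
    fix a assume a: "a \<in> carrier W"
    show "f a \<in> carrier W'" using in_carrier[OF fR[OF a]] by simp
    show "f (c \<odot>\<^bsub>W\<^esub> a) = c \<odot>\<^bsub>W'\<^esub> f a" for c by (rule f_eq[OF gen_graph.scale[OF fR[OF a]]])
    fix b assume b: "b \<in> carrier W"
    show "f (a \<oplus>\<^bsub>W\<^esub> b) = f a \<oplus>\<^bsub>W'\<^esub> f b" by (rule f_eq[OF gen_graph.add[OF fR[OF a] fR[OF b]]])
  qed
  moreover have "f (P i x) = P' i (f x)" "f (Q i x) = Q' i (f x)" if "x \<in> carrier W" for i x
    using f_eq gen_graph.creation[OF fR[OF that]] R_Q[OF fR[OF that]] by blast+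
  ultimately have "ladder_hom W P Q W' P' Q' f" by (simp add: ladder_hom_def)
  moreover have "\<forall>x\<in>A.vac. f x = \<iota> x" using f_eq gen_graph.base by blast
  ultimately show thesis using that by blast
qed

end

lemma ladder_hom_comp:
  "ladder_hom W P Q W' P' Q' f \<Longrightarrow> ladder_hom W' P' Q' W'' P'' Q'' g \<Longrightarrow>
     ladder_hom W P Q W'' P'' Q'' (\<lambda>x. g (f x))"
  unfolding ladder_hom_def by (auto intro: linear_map_comp simp: linear_mapD(1))

lemma ladder_hom_id: "ladder_hom W P Q W P Q (\<lambda>x. x)"
  by (simp add: ladder_hom_def linear_map_id)

text \<open>The extensions of mutually inverse maps of the vacua compose to endomorphisms that are the
  identity on the vacuum, hence everywhere.\<close>

theorem ladder_iso_of_vac_iso: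
  assumes "ladder W P Q \<epsilon> \<kappa>" "ladder W' P' Q' \<epsilon> \<kappa>"
    and i: "linear_map (W\<lparr>carrier := ladder.vac W Q\<rparr>) (W'\<lparr>carrier := ladder.vac W' Q'\<rparr>) i"
    and j: "linear_map (W'\<lparr>carrier := ladder.vac W' Q'\<rparr>) (W\<lparr>carrier := ladder.vac W Q\<rparr>) j"
    and ji: "\<And>x. x \<in> ladder.vac W Q \<Longrightarrow> j (i x) = x"
    and ij: "\<And>y. y \<in> ladder.vac W' Q' \<Longrightarrow> i (j y) = y"
  obtains f g where "ladder_hom W P Q W' P' Q' f" "ladder_hom W' P' Q' W P Q g"
    "\<forall>x\<in>carrier W. g (f x) = x" "\<forall>y\<in>carrier W'. f (g y) = y"
proof -
  interpret A: ladder W P Q \<epsilon> \<kappa> by (fact assms(1))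
  interpret B: ladder W' P' Q' \<epsilon> \<kappa> by (fact assms(2))
  interpret AB: ladder_pair W P Q W' P' Q' \<epsilon> \<kappa> ..
  interpret BA: ladder_pair W' P' Q' W P Q \<epsilon> \<kappa> ..
  interpret AA: ladder_pair W P Q W P Q \<epsilon> \<kappa> ..
  interpret BB: ladder_pair W' P' Q' W' P' Q' \<epsilon> \<kappa> ..
  obtain f where f: "ladder_hom W P Q W' P' Q' f" "\<forall>x\<in>A.vac. f x = i x"
    using AB.hom_extension[OF i] .
  obtain g where g: "ladder_hom W' P' Q' W P Q g" "\<forall>y\<in>B.vac. g y = j y"
    using BA.hom_extension[OF j] .
  have "g (f x) = x" if "x \<in> carrier W" for x
    by (rule AA.hom_unique[OF ladder_hom_comp[OF f(1) g(1)] ladder_hom_id _ that])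
      (use f(2) g(2) AB.hom_vac[OF f(1)] ji in force)
  moreover have "f (g y) = y" if "y \<in> carrier W'" for y
    by (rule BB.hom_unique[OF ladder_hom_comp[OF g(1) f(1)] ladder_hom_id _ that])
      (use f(2) g(2) BA.hom_vac[OF g(1)] ij in force)
  ultimately show thesis using that f g by blast
qed

section \<open>Free spaces and tensor products\<close>

lemma lookup_pm_scale [simp]: "Poly_Mapping.lookup (pm_scale c p) k = c * Poly_Mapping.lookup p k"
  by (simp add: pm_scale_def Poly_Mapping.map.rep_eq when_def)

lemma pm_scale_simps [simp]:
  "pm_scale a (pm_scale b p) = pm_scale (a * b) p" "pm_scale 1 p = p" "pm_scale 0 p = 0"
  "pm_scale c 0 = 0" "pm_scale c (Poly_Mapping.single k a) = Poly_Mapping.single k (c * a)"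
  by (rule poly_mapping_eqI; simp add: lookup_single when_def algebra_simps)+

lemma pm_scale_add: "pm_scale c (p + q) = pm_scale c p + pm_scale c q"
  and pm_scale_diff: "pm_scale c (p - q) = pm_scale c p - pm_scale c q"
  and add_pm_scale: "pm_scale (a + b) p = pm_scale a p + pm_scale b p"
  by (rule poly_mapping_eqI; simp add: lookup_add lookup_minus algebra_simps)+

lemma diff_eq_pm_scale: "p - q = p + pm_scale (-1) q"
  by (simp add: poly_mapping_eq_iff fun_eq_iff lookup_add lookup_minus)

lemma keys_pm_scale: "Poly_Mapping.keys (pm_scale c p) \<subseteq> Poly_Mapping.keys p"
  by (auto simp: in_keys_iff)

definition free_space :: "'b set \<Rightarrow> (rat, 'b \<Rightarrow>\<^sub>0 rat) module" where
  "free_space S = \<lparr>carrier = {p. Poly_Mapping.keys p \<subseteq> S}, mult = undefined, one = undefined,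
     zero = 0, add = (+), smult = pm_scale\<rparr>"

lemma free_space_sel [simp]:
  "carrier (free_space S) = {p. Poly_Mapping.keys p \<subseteq> S}" "\<zero>\<^bsub>free_space S\<^esub> = 0"
  "x \<oplus>\<^bsub>free_space S\<^esub> y = x + y" "c \<odot>\<^bsub>free_space S\<^esub> x = pm_scale c x"
  by (simp_all add: free_space_def)

lemma free_space_vector_space:
  fixes S :: "'b set"
  shows "rat_vector_space (free_space S)"
proof (rule rat_vector_spaceI)
  fix p q :: "'b \<Rightarrow>\<^sub>0 rat" and c
  assume "p \<in> carrier (free_space S)" "q \<in> carrier (free_space S)"
  then show "p \<oplus>\<^bsub>free_space S\<^esub> q \<in> carrier (free_space S)"
    using Poly_Mapping.keys_add[of p q] by auto
next
  fix p :: "'b \<Rightarrow>\<^sub>0 rat" and c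
  assume "p \<in> carrier (free_space S)"
  then show "c \<odot>\<^bsub>free_space S\<^esub> p \<in> carrier (free_space S)"
    using keys_pm_scale[of c p] by auto
qed (auto simp: pm_scale_add add_pm_scale ac_simps)

lemma free_space_induct:
  assumes S: "subspace (free_space A) S" and "\<And>a. a \<in> A \<Longrightarrow> Poly_Mapping.single a 1 \<in> S"
    and p: "Poly_Mapping.keys p \<subseteq> A"
  shows "p \<in> S"
proof -
  note SD = subspaceD[OF S, simplified]
  have "(\<Sum>k\<in>B. Poly_Mapping.single k (Poly_Mapping.lookup p k)) \<in> S"
    if "finite B" "B \<subseteq> Poly_Mapping.keys p" for B
    using that
  proof (induction B rule: finite_induct)
    case (insert k B)
    have "Poly_Mapping.single k 1 \<in> S" using assms(2) insert.prems p by blast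
    from SD(4)[OF this, of "Poly_Mapping.lookup p k"]
    have "Poly_Mapping.single k (Poly_Mapping.lookup p k) \<in> S" by simp
    then show ?case using insert SD(3) by simp
  qed (simp add: SD)
  moreover have "(\<Sum>k\<in>Poly_Mapping.keys p. Poly_Mapping.single k (Poly_Mapping.lookup p k)) = p"
    by (rule poly_mapping_eqI) (simp add: lookup_sum lookup_single when_def in_keys_iff)
  ultimately show ?thesis by (metis finite_keys order_refl)
qed

text \<open>The value at \<open>p\<close> is the linear combination of the \<open>b a\<close> with the coefficients of \<open>p\<close>.  The sum may be
  taken over any finite set containing the support, and for additivity a common one is used.\<close>

lemma free_space_lift:
  fixes L (structure)
  assumes L: "rat_vector_space L" and b: "\<And>a. a \<in> A \<Longrightarrow> b a \<in> carrier L"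
  obtains h where "linear_map (free_space A) L h" "\<forall>a\<in>A. h (Poly_Mapping.single a 1) = b a"
proof -
  interpret L: rat_vs L by (rule rat_vs.intro[OF L])
  interpret M: Module.module rat_field L by (fact L)
  define ev where "ev B p = finsum L (\<lambda>k. Poly_Mapping.lookup p k \<odot>\<^bsub>L\<^esub> b k) B" for B p
  have ev_in: "ev B p \<in> carrier L" if "B \<subseteq> A" for B p
    unfolding ev_def by (rule M.finsum_closed) (use that b in auto)
  have ev_sup: "ev B p = ev (Poly_Mapping.keys p) p" if "finite B" "Poly_Mapping.keys p \<subseteq> B" "B \<subseteq> A" for B p
    unfolding ev_def
    by (rule M.add.finprod_mono_neutral_cong_right[unfolded finsum_def[symmetric], simplified])
      (use that b in \<open>auto simp: in_keys_iff finsum_def\<close>)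
  have ev_add: "ev B (p + q) = ev B p \<oplus>\<^bsub>L\<^esub> ev B q" if "B \<subseteq> A" for B p q
    unfolding ev_def
    by (subst M.finsum_addf[symmetric])
      (use that b in \<open>auto simp: lookup_add L.add_scale intro!: M.finsum_cong'\<close>)
  have ev_scale: "ev B (pm_scale c p) = c \<odot>\<^bsub>L\<^esub> ev B p" if "finite B" "B \<subseteq> A" for B c p
    unfolding ev_def
    by (subst M.finsum_smult_ldistr) (use that b in \<open>auto intro!: M.finsum_cong'\<close>)
  let ?h = "\<lambda>p. ev (Poly_Mapping.keys p) p"
  have "linear_map (free_space A) L ?h"
    unfolding linear_map_def
  proof (intro conjI ballI allI funcsetI)
    fix p assume p: "p \<in> carrier (free_space A)"
    show "?h p \<in> carrier L" using ev_in p by simp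
    show "?h (c \<odot>\<^bsub>free_space A\<^esub> p) = c \<odot>\<^bsub>L\<^esub> ?h p" for c
      using ev_sup[of "Poly_Mapping.keys p" "pm_scale c p"] ev_scale[of "Poly_Mapping.keys p" c p] p
        keys_pm_scale[of c p] by simp
    fix q assume q: "q \<in> carrier (free_space A)"
    let ?B = "Poly_Mapping.keys p \<union> Poly_Mapping.keys q"
    show "?h (p \<oplus>\<^bsub>free_space A\<^esub> q) = ?h p \<oplus>\<^bsub>L\<^esub> ?h q"
      using ev_sup[of ?B "p + q"] ev_sup[of ?B p] ev_sup[of ?B q] ev_add[of ?B p q] p q
        Poly_Mapping.keys_add[of p q] by simp
  qed
  moreover have "?h (Poly_Mapping.single a 1) = b a" if "a \<in> A" for a
    using b[OF that] by (simp add: ev_def)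
  ultimately show thesis using that by blast
qed

lemma free_map_superset:
  assumes "finite A" "Poly_Mapping.keys p \<subseteq> A"
  shows "free_map h p = (\<Sum>k\<in>A. Poly_Mapping.single (h k) (Poly_Mapping.lookup p k))"
  unfolding free_map_def
  by (rule sum.mono_neutral_left) (use assms in \<open>auto simp: in_keys_iff\<close>)

lemma free_map_add: "free_map h (p + q) = free_map h p + free_map h q"
proof -
  let ?A = "Poly_Mapping.keys p \<union> Poly_Mapping.keys q"
  show ?thesis
    using free_map_superset[of ?A "p + q" h] free_map_superset[of ?A p h] free_map_superset[of ?A q h]
      Poly_Mapping.keys_add[of p q]
    by (simp add: lookup_add single_add sum.distrib)
qed

lemma free_map_scale: "free_map h (pm_scale c p) = pm_scale c (free_map h p)"
proof -
  have "pm_scale c (\<Sum>k\<in>A. Poly_Mapping.single (h k) (Poly_Mapping.lookup p k)) =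
      (\<Sum>k\<in>A. Poly_Mapping.single (h k) (c * Poly_Mapping.lookup p k))" if "finite A" for A
    using that by (induction A rule: finite_induct) (simp_all add: pm_scale_add)
  then show ?thesis
    using free_map_superset[of "Poly_Mapping.keys p" "pm_scale c p" h] keys_pm_scale[of c p]
    by (simp add: free_map_def)
qed

lemma free_map_diff: "free_map h (p - q) = free_map h p - free_map h q"
  by (simp add: diff_eq_pm_scale free_map_add free_map_scale)

lemma free_map_single [simp]: "free_map h (Poly_Mapping.single k c) = Poly_Mapping.single (h k) c"
  by (cases "c = 0") (simp_all add: free_map_def)

lemma keys_free_map: "Poly_Mapping.keys (free_map h p) \<subseteq> h ` Poly_Mapping.keys p"
proof -
  have "Poly_Mapping.keys (\<Sum>k\<in>A. Poly_Mapping.single (h k) (Poly_Mapping.lookup p k)) \<subseteq> h ` A"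
    if "finite A" for A
    using that
  proof (induction A rule: finite_induct)
    case (insert x A)
    then show ?case
      using Poly_Mapping.keys_add[of "Poly_Mapping.single (h x) (Poly_Mapping.lookup p x)"
          "\<Sum>k\<in>A. Poly_Mapping.single (h k) (Poly_Mapping.lookup p k)"]
      by (auto split: if_splits)
  qed simp
  then show ?thesis by (simp add: free_map_def)
qed

lemma tensor_null_diff: "p \<in> tensor_null M N \<Longrightarrow> q \<in> tensor_null M N \<Longrightarrow> p - q \<in> tensor_null M N"
  by (simp add: diff_eq_pm_scale null_add null_scale)

lemma tensor_class_eq_iff: "tensor_class M N p = tensor_class M N q \<longleftrightarrow> p - q \<in> tensor_null M N"
proof
  assume "tensor_class M N p = tensor_class M N q"
  moreover have "p \<in> tensor_class M N p" by (simp add: tensor_class_def null_zero)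
  ultimately show "p - q \<in> tensor_null M N" by (simp add: tensor_class_def)
next
  assume *: "p - q \<in> tensor_null M N"
  have "r - p \<in> tensor_null M N \<longleftrightarrow> r - q \<in> tensor_null M N" for r
    using null_add[OF _ *, of "r - p"] tensor_null_diff[OF _ *, of "r - q"] by auto
  then show "tensor_class M N p = tensor_class M N q" by (simp add: tensor_class_def)
qed

text \<open>The operations of the tensor product are unions over all representatives; this lemma
  evaluates them at one representative.\<close>

lemma UN_tensor_class:
  assumes "\<And>p'. p' - p \<in> tensor_null M N \<Longrightarrow> f p' = f p"
  shows "(\<Union>p'\<in>tensor_class M N p. f p') = f p"
proof
  show "(\<Union>p'\<in>tensor_class M N p. f p') \<subseteq> f p"
    using assms by (auto simp: tensor_class_def)
  have "p \<in> tensor_class M N p" by (simp add: tensor_class_def null_zero)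
  then show "f p \<subseteq> (\<Union>p'\<in>tensor_class M N p. f p')" by blast
qed

lemma tensor_prod_sel:
  "carrier (tensor_prod M N) = tensor_class M N ` tensor_free M N"
  "\<zero>\<^bsub>tensor_prod M N\<^esub> = tensor_class M N 0"
  "tensor_class M N p \<oplus>\<^bsub>tensor_prod M N\<^esub> tensor_class M N q = tensor_class M N (p + q)"
  "c \<odot>\<^bsub>tensor_prod M N\<^esub> tensor_class M N p = tensor_class M N (pm_scale c p)"
proof -
  have "(\<Union>p'\<in>tensor_class M N p. \<Union>q'\<in>tensor_class M N q. tensor_class M N (p' + q')) =
      (\<Union>q'\<in>tensor_class M N q. tensor_class M N (p + q'))"
    by (rule UN_tensor_class, rule SUP_cong[OF refl]) (simp add: tensor_class_eq_iff)
  also have "\<dots> = tensor_class M N (p + q)"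
    by (rule UN_tensor_class) (simp add: tensor_class_eq_iff)
  finally show "tensor_class M N p \<oplus>\<^bsub>tensor_prod M N\<^esub> tensor_class M N q = tensor_class M N (p + q)"
    by (simp add: tensor_prod_def)
  have "(\<Union>p'\<in>tensor_class M N p. tensor_class M N (pm_scale c p')) = tensor_class M N (pm_scale c p)"
    by (rule UN_tensor_class) (simp add: tensor_class_eq_iff null_scale flip: pm_scale_diff)
  then show "c \<odot>\<^bsub>tensor_prod M N\<^esub> tensor_class M N p = tensor_class M N (pm_scale c p)"
    by (simp add: tensor_prod_def)
qed (simp_all add: tensor_prod_def)

lemma tensor_prod_vector_space: "rat_vector_space (tensor_prod M N)"
  using rat_vector_space_image(1)[OF free_space_vector_space, of "tensor_prod M N" "tensor_class M N"
      "carrier M \<times> carrier N"]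
  by (simp add: tensor_prod_sel tensor_free_def)

definition tens :: "(rat, 'm, 'c) module_scheme \<Rightarrow> (rat, 'n, 'd) module_scheme \<Rightarrow> 'm \<Rightarrow> 'n \<Rightarrow> ('m, 'n) tensor"
  where "tens M N m n = tensor_class M N (Poly_Mapping.single (m, n) 1)"

lemma tens_in [simp]: "m \<in> carrier M \<Longrightarrow> n \<in> carrier N \<Longrightarrow> tens M N m n \<in> carrier (tensor_prod M N)"
  by (simp add: tens_def tensor_prod_sel tensor_free_def)

lemma tens_add_left:
  "m \<in> carrier M \<Longrightarrow> m' \<in> carrier M \<Longrightarrow> n \<in> carrier N \<Longrightarrow>
     tens M N (m \<oplus>\<^bsub>M\<^esub> m') n = tens M N m n \<oplus>\<^bsub>tensor_prod M N\<^esub> tens M N m' n"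
  using null_add_left[of m M m' n N] by (simp add: tens_def tensor_prod_sel tensor_class_eq_iff diff_diff_add)

lemma tens_add_right:
  "m \<in> carrier M \<Longrightarrow> n \<in> carrier N \<Longrightarrow> n' \<in> carrier N \<Longrightarrow>
     tens M N m (n \<oplus>\<^bsub>N\<^esub> n') = tens M N m n \<oplus>\<^bsub>tensor_prod M N\<^esub> tens M N m n'"
  using null_add_right[of m M n N n'] by (simp add: tens_def tensor_prod_sel tensor_class_eq_iff diff_diff_add)

lemma tens_scale_left:
  "m \<in> carrier M \<Longrightarrow> n \<in> carrier N \<Longrightarrow> tens M N (c \<odot>\<^bsub>M\<^esub> m) n = c \<odot>\<^bsub>tensor_prod M N\<^esub> tens M N m n"
  using null_scale_left[of m M n N c] by (simp add: tens_def tensor_prod_sel tensor_class_eq_iff)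

lemma tens_scale_right:
  "m \<in> carrier M \<Longrightarrow> n \<in> carrier N \<Longrightarrow> tens M N m (c \<odot>\<^bsub>N\<^esub> n) = c \<odot>\<^bsub>tensor_prod M N\<^esub> tens M N m n"
  using null_scale_right[of m M n N c] by (simp add: tens_def tensor_prod_sel tensor_class_eq_iff)

lemma tens_linear_left:
  "n \<in> carrier N \<Longrightarrow> linear_map M (tensor_prod M N) (\<lambda>m. tens M N m n)"
  and tens_linear_right:
  "m \<in> carrier M \<Longrightarrow> linear_map N (tensor_prod M N) (\<lambda>n. tens M N m n)"
  by (auto simp: linear_map_def tens_add_left tens_add_right tens_scale_left tens_scale_right)

lemma linear_map_preimage_subspace:
  assumes "rat_vector_space V" "rat_vector_space W" "linear_map V W f" "subspace W S"
  shows "subspace V {x \<in> carrier V. f x \<in> S}"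
proof -
  interpret V: rat_vs V by (rule rat_vs.intro[OF assms(1)])
  show ?thesis
    using linear_mapD[OF assms(3)] linear_map_zero[OF assms(3,1,2)] subspaceD[OF assms(4)]
    by (auto simp: subspace_def)
qed

text \<open>Restricting the pairs \<open>(m, n)\<close> to a subset \<open>A\<close> accommodates homogeneous components, which are
  spanned by the tensors \<open>m \<otimes> n\<close> with \<open>m\<close> of a given degree.\<close>

lemma tensor_class_linear_on:
  assumes "A \<subseteq> carrier M \<times> carrier N"
  shows "linear_map (free_space A) (tensor_prod M N) (tensor_class M N)"
  using assms by (auto simp: linear_map_def tensor_prod_sel tensor_free_def)

lemma tensor_class_induct:
  assumes S: "subspace (tensor_prod M N) S" and A: "A \<subseteq> carrier M \<times> carrier N"
    and pure: "\<And>m n. (m, n) \<in> A \<Longrightarrow> tens M N m n \<in> S"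
    and p: "Poly_Mapping.keys p \<subseteq> A"
  shows "tensor_class M N p \<in> S"
proof -
  have "p \<in> {p \<in> carrier (free_space A). tensor_class M N p \<in> S}"
  proof (rule free_space_induct[OF _ _ p])
    show "subspace (free_space A) {p \<in> carrier (free_space A). tensor_class M N p \<in> S}"
      by (rule linear_map_preimage_subspace[OF free_space_vector_space tensor_prod_vector_space
            tensor_class_linear_on[OF A] S])
    show "Poly_Mapping.single a 1 \<in> {p \<in> carrier (free_space A). tensor_class M N p \<in> S}" if "a \<in> A" for a
      using that pure[of "fst a" "snd a"] by (auto simp: tens_def)
  qed
  then show ?thesis by simp
qed

lemma tensor_induct:
  assumes S: "subspace (tensor_prod M N) S"
    and pure: "\<And>m n. m \<in> carrier M \<Longrightarrow> n \<in> carrier N \<Longrightarrow> tens M N m n \<in> S"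
    and x: "x \<in> carrier (tensor_prod M N)"
  shows "x \<in> S"
proof -
  obtain p where p: "Poly_Mapping.keys p \<subseteq> carrier M \<times> carrier N" "x = tensor_class M N p"
    using x by (auto simp: tensor_prod_sel tensor_free_def)
  show ?thesis unfolding p(2) by (rule tensor_class_induct[OF S order_refl _ p(1)]) (simp add: pure)
qed

lemma linear_map_equalizer_subspace:
  assumes "rat_vector_space V" "rat_vector_space W" "linear_map V W f" "linear_map V W g"
  shows "subspace V {x \<in> carrier V. f x = g x}"
proof -
  interpret V: rat_vs V by (rule rat_vs.intro[OF assms(1)])
  show ?thesis
    using linear_mapD[OF assms(3)] linear_mapD[OF assms(4)] linear_map_zero[OF assms(3,1,2)]
      linear_map_zero[OF assms(4,1,2)]
    by (auto simp: subspace_def)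
qed

lemma tensor_linear_map_eq:
  assumes "rat_vector_space L" "linear_map (tensor_prod M N) L f" "linear_map (tensor_prod M N) L g"
    and "\<And>m n. m \<in> carrier M \<Longrightarrow> n \<in> carrier N \<Longrightarrow> f (tens M N m n) = g (tens M N m n)"
    and "x \<in> carrier (tensor_prod M N)"
  shows "f x = g x"
proof -
  have "x \<in> {x \<in> carrier (tensor_prod M N). f x = g x}"
    by (rule tensor_induct[OF linear_map_equalizer_subspace[OF tensor_prod_vector_space assms(1-3)] _ assms(5)])
      (use assms(4) in simp)
  then show ?thesis by simp
qed

locale two_spaces = M: rat_vs M + N: rat_vs N
  for M :: "(rat, 'm, 'c) module_scheme" and N :: "(rat, 'n, 'd) module_scheme"
begin

text \<open>The universal property: the linear extension of \<open>\<beta>\<close> to the free space kills each generator of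
  \<^const>\<open>tensor_null\<close> by bilinearity.\<close>

lemma tensor_lift:
  assumes L: "rat_vector_space L"
    and left: "\<And>n. n \<in> carrier N \<Longrightarrow> linear_map M L (\<lambda>m. \<beta> m n)"
    and right: "\<And>m. m \<in> carrier M \<Longrightarrow> linear_map N L (\<lambda>n. \<beta> m n)"
  obtains h where "linear_map (tensor_prod M N) L h"
    "\<forall>m\<in>carrier M. \<forall>n\<in>carrier N. h (tens M N m n) = \<beta> m n"
proof -
  let ?A = "carrier M \<times> carrier N"
  interpret L: rat_vs L by (rule rat_vs.intro[OF L])
  interpret F: rat_vs "free_space ?A" by (rule rat_vs.intro[OF free_space_vector_space])
  note lD = linear_mapD[OF left] and rD = linear_mapD[OF right]
  have b_in: "(case a of (m, n) \<Rightarrow> \<beta> m n) \<in> carrier L" if "a \<in> ?A" for a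
    using that lD(1) by auto
  obtain h0 where h0: "linear_map (free_space ?A) L h0"
    "\<forall>a\<in>?A. h0 (Poly_Mapping.single a 1) = (case a of (m, n) \<Rightarrow> \<beta> m n)"
    using free_space_lift[OF L b_in] .
  note hD = linear_mapD[OF h0(1), simplified]
  have h1: "h0 (Poly_Mapping.single (m, n) 1) = \<beta> m n" if "m \<in> carrier M" "n \<in> carrier N" for m n
    using h0(2) that by auto
  have hc: "h0 (Poly_Mapping.single (m, n) c) = c \<odot>\<^bsub>L\<^esub> \<beta> m n" if "m \<in> carrier M" "n \<in> carrier N" for m n c
    using hD(3)[of "Poly_Mapping.single (m, n) 1" c] h1[OF that] that by simp
  have hdiff: "h0 (p - q) = h0 p \<oplus>\<^bsub>L\<^esub> (-1) \<odot>\<^bsub>L\<^esub> h0 q" and diff_in: "Poly_Mapping.keys (p - q) \<subseteq> ?A"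
    if "Poly_Mapping.keys p \<subseteq> ?A" "Poly_Mapping.keys q \<subseteq> ?A" for p q
    using that hD(2)[of p "pm_scale (-1) q"] hD(3)[of q "-1"] F.scale_in[of q "-1"]
      F.add_in[of p "pm_scale (-1) q"] by (simp_all add: diff_eq_pm_scale)
  have null: "Poly_Mapping.keys p \<subseteq> ?A \<and> h0 p = \<zero>\<^bsub>L\<^esub>" if "p \<in> tensor_null M N" for p
    using that
  proof induction
    case null_zero
    then show ?case using linear_map_zero[OF h0(1) free_space_vector_space L] by simp
  next
    case (null_add p q)
    then show ?case using hD(2) F.add_in[of p q] by simp
  next
    case (null_scale p c)
    then show ?case using hD(3) F.scale_in[of p c] by simp
  next
    case (null_add_left m m' n)
    then show ?case using lD by (simp add: hdiff diff_in h1 L.add_ac L.add_collect1)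
  next
    case (null_add_right m n n')
    then show ?case using rD by (simp add: hdiff diff_in h1 L.add_ac L.add_collect1)
  next
    case (null_scale_left m n c)
    then show ?case using lD by (simp add: hdiff diff_in h1 hc L.add_collect)
  next
    case (null_scale_right m n c)
    then show ?case using rD by (simp add: hdiff diff_in h1 hc L.add_collect)
  qed
  define h where "h X = h0 (SOME p. p \<in> X \<and> p \<in> tensor_free M N)" for X
  have h_class: "h (tensor_class M N p) = h0 p" if p: "p \<in> tensor_free M N" for p
  proof -
    let ?q = "SOME q. q \<in> tensor_class M N p \<and> q \<in> tensor_free M N"
    have "?q \<in> tensor_class M N p \<and> ?q \<in> tensor_free M N"
      by (rule someI[of _ p]) (use p in \<open>simp add: tensor_class_def tensor_null.null_zero\<close>)
    then have q: "?q - p \<in> tensor_null M N" "?q \<in> tensor_free M N" by (simp_all add: tensor_class_def)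
    have "h0 ?q \<oplus>\<^bsub>L\<^esub> (-1) \<odot>\<^bsub>L\<^esub> h0 p = \<zero>\<^bsub>L\<^esub>"
      using null[OF q(1)] hdiff[of ?q p] q(2) p by (simp add: tensor_free_def)
    then show ?thesis
      using L.eq_iff_diff_zero[of "h0 ?q" "h0 p"] hD(1) q(2) p by (simp add: h_def tensor_free_def)
  qed
  have "linear_map (tensor_prod M N) L h"
    unfolding linear_map_def
  proof (intro conjI ballI allI funcsetI)
    fix x assume "x \<in> carrier (tensor_prod M N)"
    then obtain p where p: "p \<in> tensor_free M N" "x = tensor_class M N p" by (auto simp: tensor_prod_sel)
    show "h x \<in> carrier L" using p hD(1) h_class by (simp add: tensor_free_def)
    show "h (c \<odot>\<^bsub>tensor_prod M N\<^esub> x) = c \<odot>\<^bsub>L\<^esub> h x" for c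
      using p hD(3)[of p c] h_class[OF p(1)] h_class[of "pm_scale c p"] F.scale_in[of p c]
      by (simp add: tensor_free_def tensor_prod_sel)
    fix y assume "y \<in> carrier (tensor_prod M N)"
    then obtain q where q: "q \<in> tensor_free M N" "y = tensor_class M N q" by (auto simp: tensor_prod_sel)
    show "h (x \<oplus>\<^bsub>tensor_prod M N\<^esub> y) = h x \<oplus>\<^bsub>L\<^esub> h y"
      using p q hD(2)[of p q] h_class[OF p(1)] h_class[OF q(1)] h_class[of "p + q"] F.add_in[of p q]
      by (simp add: tensor_free_def tensor_prod_sel)
  qed
  moreover have "h (tens M N m n) = \<beta> m n" if "m \<in> carrier M" "n \<in> carrier N" for m n
    unfolding tens_def using that h_class[of "Poly_Mapping.single (m, n) 1"] h1 by (simp add: tensor_free_def)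
  ultimately show thesis using that by blast
qed

end

text \<open>Linearity of \<open>f\<close> and \<open>g\<close> makes each bilinearity relation go to a bilinearity relation.\<close>

lemma free_map_tensor_null:
  assumes f: "linear_map M M' f" and g: "linear_map N N' g" and p: "p \<in> tensor_null M N"
  shows "free_map (map_prod f g) p \<in> tensor_null M' N'"
proof -
  note fD = linear_mapD[OF f] and gD = linear_mapD[OF g]
  show ?thesis
    using p
  proof induction
    case null_zero
    then show ?case by (simp add: free_map_def tensor_null.null_zero)
  qed (simp_all add: free_map_add free_map_diff free_map_scale fD gD tensor_null.intros)
qed

lemma tensor_map_class:
  assumes f: "linear_map M M' f" and g: "linear_map N N' g" and p: "p \<in> tensor_free M N"
  shows "tensor_map M N M' N' f g (tensor_class M N p) = tensor_class M' N' (free_map (map_prod f g) p)"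
proof -
  have "(\<Union>p'\<in>tensor_class M N p. tensor_class M' N' (free_map (map_prod f g) p')) =
      tensor_class M' N' (free_map (map_prod f g) p)"
    by (rule UN_tensor_class)
      (simp add: tensor_class_eq_iff free_map_tensor_null[OF f g] flip: free_map_diff)
  then show ?thesis using p by (simp add: tensor_map_def tensor_prod_sel)
qed

lemma tensor_map_tens [simp]:
  assumes "linear_map M M' f" "linear_map N N' g" "m \<in> carrier M" "n \<in> carrier N"
  shows "tensor_map M N M' N' f g (tens M N m n) = tens M' N' (f m) (g n)"
  using assms by (simp add: tens_def tensor_map_class tensor_free_def)

lemma tensor_map_linear:
  assumes f: "linear_map M M' f" and g: "linear_map N N' g"
  shows "linear_map (tensor_prod M N) (tensor_prod M' N') (tensor_map M N M' N' f g)"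
  unfolding linear_map_def
proof (intro conjI ballI allI funcsetI)
  note fD = linear_mapD[OF f] and gD = linear_mapD[OF g]
  let ?A = "carrier M \<times> carrier N"
  interpret F: rat_vs "free_space ?A" by (rule rat_vs.intro[OF free_space_vector_space])
  fix x assume "x \<in> carrier (tensor_prod M N)"
  then obtain p where p: "p \<in> tensor_free M N" "x = tensor_class M N p" by (auto simp: tensor_prod_sel)
  have "map_prod f g ` Poly_Mapping.keys p \<subseteq> map_prod f g ` ?A"
    using p by (intro image_mono) (simp add: tensor_free_def)
  also have "\<dots> \<subseteq> carrier M' \<times> carrier N'" using fD(1) gD(1) by auto
  finally have "free_map (map_prod f g) p \<in> tensor_free M' N'"
    using keys_free_map[of "map_prod f g" p] by (simp add: tensor_free_def)
  then show "tensor_map M N M' N' f g x \<in> carrier (tensor_prod M' N')"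
    using p by (simp add: tensor_map_class[OF f g] tensor_prod_sel)
  show "tensor_map M N M' N' f g (c \<odot>\<^bsub>tensor_prod M N\<^esub> x) =
      c \<odot>\<^bsub>tensor_prod M' N'\<^esub> tensor_map M N M' N' f g x" for c
    using p F.scale_in[of p c]
    by (simp add: tensor_map_class[OF f g] tensor_prod_sel free_map_scale tensor_free_def)
  fix y assume "y \<in> carrier (tensor_prod M N)"
  then obtain q where q: "q \<in> tensor_free M N" "y = tensor_class M N q" by (auto simp: tensor_prod_sel)
  show "tensor_map M N M' N' f g (x \<oplus>\<^bsub>tensor_prod M N\<^esub> y) =
      tensor_map M N M' N' f g x \<oplus>\<^bsub>tensor_prod M' N'\<^esub> tensor_map M N M' N' f g y"
    using p q F.add_in[of p q]
    by (simp add: tensor_map_class[OF f g] tensor_prod_sel free_map_add tensor_free_def)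
qed

lemma tensor_map_in_linear_maps:
  assumes f: "linear_map M M' f" and g: "linear_map N N' g"
  shows "tensor_map M N M' N' f g \<in> linear_maps (tensor_prod M N) (tensor_prod M' N')"
  using tensor_map_linear[OF assms] by (simp add: linear_maps_def) (simp add: tensor_map_def)

section \<open>Cardinality of tensor products\<close>

lemma countable_lepoll_infinite:
  assumes "countable A" "infinite U"
  shows "A \<lesssim> U"
proof -
  have "A \<lesssim> (UNIV :: nat set)" using assms(1) by (auto simp: countable_def lepoll_def)
  then show ?thesis using assms(2) lepoll_trans unfolding infinite_le_lepoll by blast
qed

text \<open>A list is determined by its length and by the element of \<open>U\<close> obtained by folding it with an
  injection of \<open>U \<times> U\<close> into \<open>U\<close>.\<close>

lemma lists_lepoll_infinite:
  assumes U: "infinite U"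
  shows "lists U \<lesssim> U"
proof -
  have "U \<times> U \<lesssim> U" by (rule infinite_times_lepoll[OF U]) auto
  then obtain pr where pr: "inj_on pr (U \<times> U)" "pr ` (U \<times> U) \<subseteq> U" by (auto simp: lepoll_def)
  obtain u where u: "u \<in> U" using infinite_imp_nonempty[OF U] by blast
  define enc where "enc xs = foldr (\<lambda>x a. pr (x, a)) xs u" for xs
  have enc_in: "enc xs \<in> U" if "xs \<in> lists U" for xs
    using that by (induction xs) (use u pr(2) in \<open>auto simp: enc_def\<close>)
  have enc_inj: "xs = ys" if "xs \<in> lists U" "ys \<in> lists U" "length xs = length ys" "enc xs = enc ys" for xs ys
    using that(3,1,2,4)
  proof (induction xs ys rule: list_induct2)
    case (Cons x xs y ys)
    have "(x, enc xs) \<in> U \<times> U" "(y, enc ys) \<in> U \<times> U" "pr (x, enc xs) = pr (y, enc ys)"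
      using Cons.prems enc_in by (auto simp: enc_def)
    then have "(x, enc xs) = (y, enc ys)" using inj_onD[OF pr(1)] by blast
    then show ?case using Cons by auto
  qed simp
  have "inj_on (\<lambda>xs. (length xs, enc xs)) (lists U)"
    by (rule inj_onI) (use enc_inj in auto)
  moreover have "(\<lambda>xs. (length xs, enc xs)) ` lists U \<subseteq> UNIV \<times> U" using enc_in by auto
  ultimately have "lists U \<lesssim> (UNIV :: nat set) \<times> U" unfolding lepoll_def by blast
  also have "\<dots> \<lesssim> U" by (rule infinite_times_lepoll[OF U countable_lepoll_infinite[OF _ U]]) auto
  finally show ?thesis .
qed

lemma finite_subsets_lepoll_infinite:
  assumes "infinite U" "A \<lesssim> U"
  shows "{B. finite B \<and> B \<subseteq> A} \<lesssim> U"
proof -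
  have "{B. finite B \<and> B \<subseteq> A} \<subseteq> set ` lists A"
  proof
    fix B assume "B \<in> {B. finite B \<and> B \<subseteq> A}"
    then obtain xs where "set xs = B" "B \<subseteq> A" using finite_list by blast
    then show "B \<in> set ` lists A" by auto
  qed
  then have "{B. finite B \<and> B \<subseteq> A} \<lesssim> lists A" by (rule subset_image_lepoll)
  also have "\<dots> \<lesssim> lists U" by (rule lists_lepoll_mono[OF assms(2)])
  also have "\<dots> \<lesssim> U" by (rule lists_lepoll_infinite[OF assms(1)])
  finally show ?thesis .
qed

lemma inj_graph_poly_mapping:
  "inj (\<lambda>p. (\<lambda>k. (k, Poly_Mapping.lookup p k)) ` Poly_Mapping.keys p)" (is "inj ?g")
proof (rule injI)
  fix p q assume eq: "?g p = ?g q"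
  have g: "(k, c) \<in> ?g r \<longleftrightarrow> Poly_Mapping.lookup r k = c \<and> c \<noteq> 0" for k c r
    by (auto simp: in_keys_iff)
  show "p = q"
  proof (rule poly_mapping_eqI)
    fix k
    show "Poly_Mapping.lookup p k = Poly_Mapping.lookup q k"
      using g[of k "Poly_Mapping.lookup p k" p] g[of k "Poly_Mapping.lookup p k" q]
        g[of k "Poly_Mapping.lookup q k" p] g[of k "Poly_Mapping.lookup q k" q] eq by auto
  qed
qed

lemma poly_mappings_lepoll:
  "{p :: 'b \<Rightarrow>\<^sub>0 'v::zero. Poly_Mapping.keys p \<subseteq> S} \<lesssim> {B. finite B \<and> B \<subseteq> S \<times> (UNIV :: 'v set)}"
  unfolding lepoll_def
  by (rule exI[of _ "\<lambda>p. (\<lambda>k. (k, Poly_Mapping.lookup p k)) ` Poly_Mapping.keys p"])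
    (auto intro: inj_on_subset[OF inj_graph_poly_mapping])

lemma countable_poly_mappings:
  assumes "countable S"
  shows "countable {p :: 'b \<Rightarrow>\<^sub>0 'v::{zero,countable}. Poly_Mapping.keys p \<subseteq> S}"
proof (rule countable_lepoll[OF _ poly_mappings_lepoll])
  have "countable (S \<times> (UNIV :: 'v set))" using assms by auto
  then show "countable {B. finite B \<and> B \<subseteq> S \<times> (UNIV :: 'v set)}"
    by (rule countable_Collect_finite_subset)
qed

text \<open>A tensor is represented by a finitely supported function on pairs, and such a function is
  determined by its finite graph.\<close>

lemma tensor_prod_lepoll:
  assumes U: "infinite U" and M: "countable (carrier M)" and N: "carrier N \<lesssim> U"
  shows "carrier (tensor_prod M N) \<lesssim> U"
proof -
  have rat: "(UNIV :: rat set) \<lesssim> U" by (rule countable_lepoll_infinite[OF _ U]) auto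
  have "carrier (tensor_prod M N) \<lesssim> tensor_free M N"
    unfolding tensor_prod_sel by (rule image_lepoll)
  also have "\<dots> \<lesssim> {B. finite B \<and> B \<subseteq> (carrier M \<times> carrier N) \<times> (UNIV :: rat set)}"
    unfolding tensor_free_def by (rule poly_mappings_lepoll)
  also have "\<dots> \<lesssim> U"
    by (intro finite_subsets_lepoll_infinite[OF U] infinite_times_lepoll[OF U]
        countable_lepoll_infinite[OF M U] N rat)
  finally show ?thesis .
qed

section \<open>Ladder modules tensored with a vector space\<close>

lemma linear_map_identity: "linear_map V V id"
  by (auto simp: linear_map_def)

locale ladder_tensor = ladder W P Q \<epsilon> \<kappa> + V: rat_vs V
  for W :: "(rat, 'w, 'c) module_scheme" (structure) and P Q \<epsilon> \<kappa>
    and V :: "(rat, 'v, 'd) module_scheme"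
begin

abbreviation "T \<equiv> tensor_prod W V"
abbreviation "PT i \<equiv> tensor_map W V W V (P i) id"
abbreviation "QT i \<equiv> tensor_map W V W V (Q i) id"
abbreviation "ten \<equiv> tens W V"

sublocale T: rat_vs T by (rule rat_vs.intro[OF tensor_prod_vector_space])

lemma PT_linear: "linear_map T T (PT i)" and QT_linear: "linear_map T T (QT i)"
  by (intro tensor_map_linear P_linear Q_linear linear_map_identity)+

lemma PT_ten [simp]: "w \<in> carrier W \<Longrightarrow> v \<in> carrier V \<Longrightarrow> PT i (ten w v) = ten (P i w) v"
  and QT_ten [simp]: "w \<in> carrier W \<Longrightarrow> v \<in> carrier V \<Longrightarrow> QT i (ten w v) = ten (Q i w) v"
  by (simp_all add: P_linear Q_linear linear_map_identity)

lemma ten_zero [simp]: "v \<in> carrier V \<Longrightarrow> ten \<zero> v = \<zero>\<^bsub>T\<^esub>"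
  by (rule linear_map_zero[OF tens_linear_left vector_space tensor_prod_vector_space])

sublocale TQ: lowering T QT
  by unfold_locales (rule QT_linear)

lemma QT_finite:
  assumes "x \<in> carrier T"
  shows "\<exists>b. \<forall>m\<ge>b. QT m x = \<zero>\<^bsub>T\<^esub>"
proof -
  have "x \<in> {x \<in> carrier T. \<exists>b. \<forall>m\<ge>b. QT m x = \<zero>\<^bsub>T\<^esub>}"
  proof (rule tensor_induct[OF _ _ assms])
    show "subspace T {x \<in> carrier T. \<exists>b. \<forall>m\<ge>b. QT m x = \<zero>\<^bsub>T\<^esub>}" by (rule TQ.finite_subspace)
    fix w v assume wv: "w \<in> carrier W" "v \<in> carrier V"
    obtain b where "\<forall>m\<ge>b. Q m w = \<zero>" using Q_finite[OF wv(1)] by blast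
    then show "ten w v \<in> {x \<in> carrier T. \<exists>b. \<forall>m\<ge>b. QT m x = \<zero>\<^bsub>T\<^esub>}"
      using wv by (auto intro!: exI[of _ b])
  qed
  then show ?thesis by simp
qed

lemma qnil_ten: "w \<in> carrier W \<Longrightarrow> v \<in> carrier V \<Longrightarrow> qnil W Q n w \<Longrightarrow> qnil T QT n (ten w v)"
  by (induction n arbitrary: w) auto

lemma QT_nilpotent:
  assumes "x \<in> carrier T"
  shows "\<exists>n. qnil T QT n x"
proof -
  have "x \<in> {x \<in> carrier T. \<exists>n. qnil T QT n x}"
  proof (rule tensor_induct[OF _ _ assms])
    show "subspace T {x \<in> carrier T. \<exists>n. qnil T QT n x}" by (rule TQ.nilpotent_subspace)
    fix w v assume wv: "w \<in> carrier W" "v \<in> carrier V"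
    then show "ten w v \<in> {x \<in> carrier T. \<exists>n. qnil T QT n x}"
      using Q_nilpotent[OF wv(1)] qnil_ten by auto
  qed
  then show ?thesis by simp
qed

sublocale TL: ladder T PT QT \<epsilon> \<kappa>
proof
  show "linear_map T T (PT i)" for i by (rule PT_linear)
  fix x i j assume x: "x \<in> carrier T"
  note tv = tensor_prod_vector_space
  show "PT i (PT j x) = \<epsilon> \<odot>\<^bsub>T\<^esub> PT j (PT i x)"
    by (rule tensor_linear_map_eq[OF tv linear_map_comp[OF PT_linear PT_linear]
          linear_map_scale[OF tv linear_map_comp[OF PT_linear PT_linear]] _ x])
      (simp add: PP[of _ i j] tens_scale_left)
  show "QT i (QT j x) = \<epsilon> \<odot>\<^bsub>T\<^esub> QT j (QT i x)"
    by (rule tensor_linear_map_eq[OF tv linear_map_comp[OF QT_linear QT_linear]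
          linear_map_scale[OF tv linear_map_comp[OF QT_linear QT_linear]] _ x])
      (simp add: QQ[of _ i j] tens_scale_left)
  show "QT i (PT j x) = \<epsilon> \<odot>\<^bsub>T\<^esub> PT j (QT i x) \<oplus>\<^bsub>T\<^esub> (if i = j then \<kappa> i else 0) \<odot>\<^bsub>T\<^esub> x"
    by (rule tensor_linear_map_eq[OF tv linear_map_comp[OF PT_linear QT_linear]
          linear_map_add[OF tv linear_map_scale[OF tv linear_map_comp[OF QT_linear PT_linear]]
            linear_map_scale[OF tv linear_map_id]] _ x])
      (simp add: QP tens_scale_left tens_add_left)
  show "\<exists>b. \<forall>m\<ge>b. QT m x = \<zero>\<^bsub>T\<^esub>" by (rule QT_finite[OF x])
  show "\<exists>n. qnil T QT n x" by (rule QT_nilpotent[OF x])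
qed (rule eps kappa)+

text \<open>The projector of \<open>W \<otimes> V\<close> is the identity on vacuum vectors, so it is enough that it maps
  every pure tensor \<open>w \<otimes> v\<close> into \<open>e \<otimes> V\<close>.  Since the vacuum generates \<open>W\<close>, one may assume that \<open>w\<close>
  is a multiple of \<open>e\<close>, or of the form \<open>P\<^sub>i w'\<close>; in the latter case the projector kills the tensor.\<close>

theorem tensor_vac:
  assumes e: "e \<in> vac" and vac: "vac \<subseteq> range (\<lambda>c. c \<odot> e)"
  shows "TL.vac = ten e ` carrier V"
proof
  have e_in: "e \<in> carrier W" using vacD(1)[OF e] .
  have lin: "linear_map V T (ten e)" by (rule tens_linear_right[OF e_in])
  have sub: "subspace T (ten e ` carrier V)"
    by (rule linear_map_image_subspace[OF V.vector_space tensor_prod_vector_space lin])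
  note SD = subspaceD[OF sub]
  show eV: "ten e ` carrier V \<subseteq> TL.vac"
    using e_in vacD(2)[OF e] by (auto simp: TL.vac_def)
  have pure: "TL.proj (ten w v) \<in> ten e ` carrier V" if w: "w \<in> carrier W" and v: "v \<in> carrier V" for w v
  proof -
    have "w \<in> {w \<in> carrier W. TL.proj (ten w v) \<in> ten e ` carrier V}"
    proof (rule vac_generates[OF _ _ _ w])
      show "subspace W {w \<in> carrier W. TL.proj (ten w v) \<in> ten e ` carrier V}"
        unfolding subspace_def
        using v SD(2-4) TL.proj_vac[OF TL.vac_closed(2)]
        by (simp add: tens_add_left tens_scale_left TL.proj_add TL.proj_scale)
      show "vac \<subseteq> {w \<in> carrier W. TL.proj (ten w v) \<in> ten e ` carrier V}"
      proof
        fix w assume "w \<in> vac"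
        then obtain c where "w = c \<odot> e" using vac by blast
        then have "ten w v = ten e (c \<odot>\<^bsub>V\<^esub> v)" using e_in v by (simp add: tens_scale_left tens_scale_right)
        then have "ten w v \<in> ten e ` carrier V" using v by blast
        moreover from this have "TL.proj (ten w v) = ten w v" using eV by (intro TL.proj_vac) blast
        ultimately show "w \<in> {w \<in> carrier W. TL.proj (ten w v) \<in> ten e ` carrier V}"
          using vacD(1)[OF \<open>w \<in> vac\<close>] by simp
      qed
      fix i w assume "w \<in> {w \<in> carrier W. TL.proj (ten w v) \<in> ten e ` carrier V}"
      then have w: "w \<in> carrier W" by simp
      then have "TL.proj (ten (P i w) v) = \<zero>\<^bsub>T\<^esub>" using TL.proj_P[of "ten w v" i] v by simp
      then show "P i w \<in> {w \<in> carrier W. TL.proj (ten w v) \<in> ten e ` carrier V}" using w SD(2) by simp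
    qed
    then show ?thesis by simp
  qed
  show "TL.vac \<subseteq> ten e ` carrier V"
  proof
    fix x assume x: "x \<in> TL.vac"
    have "x \<in> {x \<in> carrier T. TL.proj x \<in> ten e ` carrier V}"
    proof (rule tensor_induct)
      show "subspace T {x \<in> carrier T. TL.proj x \<in> ten e ` carrier V}"
        unfolding subspace_def using SD(2-4) TL.proj_vac[OF TL.vac_closed(2)]
        by (simp add: TL.proj_add TL.proj_scale)
      show "x \<in> carrier T" using TL.vacD(1)[OF x] .
    qed (use pure in simp)
    then show "x \<in> ten e ` carrier V" using TL.proj_vac[OF x] by simp
  qed
qed

text \<open>The map \<open>w \<otimes> v \<mapsto> coef w \<odot> v\<close> is a left inverse of \<open>v \<mapsto> e \<otimes> v\<close>.\<close>

lemma ten_inj: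
  assumes e: "e \<in> carrier W"
    and coef: "\<And>x y. x \<in> carrier W \<Longrightarrow> y \<in> carrier W \<Longrightarrow> coef (x \<oplus> y) = coef x + coef y"
      "\<And>c x. x \<in> carrier W \<Longrightarrow> coef (c \<odot> x) = c * coef x" "coef e = (1 :: rat)"
  shows "inj_on (ten e) (carrier V)"
proof -
  interpret TS: two_spaces W V ..
  have l: "linear_map W V (\<lambda>w. coef w \<odot>\<^bsub>V\<^esub> v)" if "v \<in> carrier V" for v
    using that coef by (auto simp: linear_map_def V.add_scale)
  have r: "linear_map V V (\<lambda>v. coef w \<odot>\<^bsub>V\<^esub> v)" for w
    by (auto simp: linear_map_def mult.commute)
  obtain h where "linear_map T V h"
    and h: "\<forall>w\<in>carrier W. \<forall>v\<in>carrier V. h (ten w v) = coef w \<odot>\<^bsub>V\<^esub> v"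
    using TS.tensor_lift[OF V.vector_space l r] .
  have "h (ten e v) = v" if "v \<in> carrier V" for v using h e coef(3) that by simp
  then show ?thesis by (metis inj_on_inverseI)
qed

end

section \<open>Tensoring with a Fock space as an equivalence\<close>

lemma ladder_hom_cong:
  assumes "ladder W P Q \<epsilon> \<kappa>" "ladder_hom W P Q W' P' Q' f" "\<And>x. x \<in> carrier W \<Longrightarrow> f x = g x"
  shows "ladder_hom W P Q W' P' Q' g"
proof -
  interpret ladder W P Q \<epsilon> \<kappa> by (fact assms(1))
  show ?thesis
    using ladder_homD[OF assms(2)] assms(3) linear_map_cong[OF vector_space ladder_homD(1)[OF assms(2)]]
    by (auto simp: ladder_hom_def)
qed

lemma rat_vector_space_cong:
  assumes "rat_vector_space W"
    and "carrier W = carrier W'" "\<zero>\<^bsub>W\<^esub> = \<zero>\<^bsub>W'\<^esub>" "add W = add W'" "smult W = smult W'"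
  shows "rat_vector_space W'"
  by (rule rat_vector_space_image[OF assms(1), of W' "\<lambda>x. x"]) (simp_all add: assms(2-))

text \<open>\<open>Fk\<close> is a ladder module whose vacuum is spanned by \<open>e\<close>, and \<open>coef\<close> reads off the coefficient of
  \<open>e\<close>.  \<open>D\<close> is a category of ladder modules, with operators \<open>Pd\<close> and \<open>Qd\<close>, and \<open>F\<close> sends \<open>V\<close>
  to \<open>Fk \<otimes> V\<close>.  The objects of \<open>D\<close> may be records with further fields, so \<open>F V\<close> is identified with the
  tensor product only as a vector space with operators.\<close>

locale fock_equivalence = Fk: ladder Fk P Q \<epsilon> \<kappa>
  for Fk :: "(rat, 'f, 'd) module_scheme" and P Q \<epsilon> \<kappa> +
  fixes e :: 'f and coef :: "'f \<Rightarrow> rat" and U :: "'a set"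
    and D :: "((rat, ('f, 'a) tensor, 'c) module_scheme, ('f, 'a) tensor \<Rightarrow> ('f, 'a) tensor) cat"
    and Pd Qd :: "(rat, ('f, 'a) tensor, 'c) module_scheme \<Rightarrow> nat \<Rightarrow> ('f, 'a) tensor \<Rightarrow> ('f, 'a) tensor"
    and F :: "((rat, 'a) module, 'a \<Rightarrow> 'a, (rat, ('f, 'a) tensor, 'c) module_scheme,
      ('f, 'a) tensor \<Rightarrow> ('f, 'a) tensor) cat_functor"
  assumes e_vac: "e \<in> Fk.vac" and vac_e: "Fk.vac \<subseteq> range (\<lambda>c. c \<odot>\<^bsub>Fk\<^esub> e)"
    and coef_add: "\<And>x y. x \<in> carrier Fk \<Longrightarrow> y \<in> carrier Fk \<Longrightarrow> coef (x \<oplus>\<^bsub>Fk\<^esub> y) = coef x + coef y"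
    and coef_scale: "\<And>c x. x \<in> carrier Fk \<Longrightarrow> coef (c \<odot>\<^bsub>Fk\<^esub> x) = c * coef x"
    and coef_e: "coef e = 1"
    and obj_ladder: "\<And>W. W \<in> Obj D \<Longrightarrow> ladder W (Pd W) (Qd W) \<epsilon> \<kappa>"
    and obj_size: "\<And>W. W \<in> Obj D \<Longrightarrow> carrier W \<lesssim> U"
    and hom_iff: "\<And>W W' f. W \<in> Obj D \<Longrightarrow> W' \<in> Obj D \<Longrightarrow>
        f \<in> Hom D W W' \<longleftrightarrow> f \<in> extensional (carrier W) \<and> ladder_hom W (Pd W) (Qd W) W' (Pd W') (Qd W') f"
    and Id_D: "Id D = (\<lambda>W. \<lambda>x\<in>carrier W. x)"
    and Comp_D: "Comp D = (\<lambda>W W' W'' g f. compose (carrier W) g f)"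
    and obj_F: "\<And>V. rat_vector_space V \<Longrightarrow> carrier V \<lesssim> U \<Longrightarrow> obj_map F V \<in> Obj D"
    and same_space: "\<And>V. carrier (obj_map F V) = carrier (tensor_prod Fk V)"
      "\<And>V. \<zero>\<^bsub>obj_map F V\<^esub> = \<zero>\<^bsub>tensor_prod Fk V\<^esub>"
      "\<And>V. add (obj_map F V) = add (tensor_prod Fk V)"
      "\<And>V. smult (obj_map F V) = smult (tensor_prod Fk V)"
    and P_F: "\<And>V i. Pd (obj_map F V) i = tensor_map Fk V Fk V (P i) id"
    and Q_F: "\<And>V i. Qd (obj_map F V) i = tensor_map Fk V Fk V (Q i) id"
    and mor_F: "\<And>V V' f. mor_map F V V' f = tensor_map Fk V Fk V' id f"
begin

lemma e_in: "e \<in> carrier Fk"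
  by (rule Fk.vacD(1)[OF e_vac])

lemma category_D: "category D"
proof (rule concrete_category[OF _ _ _ _ Id_D Comp_D])
  fix W assume W: "W \<in> Obj D"
  interpret ladder W "Pd W" "Qd W" \<epsilon> \<kappa> by (rule obj_ladder[OF W])
  show "rat_vector_space W" by (rule vector_space)
  show "(\<lambda>x\<in>carrier W. x) \<in> Hom D W W"
    unfolding hom_iff[OF W W]
    by (rule conjI[OF restrict_extensional ladder_hom_cong[OF obj_ladder[OF W] ladder_hom_id]]) simp
  fix W' assume W': "W' \<in> Obj D"
  show "Hom D W W' \<subseteq> linear_maps W W'"
    by (auto simp: linear_maps_def hom_iff[OF W W'] dest: ladder_homD(1))
  fix W'' f g assume W'': "W'' \<in> Obj D" and f: "f \<in> Hom D W W'" and g: "g \<in> Hom D W' W''"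
  show "compose (carrier W) g f \<in> Hom D W W''"
    unfolding hom_iff[OF W W'']
  proof
    show "compose (carrier W) g f \<in> extensional (carrier W)" by (simp add: compose_def)
    have "ladder_hom W (Pd W) (Qd W) W' (Pd W') (Qd W') f" "ladder_hom W' (Pd W') (Qd W') W'' (Pd W'') (Qd W'') g"
      using f g hom_iff[OF W W'] hom_iff[OF W' W''] by simp_all
    from ladder_hom_comp[OF this] show "ladder_hom W (Pd W) (Qd W) W'' (Pd W'') (Qd W'') (compose (carrier W) g f)"
      by (rule ladder_hom_cong[OF obj_ladder[OF W]]) (simp add: compose_def)
  qed
qed

lemma mor_ladder_hom:
  assumes V: "rat_vector_space V" and V': "rat_vector_space V'" and f: "linear_map V V' f"
  shows "ladder_hom (tensor_prod Fk V) (\<lambda>i. tensor_map Fk V Fk V (P i) id) (\<lambda>i. tensor_map Fk V Fk V (Q i) id)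
    (tensor_prod Fk V') (\<lambda>i. tensor_map Fk V' Fk V' (P i) id) (\<lambda>i. tensor_map Fk V' Fk V' (Q i) id)
    (tensor_map Fk V Fk V' id f)"
  unfolding ladder_hom_def
proof (intro conjI allI ballI)
  let ?FV = "tensor_map Fk V Fk V' id f"
  have F: "linear_map (tensor_prod Fk V) (tensor_prod Fk V') ?FV"
    by (rule tensor_map_linear[OF linear_map_identity f])
  then show "linear_map (tensor_prod Fk V) (tensor_prod Fk V') ?FV" .
  have op: "?FV (tensor_map Fk V Fk V a id x) = tensor_map Fk V' Fk V' a id (?FV x)"
    if a: "linear_map Fk Fk a" and x: "x \<in> carrier (tensor_prod Fk V)" for a x
    by (rule tensor_linear_map_eq[OF tensor_prod_vector_space
          linear_map_comp[OF tensor_map_linear[OF a linear_map_identity] F]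
          linear_map_comp[OF F tensor_map_linear[OF a linear_map_identity]] _ x])
      (simp add: f a linear_map_identity linear_mapD(1)[OF f] linear_mapD(1)[OF a])
  fix i x assume x: "x \<in> carrier (tensor_prod Fk V)"
  show "?FV (tensor_map Fk V Fk V (P i) id x) = tensor_map Fk V' Fk V' (P i) id (?FV x)"
    by (rule op[OF Fk.P_linear x])
  show "?FV (tensor_map Fk V Fk V (Q i) id x) = tensor_map Fk V' Fk V' (Q i) id (?FV x)"
    by (rule op[OF Fk.Q_linear x])
qed

lemma hom_F_iff:
  assumes "rat_vector_space V" "carrier V \<lesssim> U" "rat_vector_space V'" "carrier V' \<lesssim> U"
  shows "h \<in> Hom D (obj_map F V) (obj_map F V') \<longleftrightarrow> h \<in> extensional (carrier (tensor_prod Fk V)) \<and>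
    ladder_hom (tensor_prod Fk V) (\<lambda>i. tensor_map Fk V Fk V (P i) id) (\<lambda>i. tensor_map Fk V Fk V (Q i) id)
    (tensor_prod Fk V') (\<lambda>i. tensor_map Fk V' Fk V' (P i) id) (\<lambda>i. tensor_map Fk V' Fk V' (Q i) id) h"
  using hom_iff[OF obj_F[OF assms(1,2)] obj_F[OF assms(3,4)]]
  by (simp add: ladder_hom_def linear_map_def same_space P_F Q_F)

lemma functor_F: "is_functor (vect_cat U) D F"
  unfolding is_functor_def
proof (intro conjI ballI)
  fix V :: "(rat, 'a) module" assume "V \<in> Obj (vect_cat U)"
  then have V: "rat_vector_space V" "carrier V \<lesssim> U" by auto
  show "obj_map F V \<in> Obj D" by (rule obj_F[OF V])
  interpret ladder_tensor Fk P Q \<epsilon> \<kappa> V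
    by (rule ladder_tensor.intro[OF Fk.ladder_axioms rat_vs.intro[OF V(1)]])
  have "linear_map V V (\<lambda>x\<in>carrier V. x)"
    by (rule linear_mapsD[OF restrict_in_linear_maps[OF V(1) linear_map_id]])
  then have lin: "tensor_map Fk V Fk V id (\<lambda>x\<in>carrier V. x) \<in> linear_maps T T"
    by (intro tensor_map_in_linear_maps linear_map_identity)
  have "tensor_map Fk V Fk V id (\<lambda>x\<in>carrier V. x) = (\<lambda>x\<in>carrier T. x)"
  proof (rule linear_maps_eqI[OF lin restrict_in_linear_maps[OF T.vector_space linear_map_id]])
    fix x assume x: "x \<in> carrier T"
    have "tensor_map Fk V Fk V id (\<lambda>x\<in>carrier V. x) x = x"
      by (rule tensor_linear_map_eq[OF T.vector_space linear_mapsD[OF lin] linear_map_id _ x])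
        (simp add: \<open>linear_map V V (\<lambda>x\<in>carrier V. x)\<close> linear_map_identity)
    then show "tensor_map Fk V Fk V id (\<lambda>x\<in>carrier V. x) x = (\<lambda>x\<in>carrier T. x) x" using x by simp
  qed
  then show "mor_map F V V (Id (vect_cat U) V) = Id D (obj_map F V)"
    by (simp add: mor_F Id_D same_space)
next
  fix V V' :: "(rat, 'a) module" and f
  assume "V \<in> Obj (vect_cat U)" "V' \<in> Obj (vect_cat U)" "f \<in> Hom (vect_cat U) V V'"
  then have V: "rat_vector_space V" "carrier V \<lesssim> U" and V': "rat_vector_space V'" "carrier V' \<lesssim> U"
    and f: "f \<in> linear_maps V V'" by auto
  show "mor_map F V V' f \<in> Hom D (obj_map F V) (obj_map F V')"
    unfolding hom_F_iff[OF V V'] mor_F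
    using mor_ladder_hom[OF V(1) V'(1) linear_mapsD[OF f]]
      tensor_map_in_linear_maps[OF linear_map_identity linear_mapsD[OF f], of Fk]
    by (simp add: linear_maps_def)
next
  fix V V' V'' :: "(rat, 'a) module" and f g
  assume "V \<in> Obj (vect_cat U)" "V' \<in> Obj (vect_cat U)" "V'' \<in> Obj (vect_cat U)"
    "f \<in> Hom (vect_cat U) V V'" "g \<in> Hom (vect_cat U) V' V''"
  then have V: "rat_vector_space V" and f: "f \<in> linear_maps V V'" and g: "g \<in> linear_maps V' V''" by auto
  note fl = linear_mapsD[OF f] and gl = linear_mapsD[OF g]
  have gf: "compose (carrier V) g f \<in> linear_maps V V''" by (rule linear_maps_compose[OF V f g])
  note gfl = linear_mapsD[OF gf]
  let ?T = "tensor_prod Fk V" and ?F = "tensor_map Fk V Fk V' id f" and ?G = "tensor_map Fk V' Fk V'' id g"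
  have FG: "?F \<in> linear_maps ?T (tensor_prod Fk V')" "?G \<in> linear_maps (tensor_prod Fk V') (tensor_prod Fk V'')"
    "tensor_map Fk V Fk V'' id (compose (carrier V) g f) \<in> linear_maps ?T (tensor_prod Fk V'')"
    by (intro tensor_map_in_linear_maps linear_map_identity fl gl gfl)+
  have "tensor_map Fk V Fk V'' id (compose (carrier V) g f) = compose (carrier ?T) ?G ?F"
  proof (rule linear_maps_eqI[OF FG(3) linear_maps_compose[OF tensor_prod_vector_space FG(1,2)]])
    fix x assume x: "x \<in> carrier ?T"
    have "tensor_map Fk V Fk V'' id (compose (carrier V) g f) x = ?G (?F x)"
    proof (rule tensor_linear_map_eq[OF tensor_prod_vector_space linear_mapsD[OF FG(3)]
          linear_map_comp[OF linear_mapsD[OF FG(1)] linear_mapsD[OF FG(2)]] _ x])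
      fix m n assume "m \<in> carrier Fk" "n \<in> carrier V"
      then show "tensor_map Fk V Fk V'' id (compose (carrier V) g f) (tens Fk V m n) = ?G (?F (tens Fk V m n))"
        using linear_mapD(1)[OF fl] by (simp add: fl gl gfl linear_map_identity) (simp add: compose_def)
    qed
    then show "tensor_map Fk V Fk V'' id (compose (carrier V) g f) x = compose (carrier ?T) ?G ?F x"
      using x by (simp add: compose_def)
  qed
  then show "mor_map F V V'' (Comp (vect_cat U) V V' V'' g f) =
      Comp D (obj_map F V) (obj_map F V') (obj_map F V'') (mor_map F V' V'' g) (mor_map F V V' f)"
    by (simp add: mor_F Comp_D same_space)
qed

text \<open>A homomorphism \<open>h\<close> maps the vacuum \<open>e \<otimes> V\<close> to the vacuum \<open>e \<otimes> V'\<close>, so that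
  \<open>h (e \<otimes> v) = e \<otimes> f v\<close> for a unique map \<open>f\<close>.  This \<open>f\<close> is linear, and \<open>h\<close> and \<open>F f\<close> agree because they
  agree on the vacuum.\<close>

lemma fully_faithful_F: "fully_faithful (vect_cat U) D F"
  unfolding fully_faithful_def
proof (intro ballI)
  fix V V' :: "(rat, 'a) module"
  assume "V \<in> Obj (vect_cat U)" "V' \<in> Obj (vect_cat U)"
  then have V: "rat_vector_space V" "carrier V \<lesssim> U" and V': "rat_vector_space V'" "carrier V' \<lesssim> U"
    by auto
  interpret A: ladder_tensor Fk P Q \<epsilon> \<kappa> V
    by (rule ladder_tensor.intro[OF Fk.ladder_axioms rat_vs.intro[OF V(1)]])
  interpret B: ladder_tensor Fk P Q \<epsilon> \<kappa> V'
    by (rule ladder_tensor.intro[OF Fk.ladder_axioms rat_vs.intro[OF V'(1)]])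
  interpret AB: ladder_pair A.T A.PT A.QT B.T B.PT B.QT \<epsilon> \<kappa> ..
  have inj: "inj_on (B.ten e) (carrier V')"
    by (rule B.ten_inj[OF e_in, of coef]) (simp_all add: coef_add coef_scale coef_e)
  have vacA: "A.TL.vac = A.ten e ` carrier V" by (rule A.tensor_vac[OF e_vac vac_e])
  have vacB: "B.TL.vac = B.ten e ` carrier V'" by (rule B.tensor_vac[OF e_vac vac_e])
  have F_in: "mor_map F V V' f \<in> Hom D (obj_map F V) (obj_map F V')" if "f \<in> linear_maps V V'" for f
    using functor_F V V' that unfolding is_functor_def by auto
  show "bij_betw (mor_map F V V') (Hom (vect_cat U) V V') (Hom D (obj_map F V) (obj_map F V'))"
    unfolding bij_betw_def vect_cat_sel
  proof (intro conjI subset_antisym subsetI)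
    show "inj_on (mor_map F V V') (linear_maps V V')"
    proof (rule inj_onI)
      fix f g assume f: "f \<in> linear_maps V V'" and g: "g \<in> linear_maps V V'"
        and eq: "mor_map F V V' f = mor_map F V V' g"
      show "f = g"
      proof (rule linear_maps_eqI[OF f g])
        fix v assume v: "v \<in> carrier V"
        have "mor_map F V V' f (A.ten e v) = mor_map F V V' g (A.ten e v)" using eq by simp
        then have "B.ten e (f v) = B.ten e (g v)"
          using v e_in by (simp add: mor_F linear_mapsD[OF f] linear_mapsD[OF g] linear_map_identity)
        then show "f v = g v"
          using inj_onD[OF inj] linear_mapD(1)[OF linear_mapsD[OF f] v] linear_mapD(1)[OF linear_mapsD[OF g] v]
          by blast
      qed
    qed
    fix h
    show "h \<in> Hom D (obj_map F V) (obj_map F V')" if "h \<in> mor_map F V V' ` linear_maps V V'"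
      using that F_in by blast
    assume "h \<in> Hom D (obj_map F V) (obj_map F V')"
    then have h_ext: "h \<in> extensional (carrier A.T)" and h: "ladder_hom A.T A.PT A.QT B.T B.PT B.QT h"
      using hom_F_iff[OF V V'] by auto
    note hD = linear_mapD[OF ladder_homD(1)[OF h]]
    define f where "f v = the_inv_into (carrier V') (B.ten e) (h (A.ten e v))" for v
    have hv: "h (A.ten e v) \<in> B.ten e ` carrier V'" if "v \<in> carrier V" for v
    proof -
      have "A.ten e v \<in> A.TL.vac" using that vacA by blast
      then show ?thesis using AB.hom_vac[OF h] vacB by simp
    qed
    have f_in: "f v \<in> carrier V'" and ef: "B.ten e (f v) = h (A.ten e v)" if "v \<in> carrier V" for v
      unfolding f_def using the_inv_into_into[OF inj hv[OF that]] f_the_inv_into_f[OF inj hv[OF that]] by auto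
    note eA = linear_mapD[OF tens_linear_right[OF e_in], of _ V]
      and eB = linear_mapD[OF tens_linear_right[OF e_in], of _ V']
    have f_eqI: "f v = w" if "v \<in> carrier V" "w \<in> carrier V'" "B.ten e w = h (A.ten e v)" for v w
      using inj_onD[OF inj _ f_in[OF that(1)] that(2)] ef[OF that(1)] that(3) by simp
    have fl: "linear_map V V' f"
      unfolding linear_map_def
    proof (intro conjI ballI allI funcsetI)
      fix v assume v: "v \<in> carrier V"
      show "f v \<in> carrier V'" by (rule f_in[OF v])
      show "f (c \<odot>\<^bsub>V\<^esub> v) = c \<odot>\<^bsub>V'\<^esub> f v" for c
        by (rule f_eqI) (use v e_in f_in ef eA eB hD in simp_all)
      fix w assume w: "w \<in> carrier V"
      show "f (v \<oplus>\<^bsub>V\<^esub> w) = f v \<oplus>\<^bsub>V'\<^esub> f w"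
        by (rule f_eqI) (use v w e_in f_in ef eA eB hD in simp_all)
    qed
    let ?f = "restrict f (carrier V)"
    have f': "?f \<in> linear_maps V V'" by (rule restrict_in_linear_maps[OF V(1) fl])
    have m: "ladder_hom A.T A.PT A.QT B.T B.PT B.QT (mor_map F V V' ?f)"
      unfolding mor_F by (rule mor_ladder_hom[OF V(1) V'(1) linear_mapsD[OF f']])
    have m_ext: "mor_map F V V' ?f \<in> extensional (carrier A.T)"
      using F_in[OF f'] hom_F_iff[OF V V'] by blast
    have "mor_map F V V' ?f = h"
    proof (rule extensionalityI[OF m_ext h_ext])
      fix x assume x: "x \<in> carrier A.T"
      show "mor_map F V V' ?f x = h x"
      proof (rule AB.hom_unique[OF m h _ x])
        fix y assume "y \<in> A.TL.vac"
        then obtain v where v: "v \<in> carrier V" "y = A.ten e v" using vacA by blast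
        then show "mor_map F V V' ?f y = h y"
          using ef e_in by (simp add: mor_F linear_mapsD[OF f'] linear_map_identity)
      qed
    qed
    then show "h \<in> mor_map F V V' ` linear_maps V V'" using f' by blast
  qed
qed

text \<open>A module \<open>W\<close> is isomorphic to \<open>F V\<close> for \<open>V\<close> a copy of the vacuum of \<open>W\<close>, since both have isomorphic
  vacua.\<close>

lemma essentially_surjective_F: "essentially_surjective (vect_cat U) D F"
  unfolding essentially_surjective_def
proof
  fix W assume W: "W \<in> Obj D"
  interpret W: ladder W "Pd W" "Qd W" \<epsilon> \<kappa> by (rule obj_ladder[OF W])
  let ?M = "W\<lparr>carrier := W.vac\<rparr>"
  have "carrier ?M \<lesssim> U" using lepoll_subset[OF W.vac_closed(1) obj_size[OF W]] by simp
  then obtain V :: "(rat, 'a) module" and s t where V: "rat_vector_space V" "carrier V \<lesssim> U"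
    and s: "linear_map ?M V s" and t: "linear_map V ?M t"
    and ts: "\<forall>x\<in>carrier ?M. t (s x) = x" and st: "\<forall>y\<in>carrier V. s (t y) = y"
    using vector_space_copy[OF W.vac_space] by metis
  interpret A: ladder_tensor Fk P Q \<epsilon> \<kappa> V
    by (rule ladder_tensor.intro[OF Fk.ladder_axioms rat_vs.intro[OF V(1)]])
  have inj: "inj_on (A.ten e) (carrier V)"
    by (rule A.ten_inj[OF e_in, of coef]) (simp_all add: coef_add coef_scale coef_e)
  have vacA: "A.TL.vac = A.ten e ` carrier V" by (rule A.tensor_vac[OF e_vac vac_e])
  let ?N = "A.T\<lparr>carrier := A.TL.vac\<rparr>"
  have eN: "linear_map V ?N (A.ten e)"
    using tens_linear_right[OF e_in, of V] vacA by (auto simp: linear_map_def)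
  have bij: "bij_betw (A.ten e) (carrier V) (carrier ?N)" using inj vacA by (simp add: bij_betw_def)
  let ?inv = "inv_into (carrier V) (A.ten e)"
  have inv: "linear_map ?N V ?inv" by (rule linear_map_inverse[OF V(1) eN bij])
  have i: "linear_map ?N ?M (\<lambda>x. t (?inv x))" by (rule linear_map_comp[OF inv t])
  have j: "linear_map ?M ?N (\<lambda>x. A.ten e (s x))" by (rule linear_map_comp[OF s eN])
  have ji: "A.ten e (s (t (?inv x))) = x" if "x \<in> A.TL.vac" for x
    using that vacA st inj by auto
  have ij: "t (?inv (A.ten e (s y))) = y" if "y \<in> W.vac" for y
    using that linear_mapD(1)[OF s] ts inj by simp
  obtain f g where f: "ladder_hom A.T A.PT A.QT W (Pd W) (Qd W) f"
    and g: "ladder_hom W (Pd W) (Qd W) A.T A.PT A.QT g"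
    and gf: "\<forall>x\<in>carrier A.T. g (f x) = x" and fg: "\<forall>y\<in>carrier W. f (g y) = y"
    using ladder_iso_of_vac_iso[OF A.TL.ladder_axioms W.ladder_axioms i j ji ij] .
  have FV: "obj_map F V \<in> Obj D" by (rule obj_F[OF V])
  let ?f = "restrict f (carrier A.T)" and ?g = "restrict g (carrier W)"
  have f_in: "f x \<in> carrier W" if "x \<in> carrier A.T" for x
    by (rule linear_mapD(1)[OF ladder_homD(1)[OF f] that])
  have g_in: "g x \<in> carrier A.T" if "x \<in> carrier W" for x
    by (rule linear_mapD(1)[OF ladder_homD(1)[OF g] that])
  have "ladder_hom A.T A.PT A.QT W (Pd W) (Qd W) ?f"
    by (rule ladder_hom_cong[OF A.TL.ladder_axioms f]) simp
  then have fD: "?f \<in> Hom D (obj_map F V) W"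
    unfolding hom_iff[OF FV W] by (simp add: ladder_hom_def linear_map_def same_space P_F Q_F)
  have "ladder_hom W (Pd W) (Qd W) A.T A.PT A.QT ?g"
    by (rule ladder_hom_cong[OF W.ladder_axioms g]) simp
  then have gD: "?g \<in> Hom D W (obj_map F V)"
    unfolding hom_iff[OF W FV] by (simp add: ladder_hom_def linear_map_def same_space P_F Q_F)
  have "iso_mor D (obj_map F V) W ?f"
    unfolding iso_mor_def Comp_D Id_D
  proof (intro conjI bexI[of _ ?g] fD gD)
    show "compose (carrier (obj_map F V)) ?g ?f = (\<lambda>x\<in>carrier (obj_map F V). x)"
      unfolding compose_def same_space by (rule restrict_ext) (use gf f_in in simp)
    show "compose (carrier W) ?f ?g = (\<lambda>x\<in>carrier W. x)"
      unfolding compose_def by (rule restrict_ext) (use fg g_in in simp)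
  qed
  then show "\<exists>V\<in>Obj (vect_cat U). \<exists>f. iso_mor D (obj_map F V) W f" using V by auto
qed

theorem weak_equivalence_F: "weak_equivalence (vect_cat U) D F"
  unfolding weak_equivalence_def
  by (intro conjI category_vect_cat category_D functor_F fully_faithful_F essentially_surjective_F)

end

section \<open>Direct sum decompositions\<close>

lemma finsum_superset:
  assumes V: "rat_vector_space V" and "finite B" "A \<subseteq> B" "\<And>i. i \<in> B - A \<Longrightarrow> f i = \<zero>\<^bsub>V\<^esub>"
    "\<And>i. i \<in> B \<Longrightarrow> f i \<in> carrier V"
  shows "finsum V f B = finsum V f A"
proof -
  interpret Module.module rat_field V by (fact V)
  show ?thesis
    by (rule add.finprod_mono_neutral_cong_right[unfolded finsum_def[symmetric], simplified])
      (use assms in auto)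
qed

lemma subspace_finsum:
  assumes V: "rat_vector_space V" and S: "subspace V S" and "finite A" "\<And>a. a \<in> A \<Longrightarrow> f a \<in> S"
  shows "finsum V f A \<in> S"
proof -
  interpret Module.module rat_field V by (fact V)
  note SD = subspaceD[OF S]
  show ?thesis
    using assms(3,4)
  proof (induction A rule: finite_induct)
    case (insert a A)
    then have "f a \<in> carrier V" "f \<in> A \<rightarrow> carrier V" using SD(1) by auto
    then show ?case using insert SD(3) by simp
  qed (simp add: SD)
qed

lemma linear_map_finsum:
  assumes V: "rat_vector_space V" and W: "rat_vector_space W" and h: "linear_map V W h"
    and "finite A" "\<And>a. a \<in> A \<Longrightarrow> f a \<in> carrier V"
  shows "h (finsum V f A) = finsum W (\<lambda>a. h (f a)) A"
proof -
  interpret V: Module.module rat_field V by (fact V)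
  interpret W: Module.module rat_field W by (fact W)
  note hD = linear_mapD[OF h]
  show ?thesis
    using assms(4,5)
  proof (induction A rule: finite_induct)
    case empty
    then show ?case using linear_map_zero[OF h V W] by simp
  next
    case (insert a A)
    have "f a \<in> carrier V" "f \<in> A \<rightarrow> carrier V" "(\<lambda>a. h (f a)) \<in> A \<rightarrow> carrier W"
      using insert.prems hD(1) by auto
    then show ?case using insert hD by simp
  qed
qed

lemma submodule_iff_subspace:
  assumes V: "rat_vector_space V"
  shows "submodule S rat_field V \<longleftrightarrow> subspace V S"
proof
  interpret Module.module rat_field V by (fact V)
  interpret rat_vs V by (rule rat_vs.intro[OF V])
  show "submodule S rat_field V" if S: "subspace V S"
  proof (rule submoduleI)
    note SD = subspaceD[OF S]
    fix a assume a: "a \<in> S"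
    then have "(-1) \<odot>\<^bsub>V\<^esub> a = \<ominus>\<^bsub>V\<^esub> a"
      using minus_equality[of "(-1) \<odot>\<^bsub>V\<^esub> a" a] SD(1) by (auto simp: add_collect1)
    then show "\<ominus>\<^bsub>V\<^esub> a \<in> S" using SD(4)[OF a, of "-1"] by simp
  qed (use subspaceD[OF S] in auto)
  assume "submodule S rat_field V"
  note SE = submoduleE[OF this]
  obtain s where "s \<in> S" using SE(2) by blast
  then have "\<zero>\<^bsub>V\<^esub> \<in> S" using SE(4)[of 0 s] SE(1) by auto
  then show "subspace V S" using SE by (auto simp: subspace_def)
qed

text \<open>The components are read off by projections \<open>D n\<close>.  The vectors that are the sum of finitely many
  components \<open>D n x\<close> in \<open>gr n\<close> form a subspace containing every \<open>gr n\<close>, hence are all vectors;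
  applying \<open>D m\<close> to a decomposition shows that it is unique.\<close>

lemma direct_sum_decompositionI:
  assumes T: "rat_vector_space T" and gr: "\<And>n. subspace T (gr n)" and D: "\<And>n. linear_map T T (D n)"
    and same: "\<And>n x. x \<in> gr n \<Longrightarrow> D n x = x" and other: "\<And>n k x. x \<in> gr k \<Longrightarrow> n \<noteq> k \<Longrightarrow> D n x = \<zero>\<^bsub>T\<^esub>"
    and span: "\<And>M. subspace T M \<Longrightarrow> (\<And>n. gr n \<subseteq> M) \<Longrightarrow> carrier T \<subseteq> M"
  shows "direct_sum_decomposition T gr"
proof -
  interpret T: rat_vs T by (rule rat_vs.intro[OF T])
  interpret M: Module.module rat_field T by (fact T)
  note DD = linear_mapD[OF D] and grD = subspaceD[OF gr]
  have gr_in: "x \<in> carrier T" if "x \<in> gr n" for x n using grD(1) that by blast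
  have D_zero: "D n \<zero>\<^bsub>T\<^esub> = \<zero>\<^bsub>T\<^esub>" for n by (rule linear_map_zero[OF D T T])
  define ok where "ok x A \<longleftrightarrow> finite A \<and> (\<forall>n. n \<notin> A \<longrightarrow> D n x = \<zero>\<^bsub>T\<^esub>) \<and>
     finsum T (\<lambda>n. D n x) A = x" for x A
  define M where "M = {x \<in> carrier T. (\<forall>n. D n x \<in> gr n) \<and> (\<exists>A. ok x A)}"
  have M_I: "x \<in> M" if "x \<in> carrier T" "\<And>n. D n x \<in> gr n" "ok x A" for x A
    using that by (auto simp: M_def)
  have enlarge: "ok x B" if "x \<in> carrier T" "ok x A" "finite B" "A \<subseteq> B" for x A B
    using that finsum_superset[OF T that(3,4), of "\<lambda>n. D n x"] DD(1) by (auto simp: ok_def)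
  have "subspace T M"
    unfolding subspace_def
  proof (intro conjI ballI allI)
    show "M \<subseteq> carrier T" by (auto simp: M_def)
    show "\<zero>\<^bsub>T\<^esub> \<in> M" by (rule M_I[of _ "{}"]) (use D_zero grD(2) in \<open>auto simp: ok_def\<close>)
    fix x assume "x \<in> M"
    then obtain A where x: "x \<in> carrier T" "\<And>n. D n x \<in> gr n" and A: "ok x A"
      by (auto simp: M_def)
    show "c \<odot>\<^bsub>T\<^esub> x \<in> M" for c
    proof (rule M_I)
      have "finsum T (\<lambda>n. D n (c \<odot>\<^bsub>T\<^esub> x)) A = finsum T (\<lambda>n. c \<odot>\<^bsub>T\<^esub> D n x) A"
        by (simp add: DD(3)[OF x(1)])
      also have "\<dots> = c \<odot>\<^bsub>T\<^esub> finsum T (\<lambda>n. D n x) A"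
        using A x DD(1) by (intro M.finsum_smult_ldistr[symmetric]) (auto simp: ok_def)
      also have "\<dots> = c \<odot>\<^bsub>T\<^esub> x" using A by (simp add: ok_def)
      finally show "ok (c \<odot>\<^bsub>T\<^esub> x) A" using A by (simp add: ok_def DD(3)[OF x(1)])
    qed (use x DD(3) grD(4) in auto)
    fix y assume "y \<in> M"
    then obtain B where y: "y \<in> carrier T" "\<And>n. D n y \<in> gr n" and B: "ok y B"
      by (auto simp: M_def)
    have fAB: "finite (A \<union> B)" using A B by (simp add: ok_def)
    have AB: "ok x (A \<union> B)" "ok y (A \<union> B)"
      using enlarge[OF x(1) A fAB] enlarge[OF y(1) B fAB] by auto
    show "x \<oplus>\<^bsub>T\<^esub> y \<in> M"
    proof (rule M_I)
      have "finsum T (\<lambda>n. D n (x \<oplus>\<^bsub>T\<^esub> y)) (A \<union> B) = finsum T (\<lambda>n. D n x \<oplus>\<^bsub>T\<^esub> D n y) (A \<union> B)"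
        by (simp add: DD(2)[OF x(1) y(1)])
      also have "\<dots> = finsum T (\<lambda>n. D n x) (A \<union> B) \<oplus>\<^bsub>T\<^esub> finsum T (\<lambda>n. D n y) (A \<union> B)"
        using x y DD(1) by (intro M.finsum_addf) auto
      also have "\<dots> = x \<oplus>\<^bsub>T\<^esub> y" using AB by (simp add: ok_def)
      finally show "ok (x \<oplus>\<^bsub>T\<^esub> y) (A \<union> B)" using AB by (simp add: ok_def DD(2)[OF x(1) y(1)])
    qed (use x y DD(2) grD(3) in auto)
  qed
  moreover have "gr n \<subseteq> M" for n
  proof
    fix x assume x: "x \<in> gr n"
    have Dx: "D k x = (if k = n then x else \<zero>\<^bsub>T\<^esub>)" for k using same other x by auto
    have "finsum T (\<lambda>k. D k x) {n} = x" using gr_in[OF x] by (simp add: Dx)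
    then have "ok x {n}" by (simp add: Dx ok_def)
    then show "x \<in> M" by (rule M_I[OF gr_in[OF x], rotated]) (use x grD(2) Dx in auto)
  qed
  ultimately have all_ok: "carrier T \<subseteq> M" by (rule span)
  show ?thesis
    unfolding direct_sum_decomposition_def
  proof (intro conjI allI ballI)
    show "submodule (gr n) rat_field T" for n using gr submodule_iff_subspace[OF T] by blast
    fix x assume x: "x \<in> carrier T"
    then have "x \<in> M" using all_ok by blast
    then obtain A where A: "ok x A" and Dgr: "\<forall>n. D n x \<in> gr n" unfolding M_def by blast
    show "\<exists>!c. (\<forall>n. c n \<in> gr n) \<and> finite {n. c n \<noteq> \<zero>\<^bsub>T\<^esub>} \<and> x = finsum T c {n. c n \<noteq> \<zero>\<^bsub>T\<^esub>}"
    proof (rule ex1I[of _ "\<lambda>n. D n x"])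
      have sub: "{n. D n x \<noteq> \<zero>\<^bsub>T\<^esub>} \<subseteq> A" and fin: "finite A" using A by (auto simp: ok_def)
      have "finsum T (\<lambda>n. D n x) A = finsum T (\<lambda>n. D n x) {n. D n x \<noteq> \<zero>\<^bsub>T\<^esub>}"
        by (rule finsum_superset[OF T fin sub]) (use DD(1)[OF x] in auto)
      then show "(\<forall>n. D n x \<in> gr n) \<and> finite {n. D n x \<noteq> \<zero>\<^bsub>T\<^esub>} \<and>
          x = finsum T (\<lambda>n. D n x) {n. D n x \<noteq> \<zero>\<^bsub>T\<^esub>}"
        using A Dgr finite_subset[OF sub fin] by (simp add: ok_def)
      fix c assume c: "(\<forall>n. c n \<in> gr n) \<and> finite {n. c n \<noteq> \<zero>\<^bsub>T\<^esub>} \<and> x = finsum T c {n. c n \<noteq> \<zero>\<^bsub>T\<^esub>}"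
      let ?C = "{n. c n \<noteq> \<zero>\<^bsub>T\<^esub>}"
      have cgr: "c n \<in> gr n" and cin: "c n \<in> carrier T" for n using c gr_in by auto
      have finC: "finite ?C" and xC: "x = finsum T c ?C" using c by auto
      show "c = (\<lambda>n. D n x)"
      proof
        fix m
        have "D m x = finsum T (\<lambda>n. D m (c n)) ?C"
          unfolding xC by (rule linear_map_finsum[OF T T D finC cin])
        also have "\<dots> = finsum T (\<lambda>n. D m (c n)) (insert m ?C)"
          by (rule finsum_superset[OF T, symmetric]) (use finC D_zero DD(1) cin in auto)
        also have "\<dots> = finsum T (\<lambda>n. D m (c n)) {m}"
          by (rule finsum_superset[OF T]) (use finC other[OF cgr] DD(1) cin in auto)
        also have "\<dots> = c m" using same[OF cgr] cin by simp
        finally show "c m = D m x" by simp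
      qed
    qed
  qed
qed

section \<open>Admissible Clifford modules\<close>

abbreviation cl_P :: "'w clifford_module \<Rightarrow> nat \<Rightarrow> 'w \<Rightarrow> 'w" where
  "cl_P W \<equiv> (\<lambda>i. cliff_P W (Suc i))"

abbreviation cl_Q :: "'w clifford_module \<Rightarrow> nat \<Rightarrow> 'w \<Rightarrow> 'w" where
  "cl_Q W \<equiv> (\<lambda>i. cliff_Q W (Suc i))"

lemma (in rat_vs) eq_neg_of_add_zero:
  assumes "x \<in> carrier V" "y \<in> carrier V" "x \<oplus> y = z" "z \<in> carrier V"
  shows "y = (-1) \<odot> x \<oplus> z"
  using assms(1,2) by (simp add: assms(3)[symmetric] add_collect1 flip: add_ac(1))

lemma graded_clifford_subspace:
  assumes "graded_clifford_module W"
  shows "subspace W (cliff_grade W n)"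
  using assms submodule_iff_subspace[of W]
  by (simp add: graded_clifford_module_def direct_sum_decomposition_def)

lemma graded_clifford_P:
  assumes "graded_clifford_module W" "x \<in> cliff_grade W n"
  shows "cl_P W i x \<in> cliff_grade W (Suc n)"
proof -
  have "\<forall>i>0. \<forall>n. cliff_P W i ` cliff_grade W n \<subseteq> cliff_grade W (Suc n)"
    using assms(1) by (simp add: graded_clifford_module_def)
  then have "cl_P W i ` cliff_grade W n \<subseteq> cliff_grade W (Suc n)" by simp
  then show ?thesis using assms(2) by blast
qed

lemma graded_clifford_Q:
  assumes "graded_clifford_module W" "x \<in> cliff_grade W (Suc n)"
  shows "cl_Q W i x \<in> cliff_grade W n"
proof -
  have "\<forall>i>0. \<forall>n. cliff_Q W i ` cliff_grade W (Suc n) \<subseteq> cliff_grade W n"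
    using assms(1) by (simp add: graded_clifford_module_def)
  then have "cl_Q W i ` cliff_grade W (Suc n) \<subseteq> cliff_grade W n" by simp
  then show ?thesis using assms(2) by blast
qed

text \<open>Annihilation operators lower the degree and kill degree 0, so words of length \<open>n + 1\<close> kill degree
  \<open>n\<close>.\<close>

lemma admissible_clifford_ladder:
  assumes W: "admissible_clifford_module W"
  shows "ladder W (cl_P W) (cl_Q W) (-1) (\<lambda>_. 1)"
proof -
  have g: "graded_clifford_module W" and fin: "\<forall>x\<in>carrier W. \<exists>N. \<forall>m>N. cliff_Q W m x = \<zero>\<^bsub>W\<^esub>"
    using W by (simp_all add: admissible_clifford_module_def)
  have vs: "rat_vector_space W" and rel: "clifford_relations W"
    and ds: "direct_sum_decomposition W (cliff_grade W)"
    and Q0: "\<forall>i>0. cliff_Q W i ` cliff_grade W 0 \<subseteq> {\<zero>\<^bsub>W\<^esub>}"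
    and QS: "\<forall>i>0. \<forall>n. cliff_Q W i ` cliff_grade W (Suc n) \<subseteq> cliff_grade W n"
    using g by (simp_all add: graded_clifford_module_def)
  interpret rat_vs W by (rule rat_vs.intro[OF vs])
  have lin: "linear_map W W (cl_P W i)" "linear_map W W (cl_Q W i)" for i
    using rel by (simp_all add: clifford_relations_def)
  note inP = linear_mapD(1)[OF lin(1)] and inQ = linear_mapD(1)[OF lin(2)]
  have anti: "cl_P W i (cl_P W j x) \<oplus>\<^bsub>W\<^esub> cl_P W j (cl_P W i x) = \<zero>\<^bsub>W\<^esub>"
    "cl_Q W i (cl_Q W j x) \<oplus>\<^bsub>W\<^esub> cl_Q W j (cl_Q W i x) = \<zero>\<^bsub>W\<^esub>"
    "cl_P W i (cl_Q W j x) \<oplus>\<^bsub>W\<^esub> cl_Q W j (cl_P W i x) = (if i = j then x else \<zero>\<^bsub>W\<^esub>)"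
    if "x \<in> carrier W" for i j x
    using rel that by (simp_all add: clifford_relations_def)
  interpret L: lowering W "cl_Q W" by unfold_locales (rule lin(2))
  have gr_nil: "x \<in> carrier W \<and> qnil W (cl_Q W) (Suc n) x" if "x \<in> cliff_grade W n" for n x
    using that
  proof (induction n arbitrary: x)
    case 0
    then have "cl_Q W i x = \<zero>\<^bsub>W\<^esub>" for i using Q0 by blast
    then show ?case using subspaceD(1)[OF graded_clifford_subspace[OF g]] 0 by auto
  next
    case (Suc n)
    then have "cl_Q W i x \<in> cliff_grade W n" for i using QS by blast
    then have "qnil W (cl_Q W) (Suc n) (cl_Q W i x)" for i using Suc.IH by blast
    then show ?case using subspaceD(1)[OF graded_clifford_subspace[OF g]] Suc.prems
      by (subst qnil.simps(2)) blast
  qed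
  show ?thesis
  proof (intro ladder.intro ladder_axioms.intro)
    show "lowering W (cl_Q W)" by (rule L.lowering_axioms)
    fix x assume x: "x \<in> carrier W"
    show "cl_P W i (cl_P W j x) = (-1) \<odot>\<^bsub>W\<^esub> cl_P W j (cl_P W i x)" for i j
      using eq_neg_of_add_zero[OF _ _ anti(1)[OF x, of j i]] inP x by simp
    show "cl_Q W i (cl_Q W j x) = (-1) \<odot>\<^bsub>W\<^esub> cl_Q W j (cl_Q W i x)" for i j
      using eq_neg_of_add_zero[OF _ _ anti(2)[OF x, of j i]] inQ x by simp
    show "cl_Q W i (cl_P W j x) = (-1) \<odot>\<^bsub>W\<^esub> cl_P W j (cl_Q W i x) \<oplus>\<^bsub>W\<^esub> (if i = j then 1 else 0) \<odot>\<^bsub>W\<^esub> x" for i j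
      using eq_neg_of_add_zero[OF _ _ anti(3)[OF x, of j i]] inP inQ x by auto
    obtain N where N: "\<forall>m>N. cliff_Q W m x = \<zero>\<^bsub>W\<^esub>" using fin x by blast
    then show "\<exists>b. \<forall>m\<ge>b. cl_Q W m x = \<zero>\<^bsub>W\<^esub>" by (intro exI[of _ N]) auto
    obtain c where c: "\<forall>n. c n \<in> cliff_grade W n" "finite {n. c n \<noteq> \<zero>\<^bsub>W\<^esub>}"
      "x = finsum W c {n. c n \<noteq> \<zero>\<^bsub>W\<^esub>}"
      using ds x unfolding direct_sum_decomposition_def by blast
    have "x \<in> {x \<in> carrier W. \<exists>n. qnil W (cl_Q W) n x}"
      unfolding c(3) by (rule subspace_finsum[OF vs L.nilpotent_subspace c(2)]) (use gr_nil c(1) in blast)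
    then show "\<exists>n. qnil W (cl_Q W) n x" by simp
  qed (rule lin | simp)+
qed

text \<open>Such a vector would have two decompositions, one concentrated in degree \<open>a\<close> and one in degree \<open>b\<close>.\<close>

lemma graded_clifford_disjoint:
  assumes g: "graded_clifford_module W" and x: "x \<in> cliff_grade W a" "x \<in> cliff_grade W b" and "a \<noteq> b"
  shows "x = \<zero>\<^bsub>W\<^esub>"
proof (rule ccontr)
  assume nz: "x \<noteq> \<zero>\<^bsub>W\<^esub>"
  have vs: "rat_vector_space W" and ds: "direct_sum_decomposition W (cliff_grade W)"
    using g by (simp_all add: graded_clifford_module_def)
  interpret M: Module.module rat_field W by (fact vs)
  have xc: "x \<in> carrier W" using subspaceD(1)[OF graded_clifford_subspace[OF g]] x by blast
  let ?c = "\<lambda>a n. if n = a then x else \<zero>\<^bsub>W\<^esub>"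
  have supp: "{n. ?c k n \<noteq> \<zero>\<^bsub>W\<^esub>} = {k}" for k using nz by auto
  define R where "R c \<longleftrightarrow> (\<forall>n. c n \<in> cliff_grade W n) \<and> finite {n. c n \<noteq> \<zero>\<^bsub>W\<^esub>} \<and>
      x = finsum W c {n. c n \<noteq> \<zero>\<^bsub>W\<^esub>}" for c
  have "R (?c k)" if "x \<in> cliff_grade W k" for k
    unfolding R_def supp using that xc subspaceD(2)[OF graded_clifford_subspace[OF g]] by simp
  then have "R (?c a)" "R (?c b)" using x by auto
  moreover have "\<exists>!c. R c" using ds xc unfolding direct_sum_decomposition_def R_def by blast
  ultimately have "?c a = ?c b" by blast
  from fun_cong[OF this, of a] show False using nz \<open>a \<noteq> b\<close> by simp
qed

text \<open>The degree is the eigenvalue of the number operator.  By induction and \<open>[N, Q\<^sub>i] = - Q\<^sub>i\<close>, the vector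
  \<open>N x - (n + 1) x\<close> is killed by every \<open>Q\<^sub>i\<close>.  By admissibility it has degree 0; but it also has degree
  \<open>n + 1\<close>, because \<open>N\<close> preserves degrees.\<close>

lemma grade_num:
  assumes W: "admissible_clifford_module W" and x: "x \<in> cliff_grade W n"
  shows "ladder.num W (cl_P W) (cl_Q W) (\<lambda>_. 1) x = of_nat n \<odot>\<^bsub>W\<^esub> x"
proof -
  interpret ladder W "cl_P W" "cl_Q W" "-1" "\<lambda>_. 1" by (rule admissible_clifford_ladder[OF W])
  have g: "graded_clifford_module W"
    and vac0: "cliff_grade W 0 = {x \<in> carrier W. \<forall>i>0. cliff_Q W i x = \<zero>\<^bsub>W\<^esub>}"
    using W by (simp_all add: admissible_clifford_module_def)
  note QS = graded_clifford_Q[OF g] and PS = graded_clifford_P[OF g]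
  note grD = subspaceD[OF graded_clifford_subspace[OF g]]
  have vac_eq: "vac = cliff_grade W 0" unfolding vac_def vac0 by (auto simp: gr0_conv_Suc)
  show ?thesis
    using x
  proof (induction n arbitrary: x)
    case 0
    then show ?case using num_vac[of x] vac_eq vacD(1)[of x] by simp
  next
    case (Suc n)
    have xc: "x \<in> carrier W" using grD(1) Suc.prems by blast
    let ?y = "num x \<oplus>\<^bsub>W\<^esub> (- of_nat (Suc n)) \<odot>\<^bsub>W\<^esub> x"
    have "cl_Q W i ?y = \<zero>\<^bsub>W\<^esub>" for i
    proof -
      have q: "num (cl_Q W i x) = of_nat n \<odot>\<^bsub>W\<^esub> cl_Q W i x" by (rule Suc.IH[OF QS[OF Suc.prems]])
      have "cl_Q W i ?y = (of_nat n \<odot>\<^bsub>W\<^esub> cl_Q W i x \<oplus>\<^bsub>W\<^esub> cl_Q W i x) \<oplus>\<^bsub>W\<^esub>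
          (- of_nat (Suc n)) \<odot>\<^bsub>W\<^esub> cl_Q W i x"
        using xc by (simp add: Q_num q)
      also have "\<dots> = \<zero>\<^bsub>W\<^esub>" using xc by (simp add: add_collect1 add_collect)
      finally show ?thesis .
    qed
    then have "?y \<in> cliff_grade W 0" using xc by (simp add: vac_def flip: vac_eq)
    moreover have nu: "num_upto b x \<in> cliff_grade W (Suc n)" for b
      by (induction b) (auto intro!: grD PS QS Suc.prems)
    then have "?y \<in> cliff_grade W (Suc n)" unfolding num_def by (intro grD(3,4) nu Suc.prems)
    ultimately have "?y = \<zero>\<^bsub>W\<^esub>" using graded_clifford_disjoint[OF g] by blast
    then show ?case
      using eq_iff_diff_zero[of "num x" "of_nat (Suc n) \<odot>\<^bsub>W\<^esub> x"] xc by simp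
  qed
qed

text \<open>Compatibility with the grading is automatic.  In degree 0 it is compatibility with the vacua, and
  in degree \<open>n + 1\<close> one has \<open>x = (n + 1)\<^sup>-\<^sup>1 \<Sum>\<^sub>b P\<^sub>b Q\<^sub>b x\<close> with \<open>Q\<^sub>b x\<close> of degree \<open>n\<close>.\<close>

lemma clifford_hom_iff:
  assumes W: "admissible_clifford_module W" and W': "admissible_clifford_module W'"
  shows "f \<in> clifford_homs W W' \<longleftrightarrow> f \<in> extensional (carrier W) \<and>
    ladder_hom W (cl_P W) (cl_Q W) W' (cl_P W') (cl_Q W') f"
proof
  assume "f \<in> clifford_homs W W'"
  then show "f \<in> extensional (carrier W) \<and> ladder_hom W (cl_P W) (cl_Q W) W' (cl_P W') (cl_Q W') f"
    by (auto simp: clifford_homs_def linear_maps_def ladder_hom_def)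
next
  assume f: "f \<in> extensional (carrier W) \<and> ladder_hom W (cl_P W) (cl_Q W) W' (cl_P W') (cl_Q W') f"
  interpret A: ladder W "cl_P W" "cl_Q W" "-1" "\<lambda>_. 1" by (rule admissible_clifford_ladder[OF W])
  interpret B: ladder W' "cl_P W'" "cl_Q W'" "-1" "\<lambda>_. 1" by (rule admissible_clifford_ladder[OF W'])
  note h = ladder_homD[OF conjunct2[OF f]]
  note fD = linear_mapD[OF h(1)]
  have g: "graded_clifford_module W" and g': "graded_clifford_module W'"
    and vac0: "cliff_grade W 0 = {x \<in> carrier W. \<forall>i>0. cliff_Q W i x = \<zero>\<^bsub>W\<^esub>}"
    and vac0': "cliff_grade W' 0 = {x \<in> carrier W'. \<forall>i>0. cliff_Q W' i x = \<zero>\<^bsub>W'\<^esub>}"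
    using W W' by (simp_all add: admissible_clifford_module_def)
  have f0: "f \<zero>\<^bsub>W\<^esub> = \<zero>\<^bsub>W'\<^esub>" by (rule linear_map_zero[OF h(1) A.vector_space B.vector_space])
  note grD = subspaceD[OF graded_clifford_subspace[OF g]]
  note grD' = subspaceD[OF graded_clifford_subspace[OF g']]
  note QS = graded_clifford_Q[OF g] and PS = graded_clifford_P[OF g']
  have "f x \<in> cliff_grade W' n" if "x \<in> cliff_grade W n" for n x
    using that
  proof (induction n arbitrary: x)
    case 0
    have "cliff_Q W' i (f x) = \<zero>\<^bsub>W'\<^esub>" if i: "i > 0" for i
    proof -
      obtain k where k: "i = Suc k" using gr0_implies_Suc[OF i] by blast
      have "x \<in> carrier W" "cl_Q W k x = \<zero>\<^bsub>W\<^esub>" using 0 vac0 by auto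
      then show ?thesis using h(3)[of x k] f0 k by simp
    qed
    then show ?case using 0 vac0 vac0' fD(1) by auto
  next
    case (Suc n)
    have xc: "x \<in> carrier W" using grD(1) Suc.prems by blast
    have Qf: "cl_Q W' i (f x) \<in> cliff_grade W' n" for i
      using Suc.IH[OF QS[OF Suc.prems]] h(3)[OF xc] by simp
    have "f (A.num_upto b x) \<in> cliff_grade W' (Suc n)" for b
    proof (induction b)
      case 0
      then show ?case using f0 grD'(2) by simp
    next
      case (Suc b)
      have "f (A.num_upto (Suc b) x) = f (A.num_upto b x) \<oplus>\<^bsub>W'\<^esub> 1 \<odot>\<^bsub>W'\<^esub> cl_P W' b (cl_Q W' b (f x))"
        using xc fD h by simp
      also have "\<dots> \<in> cliff_grade W' (Suc n)" by (intro grD'(3,4) Suc.IH PS Qf)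
      finally show ?case .
    qed
    then have "f (A.num x) \<in> cliff_grade W' (Suc n)" by (simp add: A.num_def)
    then have "f ((1 / of_nat (Suc n)) \<odot>\<^bsub>W\<^esub> A.num x) \<in> cliff_grade W' (Suc n)"
      using fD(3)[of "A.num x"] grD'(4) xc by simp
    moreover have "(1 / of_nat (Suc n)) \<odot>\<^bsub>W\<^esub> A.num x = x"
      unfolding grade_num[OF W Suc.prems] using xc by (simp del: of_nat_Suc)
    ultimately show ?case by simp
  qed
  then show "f \<in> clifford_homs W W'"
    using f h by (auto simp: clifford_homs_def linear_maps_def gr0_conv_Suc)
qed

section \<open>The fermionic Fock space\<close>

lemma wedge_sign_single: "wedge_sign {i} S = (-1) ^ card {t \<in> S. t < i}"
proof -
  have "{(s, t). s \<in> {i} \<and> t \<in> S \<and> t < s} = Pair i ` {t \<in> S. t < i}" by auto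
  then have "card {(s, t). s \<in> {i} \<and> t \<in> S \<and> t < s} = card {t \<in> S. t < i}"
    by (simp add: card_image inj_on_def)
  then show ?thesis by (simp add: wedge_sign_def)
qed

lemma wedge_sign_square [simp]: "wedge_sign {i} S * wedge_sign {i} S = 1"
  "wedge_sign {i} S * (wedge_sign {i} S * x) = x"
  by (simp_all add: wedge_sign_single flip: power_add mult.assoc)

lemma wedge_sign_nonzero: "wedge_sign {i} S \<noteq> 0"
  by (simp add: wedge_sign_single)

lemma wedge_sign_insert:
  assumes "finite S" "j \<notin> S"
  shows "wedge_sign {i} (insert j S) = (if j < i then -1 else 1) * wedge_sign {i} S"
proof (cases "j < i")
  case True
  then have "{t \<in> insert j S. t < i} = insert j {t \<in> S. t < i}" by auto
  then show ?thesis using True assms by (simp add: wedge_sign_single)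
next
  case False
  then have "{t \<in> insert j S. t < i} = {t \<in> S. t < i}" by auto
  then show ?thesis using False by (simp add: wedge_sign_single)
qed

abbreviation cre :: "nat \<Rightarrow> fermion \<Rightarrow> fermion" where
  "cre i f \<equiv> wedge (Poly_Mapping.single {i} 1) f"

text \<open>Operators are compared coefficient by coefficient; the coefficient of the monomial \<open>S\<close> in a
  product is determined by a single coefficient of the factor.\<close>

lemma lookup_cre:
  "Poly_Mapping.lookup (cre i f) S =
     (if i \<in> S then wedge_sign {i} (S - {i}) * Poly_Mapping.lookup f (S - {i}) else 0)"
proof -
  have keys1: "Poly_Mapping.keys (Poly_Mapping.single {i} (1 :: rat)) = {{i}}" by simp
  have "cre i f = (\<Sum>T\<in>Poly_Mapping.keys f. if i \<notin> T
      then Poly_Mapping.single (insert i T) (wedge_sign {i} T * Poly_Mapping.lookup f T) else 0)"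
    unfolding wedge_def keys1 by (simp add: Int_insert_left_if0 cong: if_cong)
  then have "Poly_Mapping.lookup (cre i f) S = (\<Sum>T\<in>Poly_Mapping.keys f. Poly_Mapping.lookup (if i \<notin> T
      then Poly_Mapping.single (insert i T) (wedge_sign {i} T * Poly_Mapping.lookup f T) else 0) S)"
    by (simp add: lookup_sum)
  also have "\<dots> = (\<Sum>T\<in>Poly_Mapping.keys f.
      if T = S - {i} then (if i \<in> S then wedge_sign {i} T * Poly_Mapping.lookup f T else 0) else 0)"
    by (rule sum.cong[OF refl]) (auto simp: lookup_single when_def insert_absorb)
  finally show ?thesis by (auto simp: in_keys_iff)
qed

lemma lookup_ext_deriv:
  "Poly_Mapping.lookup (ext_deriv i f) S =
     (if i \<notin> S then wedge_sign {i} S * Poly_Mapping.lookup f (insert i S) else 0)"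
proof -
  have "Poly_Mapping.lookup (ext_deriv i f) S = (\<Sum>T\<in>Poly_Mapping.keys f.
      if T = insert i S then (if i \<notin> S then wedge_sign {i} S * Poly_Mapping.lookup f T else 0) else 0)"
    unfolding ext_deriv_def lookup_sum
    by (rule sum.cong[OF refl]) (auto simp: lookup_single when_def insert_absorb)
  then show ?thesis by (auto simp: in_keys_iff)
qed

abbreviation "fmon \<equiv> {S :: nat set. finite S \<and> 0 \<notin> S}"

lemma fermionic_sel [simp]:
  "carrier fermionic_fock_space = {f. Poly_Mapping.keys f \<subseteq> fmon}"
  "\<zero>\<^bsub>fermionic_fock_space\<^esub> = 0" "x \<oplus>\<^bsub>fermionic_fock_space\<^esub> y = x + y"
  "c \<odot>\<^bsub>fermionic_fock_space\<^esub> x = pm_scale c x"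
  "cliff_P fermionic_fock_space i = cre i" "cliff_Q fermionic_fock_space = ext_deriv"
  "cliff_grade fermionic_fock_space n = {f. Poly_Mapping.keys f \<subseteq> {S \<in> fmon. card S = n}}"
  by (auto simp: fermionic_fock_space_def)

lemma fermionic_vector_space: "rat_vector_space fermionic_fock_space"
  by (rule rat_vector_space_image(1)[OF free_space_vector_space, of _ "\<lambda>x. x" fmon]) simp_all

lemma fermionic_lookup_zero:
  assumes "f \<in> carrier fermionic_fock_space" "S \<notin> fmon"
  shows "Poly_Mapping.lookup f S = 0"
  using assms by (auto simp: in_keys_iff subset_iff)

lemma fermionic_inI:
  assumes "\<And>S. S \<notin> fmon \<Longrightarrow> Poly_Mapping.lookup f S = 0"
  shows "f \<in> carrier fermionic_fock_space"
  using assms by (force simp: in_keys_iff subset_iff)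

lemma cre_linear:
  assumes "i > 0"
  shows "linear_map fermionic_fock_space fermionic_fock_space (cre i)"
  unfolding linear_map_def
proof (intro conjI ballI allI funcsetI)
  fix f assume f: "f \<in> carrier fermionic_fock_space"
  show "cre i f \<in> carrier fermionic_fock_space"
  proof (rule fermionic_inI)
    fix S assume "S \<notin> fmon"
    then have "i \<in> S \<Longrightarrow> S - {i} \<notin> fmon" using assms by auto
    then show "Poly_Mapping.lookup (cre i f) S = 0" using fermionic_lookup_zero[OF f] by (auto simp: lookup_cre)
  qed
qed (auto intro!: poly_mapping_eqI simp: lookup_cre lookup_add distrib_left)

lemma ext_deriv_linear:
  assumes "i > 0"
  shows "linear_map fermionic_fock_space fermionic_fock_space (ext_deriv i)"
  unfolding linear_map_def
proof (intro conjI ballI allI funcsetI)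
  fix f assume f: "f \<in> carrier fermionic_fock_space"
  show "ext_deriv i f \<in> carrier fermionic_fock_space"
  proof (rule fermionic_inI)
    fix S assume "S \<notin> fmon"
    then have "insert i S \<notin> fmon" by auto
    then show "Poly_Mapping.lookup (ext_deriv i f) S = 0"
      using fermionic_lookup_zero[OF f] by (simp add: lookup_ext_deriv)
  qed
qed (auto intro!: poly_mapping_eqI simp: lookup_ext_deriv lookup_add distrib_left)

text \<open>For \<open>i \<noteq> j\<close> the presence of the smaller index changes the sign of the larger one, and this
  happens in exactly one of the two orders.  Infinite sets, for which \<^const>\<open>wedge_sign\<close> does not
  count elements, have coefficient zero.\<close>

lemma cre_cre:
  assumes f: "f \<in> carrier fermionic_fock_space"
  shows "cre i (cre j f) = pm_scale (-1) (cre j (cre i f))"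
proof (rule poly_mapping_eqI)
  fix S
  show "Poly_Mapping.lookup (cre i (cre j f)) S = Poly_Mapping.lookup (pm_scale (-1) (cre j (cre i f))) S"
  proof (cases "i \<in> S \<and> j \<in> S \<and> i \<noteq> j")
    case True
    then obtain T where S: "S = insert i (insert j T)" and T: "i \<notin> T" "j \<notin> T" "i \<noteq> j"
      by (metis Diff_iff insertI1 insert_Diff insert_iff)
    show ?thesis
    proof (cases "finite T")
      case True
      have eq: "S - {i} = insert j T" "S - {j} = insert i T" "insert j T - {j} = T" "insert i T - {i} = T"
        using S T by auto
      have "i \<in> S" "j \<in> S" using S by auto
      then show ?thesis using T True
        by (auto simp: lookup_cre eq wedge_sign_insert linorder_neq_iff)
    next
      case False
      then have z: "Poly_Mapping.lookup f (S - {i} - {j}) = 0" "Poly_Mapping.lookup f (S - {j} - {i}) = 0"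
        using S by (auto intro!: fermionic_lookup_zero[OF f])
      then show ?thesis by (simp add: lookup_cre)
    qed
  qed (auto simp: lookup_cre)
qed

lemma ext_deriv_ext_deriv:
  assumes f: "f \<in> carrier fermionic_fock_space"
  shows "ext_deriv i (ext_deriv j f) = pm_scale (-1) (ext_deriv j (ext_deriv i f))"
proof (rule poly_mapping_eqI)
  fix S
  show "Poly_Mapping.lookup (ext_deriv i (ext_deriv j f)) S =
      Poly_Mapping.lookup (pm_scale (-1) (ext_deriv j (ext_deriv i f))) S"
  proof (cases "i \<notin> S \<and> j \<notin> S \<and> i \<noteq> j")
    case True
    show ?thesis
    proof (cases "finite S")
      case fin: True
      then show ?thesis using True
        by (auto simp: lookup_ext_deriv wedge_sign_insert linorder_neq_iff insert_commute)
    next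
      case False
      then have z: "Poly_Mapping.lookup f (insert i (insert j S)) = 0"
        "Poly_Mapping.lookup f (insert j (insert i S)) = 0"
        by (auto intro!: fermionic_lookup_zero[OF f])
      then show ?thesis by (simp add: lookup_ext_deriv)
    qed
  qed (auto simp: lookup_ext_deriv)
qed

lemma ext_deriv_cre:
  assumes f: "f \<in> carrier fermionic_fock_space"
  shows "ext_deriv i (cre j f) = pm_scale (-1) (cre j (ext_deriv i f)) + pm_scale (if i = j then 1 else 0) f"
proof (rule poly_mapping_eqI)
  fix S
  show "Poly_Mapping.lookup (ext_deriv i (cre j f)) S =
      Poly_Mapping.lookup (pm_scale (-1) (cre j (ext_deriv i f)) + pm_scale (if i = j then 1 else 0) f) S"
  proof (cases "i = j")
    case True
    then show ?thesis
      by (cases "j \<in> S") (simp_all add: lookup_ext_deriv lookup_cre lookup_add insert_absorb)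
  next
    case ij: False
    show ?thesis
    proof (cases "i \<notin> S \<and> j \<in> S")
      case True
      then obtain T where S: "S = insert j T" and T: "j \<notin> T" "i \<notin> T"
        by (metis Diff_iff insertI1 insert_Diff)
      have eq: "insert i S - {j} = insert i T" "S - {j} = T" using S T ij by auto
      show ?thesis
      proof (cases "finite T")
        case fin: True
        have "wedge_sign {i} S = (if j < i then -1 else 1) * wedge_sign {i} T"
          "wedge_sign {j} (insert i T) = (if i < j then -1 else 1) * wedge_sign {j} T"
          using wedge_sign_insert fin T S by auto
        then show ?thesis using T ij True
          by (auto simp: lookup_ext_deriv lookup_cre lookup_add eq linorder_neq_iff)
      next
        case False
        then have "Poly_Mapping.lookup f (insert i T) = 0" by (auto intro!: fermionic_lookup_zero[OF f])
        then show ?thesis using ij by (simp add: lookup_ext_deriv lookup_cre lookup_add eq)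
      qed
    next
      case False
      then show ?thesis using ij by (auto simp: lookup_ext_deriv lookup_cre lookup_add)
    qed
  qed
qed

lemma fermionic_nilpotent:
  assumes "f \<in> carrier fermionic_fock_space" "\<And>S. S \<in> Poly_Mapping.keys f \<Longrightarrow> card S < n"
  shows "qnil fermionic_fock_space (cl_Q fermionic_fock_space) n f"
  using assms
proof (induction n arbitrary: f)
  case 0
  then have "Poly_Mapping.keys f = {}" by blast
  then show ?case by simp
next
  case (Suc n)
  have "qnil fermionic_fock_space (cl_Q fermionic_fock_space) n (ext_deriv (Suc i) f)" for i
  proof (rule Suc.IH)
    show "ext_deriv (Suc i) f \<in> carrier fermionic_fock_space"
      by (rule linear_mapD(1)[OF ext_deriv_linear Suc.prems(1)]) simp
    fix S assume "S \<in> Poly_Mapping.keys (ext_deriv (Suc i) f)"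
    then have *: "Suc i \<notin> S" "insert (Suc i) S \<in> Poly_Mapping.keys f"
      by (auto simp: in_keys_iff lookup_ext_deriv split: if_splits)
    then have "finite S" using Suc.prems(1) by auto
    then show "card S < n" using Suc.prems(2)[OF *(2)] *(1) by simp
  qed
  then show ?case by simp
qed

lemma fermionic_ladder:
  "ladder fermionic_fock_space (cl_P fermionic_fock_space) (cl_Q fermionic_fock_space) (-1) (\<lambda>_. 1)"
proof (intro ladder.intro lowering.intro rat_vs.intro ladder_axioms.intro lowering_axioms.intro)
  fix f assume f: "f \<in> carrier fermionic_fock_space"
  have fin: "finite (\<Union>(Poly_Mapping.keys f))" using f by auto
  then obtain b where b: "\<forall>i\<in>\<Union>(Poly_Mapping.keys f). i < b"
    using finite_nat_set_iff_bounded by blast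
  show "\<exists>b. \<forall>m\<ge>b. cl_Q fermionic_fock_space m f = \<zero>\<^bsub>fermionic_fock_space\<^esub>"
  proof (intro exI allI impI)
    fix m assume "m \<ge> b"
    have "Poly_Mapping.lookup f (insert (Suc m) S) = 0" for S
    proof (rule ccontr)
      assume "Poly_Mapping.lookup f (insert (Suc m) S) \<noteq> 0"
      then have "Suc m \<in> \<Union>(Poly_Mapping.keys f)" by (auto simp: in_keys_iff)
      then show False using b \<open>m \<ge> b\<close> by fastforce
    qed
    then show "cl_Q fermionic_fock_space m f = \<zero>\<^bsub>fermionic_fock_space\<^esub>"
      by (intro poly_mapping_eqI) (simp add: lookup_ext_deriv)
  qed
  have "finite (card ` Poly_Mapping.keys f)" by simp
  then obtain n where "\<forall>k\<in>card ` Poly_Mapping.keys f. k < n"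
    using finite_nat_set_iff_bounded by blast
  then show "\<exists>n. qnil fermionic_fock_space (cl_Q fermionic_fock_space) n f"
    by (intro exI fermionic_nilpotent[OF f]) auto
  show "cl_P fermionic_fock_space i (cl_P fermionic_fock_space j f) =
      (-1) \<odot>\<^bsub>fermionic_fock_space\<^esub> cl_P fermionic_fock_space j (cl_P fermionic_fock_space i f)" for i j
    using cre_cre[OF f, of "Suc i" "Suc j"] by simp
  show "cl_Q fermionic_fock_space i (cl_Q fermionic_fock_space j f) =
      (-1) \<odot>\<^bsub>fermionic_fock_space\<^esub> cl_Q fermionic_fock_space j (cl_Q fermionic_fock_space i f)" for i j
    using ext_deriv_ext_deriv[OF f, of "Suc i" "Suc j"] by simp
  show "cl_Q fermionic_fock_space i (cl_P fermionic_fock_space j f) =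
      (-1) \<odot>\<^bsub>fermionic_fock_space\<^esub> cl_P fermionic_fock_space j (cl_Q fermionic_fock_space i f)
      \<oplus>\<^bsub>fermionic_fock_space\<^esub> (if i = j then 1 else 0) \<odot>\<^bsub>fermionic_fock_space\<^esub> f" for i j
    using ext_deriv_cre[OF f, of "Suc i" "Suc j"] by simp
next
  show "linear_map fermionic_fock_space fermionic_fock_space (cl_P fermionic_fock_space i)" for i
    using cre_linear[of "Suc i"] by simp
  show "linear_map fermionic_fock_space fermionic_fock_space (cl_Q fermionic_fock_space i)" for i
    using ext_deriv_linear[of "Suc i"] by simp
qed (rule fermionic_vector_space | simp)+

interpretation ferm: ladder fermionic_fock_space "cl_P fermionic_fock_space" "cl_Q fermionic_fock_space"
    "-1" "\<lambda>_. 1"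
  by (rule fermionic_ladder)

abbreviation fvac :: fermion where
  "fvac \<equiv> Poly_Mapping.single {} 1"

lemma fvac_in_vac: "fvac \<in> ferm.vac"
  unfolding ferm.vac_def
  by (auto intro!: poly_mapping_eqI simp: lookup_ext_deriv lookup_single)

text \<open>The coefficient of \<open>f\<close> at a nonempty \<open>S\<close> is, up to sign, the coefficient of \<open>Q\<^sub>i f\<close> at \<open>S - {i}\<close>
  for any \<open>i \<in> S\<close>.\<close>

lemma fermionic_vac: "ferm.vac \<subseteq> range (\<lambda>c. c \<odot>\<^bsub>fermionic_fock_space\<^esub> fvac)"
proof
  fix f assume f: "f \<in> ferm.vac"
  have "Poly_Mapping.lookup f S = 0" if ne: "S \<noteq> {}" for S
  proof (cases "S \<in> fmon")
    case True
    obtain i where i: "i \<in> S" using ne by blast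
    then have "i \<noteq> 0" using True by (metis mem_Collect_eq)
    then obtain k where k: "i = Suc k" using not0_implies_Suc by blast
    have "Poly_Mapping.lookup (ext_deriv (Suc k) f) (S - {i}) = 0" using ferm.vacD(2)[OF f, of k] by simp
    then show ?thesis using i k wedge_sign_nonzero[of i "S - {i}"]
      by (simp add: lookup_ext_deriv insert_absorb)
  next
    case False
    then show ?thesis using fermionic_lookup_zero ferm.vacD(1)[OF f] by blast
  qed
  then have "f = pm_scale (Poly_Mapping.lookup f {}) fvac"
    by (intro poly_mapping_eqI) (auto simp: lookup_single when_def)
  then show "f \<in> range (\<lambda>c. c \<odot>\<^bsub>fermionic_fock_space\<^esub> fvac)" by auto
qed

section \<open>The grading of a fermionic tensor product\<close>

lemma clifford_tensor_sel [simp]: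
  "carrier (clifford_tensor W V) = carrier (tensor_prod W V)"
  "\<zero>\<^bsub>clifford_tensor W V\<^esub> = \<zero>\<^bsub>tensor_prod W V\<^esub>"
  "add (clifford_tensor W V) = add (tensor_prod W V)"
  "smult (clifford_tensor W V) = smult (tensor_prod W V)"
  "cliff_P (clifford_tensor W V) = (\<lambda>i. tensor_map W V W V (cliff_P W i) id)"
  "cliff_Q (clifford_tensor W V) = (\<lambda>i. tensor_map W V W V (cliff_Q W i) id)"
  "cliff_grade (clifford_tensor W V) =
     (\<lambda>n. tensor_class W V ` {p. Poly_Mapping.keys p \<subseteq> cliff_grade W n \<times> carrier V})"
  by (simp_all add: clifford_tensor_def module.defs clifford_module.defs)

definition degree_part :: "nat \<Rightarrow> fermion \<Rightarrow> fermion" where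
  "degree_part n f = Poly_Mapping.mapp (\<lambda>S c. if card S = n then c else 0) f"

lemma lookup_degree_part:
  "Poly_Mapping.lookup (degree_part n f) S = (if card S = n then Poly_Mapping.lookup f S else 0)"
  by (simp add: degree_part_def lookup_mapp when_def in_keys_iff)

lemma degree_part_linear: "linear_map fermionic_fock_space fermionic_fock_space (degree_part n)"
  unfolding linear_map_def
proof (intro conjI ballI allI funcsetI)
  fix f assume "f \<in> carrier fermionic_fock_space"
  then show "degree_part n f \<in> carrier fermionic_fock_space"
    using fermionic_lookup_zero by (intro fermionic_inI) (simp add: lookup_degree_part)
qed (auto intro!: poly_mapping_eqI simp: lookup_degree_part lookup_add)

lemma degree_part_grade:
  assumes "f \<in> cliff_grade fermionic_fock_space k"
  shows "degree_part n f = (if n = k then f else 0)"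
proof (rule poly_mapping_eqI)
  fix S
  have "Poly_Mapping.lookup f S = 0" if "card S \<noteq> k"
    using assms that by (auto simp: in_keys_iff subset_iff)
  then show "Poly_Mapping.lookup (degree_part n f) S = Poly_Mapping.lookup (if n = k then f else 0) S"
    by (auto simp: lookup_degree_part)
qed

locale fermionic_tensor = rat_vs V for V :: "(rat, 'v) module"
begin

sublocale FT: ladder_tensor fermionic_fock_space "cl_P fermionic_fock_space" "cl_Q fermionic_fock_space"
    "-1" "\<lambda>_. 1" V
  by (rule ladder_tensor.intro[OF fermionic_ladder rat_vs_axioms])

abbreviation "Fk \<equiv> fermionic_fock_space"

definition gr :: "nat \<Rightarrow> (fermion, 'v) tensor set" where
  "gr n = tensor_class Fk V ` {p. Poly_Mapping.keys p \<subseteq> cliff_grade Fk n \<times> carrier V}"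

lemma grade_sub: "cliff_grade Fk n \<times> carrier V \<subseteq> carrier Fk \<times> carrier V"
  by auto

lemma gr_subspace: "subspace FT.T (gr n)"
  using linear_map_image_subspace[OF free_space_vector_space tensor_prod_vector_space
      tensor_class_linear_on[OF grade_sub, of n]]
  by (simp add: gr_def)

lemma gr_induct:
  assumes "subspace FT.T M" "\<And>f v. f \<in> cliff_grade Fk n \<Longrightarrow> v \<in> carrier V \<Longrightarrow> FT.ten f v \<in> M"
  shows "gr n \<subseteq> M"
proof
  fix x assume "x \<in> gr n"
  then obtain p where p: "Poly_Mapping.keys p \<subseteq> cliff_grade Fk n \<times> carrier V" "x = tensor_class Fk V p"
    unfolding gr_def by blast
  show "x \<in> M" unfolding p(2) by (rule tensor_class_induct[OF assms(1) grade_sub _ p(1)]) (use assms(2) in auto)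
qed

lemma ten_in_gr: "f \<in> cliff_grade Fk n \<Longrightarrow> v \<in> carrier V \<Longrightarrow> FT.ten f v \<in> gr n"
  unfolding gr_def tens_def by (rule imageI) (simp del: fermionic_sel)

lemma ten_grade_in: "f \<in> cliff_grade Fk n \<Longrightarrow> v \<in> carrier V \<Longrightarrow> FT.ten f v \<in> carrier FT.T"
  by (rule tens_in) auto

lemma gr_image:
  assumes h: "linear_map Fk Fk h" and "\<And>f. f \<in> cliff_grade Fk n \<Longrightarrow> h f \<in> cliff_grade Fk m"
  shows "tensor_map Fk V Fk V h id ` gr n \<subseteq> gr m"
proof -
  note hl = tensor_map_linear[OF h linear_map_identity, of V]
  have "gr n \<subseteq> {x \<in> carrier FT.T. tensor_map Fk V Fk V h id x \<in> gr m}"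
  proof (rule gr_induct)
    show "subspace FT.T {x \<in> carrier FT.T. tensor_map Fk V Fk V h id x \<in> gr m}"
      by (rule linear_map_preimage_subspace[OF tensor_prod_vector_space tensor_prod_vector_space hl gr_subspace])
    fix f v assume f: "f \<in> cliff_grade Fk n" and v: "v \<in> carrier V"
    then have "f \<in> carrier Fk" by auto
    then show "FT.ten f v \<in> {x \<in> carrier FT.T. tensor_map Fk V Fk V h id x \<in> gr m}"
      using ten_in_gr[OF assms(2)[OF f] v] v by (simp add: h linear_map_identity del: fermionic_sel)
  qed
  then show ?thesis by blast
qed

text \<open>The projections are \<open>degree_part n \<otimes> id\<close>.  The homogeneous components span because the
  monomials do.\<close>

lemma gr_direct_sum: "direct_sum_decomposition FT.T gr"
proof (rule direct_sum_decompositionI[of _ _ "\<lambda>n. tensor_map Fk V Fk V (degree_part n) id"])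
  let ?D = "\<lambda>n. tensor_map Fk V Fk V (degree_part n) id"
  show "rat_vector_space FT.T" by (rule tensor_prod_vector_space)
  show "subspace FT.T (gr n)" for n by (rule gr_subspace)
  show lin: "linear_map FT.T FT.T (?D n)" for n
    by (rule tensor_map_linear[OF degree_part_linear linear_map_identity])
  have pure: "?D n (FT.ten f v) = (if n = k then FT.ten f v else \<zero>\<^bsub>FT.T\<^esub>)"
    if "f \<in> cliff_grade Fk k" "v \<in> carrier V" for n k f v
  proof -
    have "f \<in> carrier Fk" using that(1) by auto
    then show ?thesis
      using degree_part_grade[OF that(1), of n] that(2) FT.ten_zero[OF that(2)]
      by (simp add: degree_part_linear linear_map_identity del: fermionic_sel(1) fermionic_sel(7))
  qed
  show "?D n x = x" if "x \<in> gr n" for n x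
  proof -
    have "gr n \<subseteq> {x \<in> carrier FT.T. ?D n x = x}"
      by (rule gr_induct[OF linear_map_equalizer_subspace[OF tensor_prod_vector_space
              tensor_prod_vector_space lin linear_map_id]])
        (simp add: pure ten_grade_in del: fermionic_sel)
    then show ?thesis using that by blast
  qed
  show "?D n x = \<zero>\<^bsub>FT.T\<^esub>" if "x \<in> gr k" "n \<noteq> k" for n k x
  proof -
    have "gr k \<subseteq> {x \<in> carrier FT.T. ?D n x = \<zero>\<^bsub>FT.T\<^esub>}"
      by (rule gr_induct[OF linear_map_kernel_subspace[OF tensor_prod_vector_space
              tensor_prod_vector_space lin]])
        (use that(2) in \<open>simp add: pure ten_grade_in del: fermionic_sel\<close>)
    then show ?thesis using that by blast
  qed
  fix M assume M: "subspace FT.T M" and gr: "\<And>n. gr n \<subseteq> M"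
  show "carrier FT.T \<subseteq> M"
  proof
    fix x assume "x \<in> carrier FT.T"
    then show "x \<in> M"
    proof (rule tensor_induct[OF M, rotated])
      fix f v assume f: "f \<in> carrier Fk" and v: "v \<in> carrier V"
      have "linear_map (free_space fmon) FT.T (\<lambda>f. FT.ten f v)"
        using tens_linear_left[OF v, of Fk] by (simp add: linear_map_def)
      then have "subspace (free_space fmon) {f \<in> carrier (free_space fmon). FT.ten f v \<in> M}"
        by (rule linear_map_preimage_subspace[OF free_space_vector_space tensor_prod_vector_space _ M])
      then have "f \<in> {f \<in> carrier (free_space fmon). FT.ten f v \<in> M}"
      proof (rule free_space_induct)
        fix S assume "S \<in> fmon"
        then have "Poly_Mapping.single S 1 \<in> cliff_grade Fk (card S)" by simp
        then have "FT.ten (Poly_Mapping.single S 1) v \<in> gr (card S)" by (rule ten_in_gr[OF _ v])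
        then show "Poly_Mapping.single S 1 \<in> {f \<in> carrier (free_space fmon). FT.ten f v \<in> M}"
          using gr \<open>S \<in> fmon\<close> by auto
      qed (use f in simp)
      then show "FT.ten f v \<in> M" by simp
    qed
  qed
qed

text \<open>The relations and the finiteness condition are those of a ladder module.  The description of
  degree 0 is \<open>tensor_vac\<close>: the vacuum consists of the tensors \<open>1 \<otimes> v\<close>.\<close>

lemma fermionic_tensor_admissible: "admissible_clifford_module (clifford_tensor Fk V)"
proof -
  let ?W = "clifford_tensor Fk V"
  have vs: "rat_vector_space ?W"
    by (rule rat_vector_space_cong[of FT.T]) (simp_all add: tensor_prod_vector_space)
  have lin_eq: "linear_map ?W ?W f \<longleftrightarrow> linear_map FT.T FT.T f" for f
    by (simp add: linear_map_def)
  have vacT: "FT.TL.vac = FT.ten fvac ` carrier V"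
    by (rule FT.tensor_vac[OF fvac_in_vac fermionic_vac])
  have "clifford_relations ?W"
    unfolding clifford_relations_def
  proof (intro conjI allI impI ballI)
    fix i :: nat assume i: "i > 0"
    then obtain a where a: "i = Suc a" using gr0_implies_Suc by blast
    show "linear_map ?W ?W (cliff_P ?W i)" "linear_map ?W ?W (cliff_Q ?W i)"
      using FT.PT_linear[of a] FT.QT_linear[of a] by (simp_all add: lin_eq a)
    fix j :: nat and x assume j: "j > 0" and x: "x \<in> carrier ?W"
    then obtain b where b: "j = Suc b" using gr0_implies_Suc by blast
    have x': "x \<in> carrier FT.T" using x by simp
    note in_T = linear_mapD(1)[OF FT.PT_linear] linear_mapD(1)[OF FT.QT_linear]
    show "cliff_P ?W i (cliff_P ?W j x) \<oplus>\<^bsub>?W\<^esub> cliff_P ?W j (cliff_P ?W i x) = \<zero>\<^bsub>?W\<^esub>"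
      using FT.TL.PP[OF x', of a b] x' in_T by (simp add: a b FT.T.add_collect1)
    show "cliff_Q ?W i (cliff_Q ?W j x) \<oplus>\<^bsub>?W\<^esub> cliff_Q ?W j (cliff_Q ?W i x) = \<zero>\<^bsub>?W\<^esub>"
      using FT.TL.QQ[OF x', of a b] x' in_T by (simp add: a b FT.T.add_collect1)
    show "cliff_P ?W i (cliff_Q ?W j x) \<oplus>\<^bsub>?W\<^esub> cliff_Q ?W j (cliff_P ?W i x) = (if i = j then x else \<zero>\<^bsub>?W\<^esub>)"
      using FT.TL.QP[OF x', of b a] x' in_T by (simp add: a b FT.T.add_collect1)
  qed
  moreover have "direct_sum_decomposition ?W (cliff_grade ?W)"
  proof -
    have grW: "cliff_grade ?W = gr" by (simp add: gr_def fun_eq_iff del: fermionic_sel(7))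
    have sub: "submodule S rat_field ?W \<longleftrightarrow> submodule S rat_field FT.T" for S
      by (simp add: submodule_iff_subspace vs tensor_prod_vector_space subspace_def)
    have "finsum ?W f A = finsum FT.T f A" for f :: "nat \<Rightarrow> _" and A
      by (simp add: finsum_def finprod_def)
    then show ?thesis
      using gr_direct_sum unfolding direct_sum_decomposition_def grW sub by simp
  qed
  moreover have PQ: "cliff_P ?W i ` cliff_grade ?W n \<subseteq> cliff_grade ?W (Suc n)"
    "cliff_Q ?W i ` cliff_grade ?W (Suc n) \<subseteq> cliff_grade ?W n"
    "cliff_Q ?W i ` cliff_grade ?W 0 \<subseteq> {\<zero>\<^bsub>?W\<^esub>}" if i: "i > 0" for i n
  proof -
    have "cre i f \<in> cliff_grade Fk (Suc n)" if f: "f \<in> cliff_grade Fk n" for f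
    proof -
      have "S \<in> {S \<in> fmon. card S = Suc n}" if "S \<in> Poly_Mapping.keys (cre i f)" for S
      proof -
        have "i \<in> S" "S - {i} \<in> Poly_Mapping.keys f"
          using that by (auto simp: in_keys_iff lookup_cre split: if_splits)
        then have "finite (S - {i})" "0 \<notin> S - {i}" "card (S - {i}) = n" using f by auto
        then show ?thesis using \<open>i \<in> S\<close> i by (auto simp: card_Diff_singleton) (metis Suc_pred card_gt_0_iff empty_iff)
      qed
      then show ?thesis by auto
    qed
    then show "cliff_P ?W i ` cliff_grade ?W n \<subseteq> cliff_grade ?W (Suc n)"
      using gr_image[OF cre_linear[OF i], of n "Suc n"] by (simp add: gr_def del: fermionic_sel(7))
    have "ext_deriv i f \<in> cliff_grade Fk n" if f: "f \<in> cliff_grade Fk (Suc n)" for f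
    proof -
      have "S \<in> {S \<in> fmon. card S = n}" if "S \<in> Poly_Mapping.keys (ext_deriv i f)" for S
      proof -
        have "i \<notin> S" "insert i S \<in> Poly_Mapping.keys f"
          using that by (auto simp: in_keys_iff lookup_ext_deriv split: if_splits)
        then have "finite (insert i S)" "0 \<notin> insert i S" "card (insert i S) = Suc n" using f by auto
        then show ?thesis using \<open>i \<notin> S\<close> by simp
      qed
      then show ?thesis by auto
    qed
    then show "cliff_Q ?W i ` cliff_grade ?W (Suc n) \<subseteq> cliff_grade ?W n"
      using gr_image[OF ext_deriv_linear[OF i], of "Suc n" n] by (simp add: gr_def del: fermionic_sel(7))
    note lin = tensor_map_linear[OF ext_deriv_linear[OF i] linear_map_identity, of V]
    have "gr 0 \<subseteq> {x \<in> carrier FT.T. tensor_map Fk V Fk V (ext_deriv i) id x = \<zero>\<^bsub>FT.T\<^esub>}"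
    proof (rule gr_induct[OF linear_map_kernel_subspace[OF tensor_prod_vector_space tensor_prod_vector_space lin]])
      fix f v assume f: "f \<in> cliff_grade Fk 0" and v: "v \<in> carrier V"
      have "Poly_Mapping.lookup f (insert i S) = 0" for S
        using f by (auto simp: in_keys_iff subset_iff)
      then have "ext_deriv i f = 0" by (intro poly_mapping_eqI) (simp add: lookup_ext_deriv)
      moreover have "f \<in> carrier Fk" using f by auto
      ultimately show "FT.ten f v \<in> {x \<in> carrier FT.T. tensor_map Fk V Fk V (ext_deriv i) id x = \<zero>\<^bsub>FT.T\<^esub>}"
        using v FT.ten_zero[OF v] by (simp add: ext_deriv_linear[OF i] linear_map_identity del: fermionic_sel(1))
    qed
    then show "cliff_Q ?W i ` cliff_grade ?W 0 \<subseteq> {\<zero>\<^bsub>?W\<^esub>}" by (auto simp: gr_def)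
  qed
  ultimately have graded: "graded_clifford_module ?W"
    unfolding graded_clifford_module_def using vs by blast
  have fin: "\<exists>N. \<forall>m>N. cliff_Q ?W m x = \<zero>\<^bsub>?W\<^esub>" if x: "x \<in> carrier ?W" for x
  proof -
    obtain b where b: "\<forall>m\<ge>b. FT.QT m x = \<zero>\<^bsub>FT.T\<^esub>" using FT.TL.Q_finite x by auto
    have "cliff_Q ?W m x = \<zero>\<^bsub>?W\<^esub>" if "m > b" for m
    proof -
      obtain k where "m = Suc k" "k \<ge> b" using \<open>m > b\<close> by (cases m) auto
      then show ?thesis using b by simp
    qed
    then show ?thesis by blast
  qed
  have "cliff_grade ?W 0 = {x \<in> carrier ?W. \<forall>i>0. cliff_Q ?W i x = \<zero>\<^bsub>?W\<^esub>}"
  proof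
    show "cliff_grade ?W 0 \<subseteq> {x \<in> carrier ?W. \<forall>i>0. cliff_Q ?W i x = \<zero>\<^bsub>?W\<^esub>}"
      using PQ(3) subspaceD(1)[OF graded_clifford_subspace[OF graded, of 0]] by blast
    show "{x \<in> carrier ?W. \<forall>i>0. cliff_Q ?W i x = \<zero>\<^bsub>?W\<^esub>} \<subseteq> cliff_grade ?W 0"
    proof
      fix x assume "x \<in> {x \<in> carrier ?W. \<forall>i>0. cliff_Q ?W i x = \<zero>\<^bsub>?W\<^esub>}"
      then have "x \<in> FT.TL.vac" unfolding FT.TL.vac_def by auto
      then obtain v where v: "v \<in> carrier V" "x = FT.ten fvac v" using vacT by blast
      have "fvac \<in> cliff_grade Fk 0" by simp
      then show "x \<in> cliff_grade ?W 0" using ten_in_gr[OF _ v(1), of fvac 0] v(2) by (simp add: gr_def)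
    qed
  qed
  then show ?thesis using graded fin by (simp add: admissible_clifford_module_def)
qed

end

lemma countable_fermionic: "countable (carrier fermionic_fock_space)"
proof -
  have "countable fmon" by (rule countable_subset[OF _ countable_Collect_finite]) auto
  then show ?thesis by (simp add: countable_poly_mappings)
qed

theorem fermionic_functor_weak_equivalence:
  fixes U :: "'a set"
  assumes U: "infinite U"
  shows "weak_equivalence (vect_cat U :: ((rat, 'a) module, 'a \<Rightarrow> 'a) cat) (admissible_clifford_cat U) fermionic_functor"
proof -
  have sel: "Obj (admissible_clifford_cat U) = {W. admissible_clifford_module W \<and> carrier W \<lesssim> U}"
    "Hom (admissible_clifford_cat U) = clifford_homs"
    "Id (admissible_clifford_cat U) = (\<lambda>W. \<lambda>x\<in>carrier W. x)"
    "Comp (admissible_clifford_cat U) = (\<lambda>W W' W'' g f. compose (carrier W) g f)"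
    for U :: "'a set"
    by (simp_all add: admissible_clifford_cat_def)
  have fun_sel: "obj_map fermionic_functor V = clifford_tensor fermionic_fock_space V"
    "mor_map fermionic_functor V V' f = tensor_map fermionic_fock_space V fermionic_fock_space V' id f"
    for V V' :: "(rat, 'a) module" and f
    by (simp_all add: fermionic_functor_def)
  interpret fock_equivalence fermionic_fock_space "cl_P fermionic_fock_space" "cl_Q fermionic_fock_space"
    "-1" "\<lambda>_. 1" fvac "\<lambda>f. Poly_Mapping.lookup f {}" U "admissible_clifford_cat U" cl_P cl_Q
    "fermionic_functor :: ((rat, 'a) module, _, _, _) cat_functor"
  proof (intro fock_equivalence.intro fock_equivalence_axioms.intro fermionic_ladder fvac_in_vac fermionic_vac)
    fix V :: "(rat, 'a) module" assume V: "rat_vector_space V" "carrier V \<lesssim> U"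
    interpret fermionic_tensor V by (rule fermionic_tensor.intro[OF rat_vs.intro[OF V(1)]])
    show "obj_map fermionic_functor V \<in> Obj (admissible_clifford_cat U)"
      using fermionic_tensor_admissible tensor_prod_lepoll[OF U countable_fermionic V(2)]
      by (simp add: sel fun_sel)
  qed (simp_all add: sel fun_sel lookup_add admissible_clifford_ladder clifford_hom_iff)
  show ?thesis by (rule weak_equivalence_F)
qed

section \<open>Admissible Heisenberg modules\<close>

abbreviation he_P :: "'w heisenberg_module \<Rightarrow> nat \<Rightarrow> 'w \<Rightarrow> 'w" where
  "he_P W \<equiv> (\<lambda>i. heis_H W (int (Suc i)))"

abbreviation he_Q :: "'w heisenberg_module \<Rightarrow> nat \<Rightarrow> 'w \<Rightarrow> 'w" where
  "he_Q W \<equiv> (\<lambda>i. heis_H W (- int (Suc i)))"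

text \<open>The factors of \<open>H\<^bsub>-\<lambda>\<^esub>\<close> for an arbitrary list of indices.  In \<^const>\<open>heis_neg\<close> the list is
  the sorted support of \<open>\<lambda>\<close>, which is unsuitable for induction.\<close>

definition heis_word :: "'w heisenberg_module \<Rightarrow> (nat \<Rightarrow>\<^sub>0 nat) \<Rightarrow> nat list \<Rightarrow> 'w \<Rightarrow> 'w" where
  "heis_word W l ks = foldr (\<lambda>i g. (heis_H W (- int i) ^^ Poly_Mapping.lookup l i) \<circ> g) ks id"

lemma heis_word_simps [simp]:
  "heis_word W l [] x = x"
  "heis_word W l (k # ks) x = (heis_H W (- int k) ^^ Poly_Mapping.lookup l k) (heis_word W l ks x)"
  by (simp_all add: heis_word_def)

lemma heis_neg_eq_word:
  "heis_neg W l = heis_word W l (sorted_list_of_set (Poly_Mapping.keys l))"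
  by (simp add: heis_neg_def heis_word_def)

lemma heis_neg_zero [simp]: "heis_neg W 0 x = x"
  by (simp add: heis_neg_eq_word)

text \<open>The exponent vector of a single variable.\<close>

definition munit :: "nat \<Rightarrow> nat \<Rightarrow>\<^sub>0 nat" where
  "munit k = Poly_Mapping.single k 1"

lemma lookup_munit: "Poly_Mapping.lookup (munit k) m = (if m = k then 1 else 0)"
  by (simp add: munit_def lookup_single when_def)

lemma keys_munit: "Poly_Mapping.keys (munit k) = {k}"
  by (simp add: munit_def)

lemma seq_weight_superset:
  assumes "finite A" "Poly_Mapping.keys l \<subseteq> A"
  shows "seq_weight l = (\<Sum>i\<in>A. i * Poly_Mapping.lookup l i)"
  unfolding seq_weight_def by (rule sum.mono_neutral_left) (use assms in \<open>auto simp: in_keys_iff\<close>)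

lemma seq_weight_add_single: "seq_weight (l + munit i) = seq_weight l + i"
proof -
  let ?A = "insert i (Poly_Mapping.keys l)"
  have "Poly_Mapping.keys (l + munit i) \<subseteq> ?A"
    using Poly_Mapping.keys_add[of l "munit i"] by (auto simp: munit_def)
  then have "seq_weight (l + munit i) =
      (\<Sum>k\<in>?A. k * Poly_Mapping.lookup l k + (if k = i then i else 0))"
    by (subst seq_weight_superset[of ?A])
      (auto simp: lookup_add lookup_munit algebra_simps intro!: sum.cong)
  also have "\<dots> = seq_weight l + i"
    by (subst seq_weight_superset[of ?A l]) (auto simp: sum.distrib)
  finally show ?thesis .
qed

lemma seq_weight_single: "seq_weight (munit i) = i"
  using seq_weight_add_single[of 0 i] by (simp add: seq_weight_def)

lemma remove_one:
  fixes l :: "nat \<Rightarrow>\<^sub>0 nat"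
  assumes "i \<in> Poly_Mapping.keys l"
  shows "l = (l - munit i) + munit i"
  by (rule poly_mapping_eqI)
    (use assms in \<open>auto simp: lookup_add lookup_minus lookup_munit in_keys_iff\<close>)

lemma keys_add_single:
  fixes l :: "nat \<Rightarrow>\<^sub>0 nat"
  shows "Poly_Mapping.keys (l + munit i) = insert i (Poly_Mapping.keys l)"
  by (auto simp: in_keys_iff lookup_add lookup_munit split: if_splits)

locale heisenberg =
  fixes W :: "'w heisenberg_module"
  assumes heisenberg: "heisenberg_module W"
begin

sublocale rat_vs W
  using heisenberg by (intro rat_vs.intro) (simp add: heisenberg_module_def)

abbreviation "A k \<equiv> heis_H W (- int k)"

lemma H_linear: "i \<noteq> 0 \<Longrightarrow> linear_map W W (heis_H W i)"
  using heisenberg by (simp add: heisenberg_module_def)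

lemma H_in: "i \<noteq> 0 \<Longrightarrow> x \<in> carrier W \<Longrightarrow> heis_H W i x \<in> carrier W"
  using linear_mapD(1)[OF H_linear] .

lemma H_comm:
  assumes "i \<noteq> 0" "j \<noteq> 0" "x \<in> carrier W"
  shows "heis_H W i (heis_H W j x) = heis_H W j (heis_H W i x) \<oplus>\<^bsub>W\<^esub>
    (if i = - j then rat_of_int i else 0) \<odot>\<^bsub>W\<^esub> x"
proof -
  let ?a = "heis_H W i (heis_H W j x)" and ?b = "heis_H W j (heis_H W i x)"
  have ab: "?a \<in> carrier W" "?b \<in> carrier W" using assms H_in by auto
  have "?a \<oplus>\<^bsub>W\<^esub> (-1) \<odot>\<^bsub>W\<^esub> ?b = (if i = - j then rat_of_int i \<odot>\<^bsub>W\<^esub> x else \<zero>\<^bsub>W\<^esub>)"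
    using heisenberg assms ab by (simp add: heisenberg_module_def flip: minus_eq)
  then have "?b \<oplus>\<^bsub>W\<^esub> (?a \<oplus>\<^bsub>W\<^esub> (-1) \<odot>\<^bsub>W\<^esub> ?b) = ?b \<oplus>\<^bsub>W\<^esub> (if i = - j then rat_of_int i \<odot>\<^bsub>W\<^esub> x else \<zero>\<^bsub>W\<^esub>)"
    by simp
  moreover have "?b \<oplus>\<^bsub>W\<^esub> (?a \<oplus>\<^bsub>W\<^esub> (-1) \<odot>\<^bsub>W\<^esub> ?b) = ?a"
    using ab by (simp add: add_ac(3)[of ?b ?a] add_collect1)
  ultimately show ?thesis using assms(3) by (auto split: if_splits)
qed

lemma A_comm: "i > 0 \<Longrightarrow> k > 0 \<Longrightarrow> x \<in> carrier W \<Longrightarrow> A i (A k x) = A k (A i x)"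
  using H_comm[of "- int i" "- int k" x] H_in by simp

lemma A_in: "k > 0 \<Longrightarrow> x \<in> carrier W \<Longrightarrow> A k x \<in> carrier W"
  by (rule H_in) simp_all

lemma A_zero: "k > 0 \<Longrightarrow> A k \<zero>\<^bsub>W\<^esub> = \<zero>\<^bsub>W\<^esub>"
  using linear_map_zero[OF H_linear vector_space vector_space, of "- int k"] by simp

lemma A_pow_in: "k > 0 \<Longrightarrow> x \<in> carrier W \<Longrightarrow> (A k ^^ n) x \<in> carrier W"
  by (induction n) (simp_all add: A_in)

lemma A_pow_comm: "i > 0 \<Longrightarrow> k > 0 \<Longrightarrow> x \<in> carrier W \<Longrightarrow> (A k ^^ n) (A i x) = A i ((A k ^^ n) x)"
proof (induction n)
  case (Suc n)
  then show ?case using A_comm[of k i "(A k ^^ n) x"] A_pow_in[of k x n] by simp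
qed simp

lemma word_in: "0 \<notin> set ks \<Longrightarrow> x \<in> carrier W \<Longrightarrow> heis_word W l ks x \<in> carrier W"
  by (induction ks) (auto simp: A_pow_in)

lemma word_comm:
  "0 \<notin> set ks \<Longrightarrow> i > 0 \<Longrightarrow> x \<in> carrier W \<Longrightarrow> heis_word W l ks (A i x) = A i (heis_word W l ks x)"
  by (induction ks) (auto simp: A_pow_comm word_in)

lemma word_cong:
  "(\<And>k. k \<in> set ks \<Longrightarrow> Poly_Mapping.lookup l k = Poly_Mapping.lookup l' k) \<Longrightarrow>
     heis_word W l ks x = heis_word W l' ks x"
  by (induction ks) auto

lemma word_add_single:
  "0 \<notin> set ks \<Longrightarrow> distinct ks \<Longrightarrow> i \<in> set ks \<Longrightarrow> x \<in> carrier W \<Longrightarrow>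
     heis_word W (l + munit i) ks x = A i (heis_word W l ks x)"
proof (induction ks)
  case (Cons k ks)
  show ?case
  proof (cases "k = i")
    case True
    have "heis_word W (l + munit i) ks x = heis_word W l ks x"
      by (rule word_cong) (use Cons.prems True in \<open>auto simp: lookup_add lookup_munit\<close>)
    then show ?thesis using True by (simp add: lookup_add lookup_munit)
  next
    case False
    then have "heis_word W (l + munit i) ks x = A i (heis_word W l ks x)"
      using Cons by auto
    moreover have "i > 0" "k > 0" using Cons.prems by (metis gr0I, simp)
    ultimately show ?thesis using False Cons.prems
      by (simp add: lookup_add lookup_munit A_pow_comm word_in)
  qed
qed simp

lemma word_insort:
  "Poly_Mapping.lookup l i = 0 \<Longrightarrow> heis_word W l (insort i ks) x = heis_word W l ks x"
  by (induction ks) auto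

text \<open>The operators \<open>H\<^bsub>-k\<^esub>\<close> with \<open>k > 0\<close> commute, so the additional factor can be moved to the front.\<close>

lemma neg_add_single:
  assumes "0 \<notin> Poly_Mapping.keys l" "i > 0" "x \<in> carrier W"
  shows "heis_neg W (l + munit i) x = A i (heis_neg W l x)"
proof -
  let ?ks = "sorted_list_of_set (insert i (Poly_Mapping.keys l))"
  have "heis_neg W (l + munit i) x = A i (heis_word W l ?ks x)"
    unfolding heis_neg_eq_word keys_add_single by (rule word_add_single)
      (use assms in \<open>auto simp del: sorted_list_of_set_insert_remove\<close>)
  also have "heis_word W l ?ks x = heis_neg W l x"
  proof (cases "i \<in> Poly_Mapping.keys l")
    case True
    then show ?thesis by (simp add: heis_neg_eq_word insert_absorb)
  next
    case False
    then have "Poly_Mapping.lookup l i = 0" by (simp add: in_keys_iff)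
    then show ?thesis using False by (simp add: heis_neg_eq_word word_insort)
  qed
  finally show ?thesis .
qed

lemma neg_comm:
  assumes "0 \<notin> Poly_Mapping.keys l" "i > 0" "x \<in> carrier W"
  shows "heis_neg W l (A i x) = A i (heis_neg W l x)"
  unfolding heis_neg_eq_word by (rule word_comm) (use assms in auto)

lemma neg_zero_arg:
  assumes "0 \<notin> Poly_Mapping.keys l"
  shows "heis_neg W l \<zero>\<^bsub>W\<^esub> = \<zero>\<^bsub>W\<^esub>"
proof -
  have pow: "(A k ^^ n) \<zero>\<^bsub>W\<^esub> = \<zero>\<^bsub>W\<^esub>" if "k > 0" for k n by (induction n) (simp_all add: A_zero that)
  have "heis_word W l ks \<zero>\<^bsub>W\<^esub> = \<zero>\<^bsub>W\<^esub>" if "0 \<notin> set ks" for ks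
    using that by (induction ks) (auto simp: pow)
  then show ?thesis using assms by (simp add: heis_neg_eq_word)
qed

text \<open>Up to the order of its factors a word of length \<open>n\<close> is some \<open>H\<^bsub>-\<lambda>\<^esub>\<close> with \<open>|\<lambda>| \<ge> n\<close>.\<close>

lemma qnil_of_bound:
  assumes x: "x \<in> carrier W"
    and N: "\<And>l. 0 \<notin> Poly_Mapping.keys l \<Longrightarrow> seq_weight l > N \<Longrightarrow> heis_neg W l x = \<zero>\<^bsub>W\<^esub>"
  shows "qnil W (he_Q W) (Suc N) x"
proof -
  have "qnil W (he_Q W) n (heis_neg W l x)" if "0 \<notin> Poly_Mapping.keys l" "n + seq_weight l > N" for n l
    using that
  proof (induction n arbitrary: l)
    case 0
    then show ?case using N by simp
  next
    case (Suc n)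
    have "qnil W (he_Q W) n (heis_neg W (l + munit (Suc i)) x)" for i
      by (rule Suc.IH) (use Suc.prems in \<open>auto simp: seq_weight_add_single keys_add_single\<close>)
    then show ?case using neg_add_single[OF Suc.prems(1) _ x] by simp
  qed
  from this[of 0 "Suc N"] show ?thesis by (simp add: seq_weight_def del: qnil.simps)
qed

text \<open>If \<open>|\<lambda>| > n b\<close> then \<open>\<lambda>\<close> has a part larger than \<open>b\<close> or more than \<open>n\<close> parts; in either case
  \<open>H\<^bsub>-\<lambda>\<^esub>\<close> kills \<open>x\<close>.  The operator with shifted index \<open>m\<close> is \<open>H\<^bsub>-(m+1)\<^esub>\<close>, so the parts larger than \<open>b\<close>
  are those with \<open>m \<ge> b\<close>.\<close>

lemma bound_of_qnil:
  assumes "x \<in> carrier W" "qnil W (he_Q W) n x" "\<forall>m\<ge>b. he_Q W m x = \<zero>\<^bsub>W\<^esub>"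
    "0 \<notin> Poly_Mapping.keys l" "seq_weight l > n * b"
  shows "heis_neg W l x = \<zero>\<^bsub>W\<^esub>"
  using assms
proof (induction n arbitrary: x l)
  case 0
  then show ?case using neg_zero_arg by simp
next
  case (Suc n)
  have "Poly_Mapping.keys l \<noteq> {}" using Suc.prems(5) by (auto simp: seq_weight_def)
  then obtain i where i: "i \<in> Poly_Mapping.keys l" by blast
  then have i0: "i > 0" using Suc.prems(4) by (metis gr0I)
  then obtain k where k: "i = Suc k" using gr0_implies_Suc by blast
  define l' where "l' = l - munit i"
  have l: "l = l' + munit i" unfolding l'_def by (rule remove_one[OF i])
  have l0: "0 \<notin> Poly_Mapping.keys l'" using Suc.prems(4) unfolding l keys_add_single by simp
  have split: "heis_neg W l x = heis_neg W l' (A i x)"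
    unfolding l using neg_add_single[OF l0 i0] neg_comm[OF l0 i0] Suc.prems(1) by simp
  show ?case
  proof (cases "k \<ge> b")
    case True
    then have "A i x = \<zero>\<^bsub>W\<^esub>" using Suc.prems(3) k by blast
    then show ?thesis using split neg_zero_arg[OF l0] by simp
  next
    case False
    have "heis_neg W l' (A i x) = \<zero>\<^bsub>W\<^esub>"
    proof (rule Suc.IH)
      show "A i x \<in> carrier W" by (rule A_in[OF i0 Suc.prems(1)])
      show "qnil W (he_Q W) n (A i x)" using Suc.prems(2) k by simp
      show "\<forall>m\<ge>b. he_Q W m (A i x) = \<zero>\<^bsub>W\<^esub>"
      proof (intro allI impI)
        fix m assume "m \<ge> b"
        then have "A (Suc m) x = \<zero>\<^bsub>W\<^esub>" using Suc.prems(3) by blast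
        then show "he_Q W m (A i x) = \<zero>\<^bsub>W\<^esub>"
          using A_comm[OF _ i0 Suc.prems(1), of "Suc m"] A_zero[OF i0] by simp
      qed
      show "seq_weight l' > n * b"
        using Suc.prems(5) False k unfolding l seq_weight_add_single by simp
    qed (rule l0)
    then show ?thesis using split by simp
  qed
qed

lemma ladder_of_locally_nilpotent:
  assumes "\<And>x. x \<in> carrier W \<Longrightarrow> \<exists>b. \<forall>m\<ge>b. he_Q W m x = \<zero>\<^bsub>W\<^esub>"
    and "\<And>x. x \<in> carrier W \<Longrightarrow> \<exists>n. qnil W (he_Q W) n x"
  shows "ladder W (he_P W) (he_Q W) 1 (\<lambda>i. - of_nat (Suc i))"
proof (intro ladder.intro ladder_axioms.intro lowering.intro lowering_axioms.intro)
  fix x assume x: "x \<in> carrier W"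
  show "he_P W i (he_P W j x) = 1 \<odot>\<^bsub>W\<^esub> he_P W j (he_P W i x)" for i j
    using H_comm[of "int (Suc i)" "int (Suc j)" x] H_in x by simp
  show "he_Q W i (he_Q W j x) = 1 \<odot>\<^bsub>W\<^esub> he_Q W j (he_Q W i x)" for i j
    using H_comm[of "- int (Suc i)" "- int (Suc j)" x] H_in x by simp
  show "he_Q W i (he_P W j x) = 1 \<odot>\<^bsub>W\<^esub> he_P W j (he_Q W i x) \<oplus>\<^bsub>W\<^esub>
      (if i = j then - of_nat (Suc i) else 0) \<odot>\<^bsub>W\<^esub> x" for i j
    using H_comm[of "- int (Suc i)" "int (Suc j)" x] H_in x by (auto simp del: of_nat_Suc)
  show "\<exists>b. \<forall>m\<ge>b. he_Q W m x = \<zero>\<^bsub>W\<^esub>" "\<exists>n. qnil W (he_Q W) n x" using assms x by auto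
next
  show "- of_nat (Suc i) \<noteq> (0 :: rat)" for i by (metis neg_equal_0_iff_equal of_nat_Suc of_nat_neq_0)
  show "rat_vs W" by (rule rat_vs_axioms)
qed (auto intro: H_linear)

end

lemma admissible_heisenberg_ladder:
  assumes W: "admissible_heisenberg_module W"
  shows "ladder W (he_P W) (he_Q W) 1 (\<lambda>i. - of_nat (Suc i))"
proof -
  interpret heisenberg W using W by unfold_locales (simp add: admissible_heisenberg_module_def)
  have bound: "\<exists>N. \<forall>l. 0 \<notin> Poly_Mapping.keys l \<longrightarrow> seq_weight l > N \<longrightarrow> heis_neg W l x = \<zero>\<^bsub>W\<^esub>"
    if "x \<in> carrier W" for x
    using W that unfolding admissible_heisenberg_module_def by blast
  show ?thesis
  proof (rule ladder_of_locally_nilpotent)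
    fix x assume x: "x \<in> carrier W"
    obtain N where N: "\<forall>l. 0 \<notin> Poly_Mapping.keys l \<longrightarrow> seq_weight l > N \<longrightarrow> heis_neg W l x = \<zero>\<^bsub>W\<^esub>"
      using bound[OF x] by blast
    then show "\<exists>n. qnil W (he_Q W) n x" using qnil_of_bound[OF x] by blast
    have "he_Q W m x = \<zero>\<^bsub>W\<^esub>" if "m \<ge> N" for m
    proof -
      have "heis_neg W (0 + munit (Suc m)) x = he_Q W m x"
        by (subst neg_add_single) (simp_all add: x)
      moreover have "heis_neg W (0 + munit (Suc m)) x = \<zero>\<^bsub>W\<^esub>"
        using N[rule_format, of "0 + munit (Suc m)"] that seq_weight_single[of "Suc m"]
        by (simp add: keys_munit)
      ultimately show ?thesis by simp
    qed
    then show "\<exists>b. \<forall>m\<ge>b. he_Q W m x = \<zero>\<^bsub>W\<^esub>" by blast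
  qed
qed

lemma admissible_heisenberg_of_ladder:
  assumes h: "heisenberg_module W" and l: "ladder W (he_P W) (he_Q W) \<epsilon> \<kappa>"
  shows "admissible_heisenberg_module W"
proof -
  interpret heisenberg W by unfold_locales (rule h)
  interpret L: ladder W "he_P W" "he_Q W" \<epsilon> \<kappa> by (rule l)
  have "\<exists>N>0. \<forall>l. 0 \<notin> Poly_Mapping.keys l \<longrightarrow> seq_weight l > N \<longrightarrow> heis_neg W l x = \<zero>\<^bsub>W\<^esub>"
    if x: "x \<in> carrier W" for x
  proof -
    obtain n where n: "qnil W (he_Q W) n x" using L.Q_nilpotent[OF x] by blast
    obtain b where b: "\<forall>m\<ge>b. he_Q W m x = \<zero>\<^bsub>W\<^esub>" using L.Q_finite[OF x] by blast
    show ?thesis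
      by (rule exI[of _ "Suc (n * b)"]) (auto intro: bound_of_qnil[OF x n b])
  qed
  then show ?thesis using h by (simp add: admissible_heisenberg_module_def)
qed

lemma int_cases_nonzero:
  fixes i :: int
  assumes "i \<noteq> 0"
  obtains k where "i = int (Suc k)" | k where "i = - int (Suc k)"
proof (cases "i > 0")
  case True
  then have "i = int (Suc (nat i - 1))" by simp
  then show thesis by (rule that(1))
next
  case False
  then have "i = - int (Suc (nat (- i) - 1))" using assms by simp
  then show thesis by (rule that(2))
qed

lemma heisenberg_hom_iff:
  "f \<in> heisenberg_homs W W' \<longleftrightarrow> f \<in> extensional (carrier W) \<and>
    ladder_hom W (he_P W) (he_Q W) W' (he_P W') (he_Q W') f"
proof
  assume f: "f \<in> extensional (carrier W) \<and> ladder_hom W (he_P W) (he_Q W) W' (he_P W') (he_Q W') f"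
  have "f (heis_H W i x) = heis_H W' i (f x)" if i: "i \<noteq> 0" and x: "x \<in> carrier W" for i x
    using i by (cases rule: int_cases_nonzero) (use f ladder_homD(2,3) x in metis)+
  then show "f \<in> heisenberg_homs W W'"
    using f by (simp add: heisenberg_homs_def linear_maps_def ladder_hom_def)
qed (auto simp: heisenberg_homs_def linear_maps_def ladder_hom_def)

section \<open>The bosonic Fock space\<close>

abbreviation "bmon \<equiv> {m :: nat \<Rightarrow>\<^sub>0 nat. 0 \<notin> Poly_Mapping.keys m}"

lemma lookup_boson_var_mult:
  "Poly_Mapping.lookup (boson_var k * p) m =
     (if k \<in> Poly_Mapping.keys m then Poly_Mapping.lookup p (m - munit k) else 0)"
proof -
  let ?d = "munit k"
  have "Poly_Mapping.lookup (boson_var k * p) m = Sum_any (\<lambda>q. Poly_Mapping.lookup p q when m = ?d + q)"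
    unfolding boson_var_def munit_def[symmetric] lookup_mult by (simp add: lookup_single when_mult)
  also have "\<dots> = (if k \<in> Poly_Mapping.keys m then Poly_Mapping.lookup p (m - ?d) else 0)"
  proof (cases "k \<in> Poly_Mapping.keys m")
    case True
    have "m = ?d + q \<longleftrightarrow> q = m - ?d" for q using remove_one[OF True] by (metis add.commute add_diff_cancel_left')
    then show ?thesis using True by simp
  next
    case False
    have "m \<noteq> ?d + q" for q using False keys_add_single[of q k] by (metis add.commute insertI1)
    then show ?thesis using False by simp
  qed
  finally show ?thesis .
qed

lemma lookup_boson_deriv:
  "Poly_Mapping.lookup (boson_deriv k p) m =
     of_nat (Suc (Poly_Mapping.lookup m k)) * Poly_Mapping.lookup p (m + munit k)"
proof -
  let ?d = "munit k"
  have "Poly_Mapping.lookup (boson_deriv k p) m = (\<Sum>n\<in>Poly_Mapping.keys p.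
      if n = m + ?d then of_nat (Poly_Mapping.lookup n k) * Poly_Mapping.lookup p n else 0)"
    unfolding boson_deriv_def lookup_sum munit_def[symmetric]
  proof (rule sum.cong[OF refl])
    fix n
    show "Poly_Mapping.lookup (Poly_Mapping.single (n - ?d) (of_nat (Poly_Mapping.lookup n k) * Poly_Mapping.lookup p n)) m
      = (if n = m + ?d then of_nat (Poly_Mapping.lookup n k) * Poly_Mapping.lookup p n else 0)"
    proof (cases "k \<in> Poly_Mapping.keys n")
      case True
      have "n - ?d = m \<longleftrightarrow> n = m + ?d" using remove_one[OF True] by (metis add_diff_cancel_right')
      then show ?thesis by (simp add: lookup_single when_def)
    next
      case False
      then have "of_nat (Poly_Mapping.lookup n k) * Poly_Mapping.lookup p n = 0" by (simp add: in_keys_iff)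
      then show ?thesis by (simp only: single_zero lookup_zero if_cancel)
    qed
  qed
  also have "\<dots> = of_nat (Suc (Poly_Mapping.lookup m k)) * Poly_Mapping.lookup p (m + ?d)"
    by (auto simp: in_keys_iff lookup_add lookup_munit)
  finally show ?thesis .
qed

abbreviation "Bk \<equiv> bosonic_fock_space"

lemma bosonic_sel [simp]:
  "carrier Bk = {p. Poly_Mapping.keys p \<subseteq> bmon}"
  "\<zero>\<^bsub>Bk\<^esub> = 0" "x \<oplus>\<^bsub>Bk\<^esub> y = x + y" "c \<odot>\<^bsub>Bk\<^esub> x = pm_scale c x"
  by (auto simp: bosonic_fock_space_def)

lemma lookup_bosonic_H:
  "Poly_Mapping.lookup (he_P Bk i p) m =
     (if Suc i \<in> Poly_Mapping.keys m then Poly_Mapping.lookup p (m - munit (Suc i)) else 0)"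
  "Poly_Mapping.lookup (he_Q Bk i p) m =
     - of_nat (Suc i) * of_nat (Suc (Poly_Mapping.lookup m (Suc i))) *
       Poly_Mapping.lookup p (m + munit (Suc i))"
  unfolding bosonic_fock_space_def
  by (simp_all add: lookup_boson_var_mult lookup_boson_deriv nat_add_distrib del: of_nat_Suc)

lemma bosonic_vector_space: "rat_vector_space Bk"
  by (rule rat_vector_space_image(1)[OF free_space_vector_space, of _ "\<lambda>x. x" bmon]) simp_all

lemma bosonic_lookup_zero:
  assumes "f \<in> carrier Bk" "m \<notin> bmon"
  shows "Poly_Mapping.lookup f m = 0"
  using assms by (auto simp: in_keys_iff subset_iff)

lemma bosonic_inI:
  assumes "\<And>m. m \<notin> bmon \<Longrightarrow> Poly_Mapping.lookup f m = 0"
  shows "f \<in> carrier Bk"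
  using assms by (force simp: in_keys_iff subset_iff)

lemma bosonic_P_linear: "linear_map Bk Bk (he_P Bk i)"
  unfolding linear_map_def
proof (intro conjI ballI allI funcsetI)
  fix f assume f: "f \<in> carrier Bk"
  show "he_P Bk i f \<in> carrier Bk"
  proof (rule bosonic_inI)
    fix m :: "nat \<Rightarrow>\<^sub>0 nat" assume "m \<notin> bmon"
    then have "m - munit (Suc i) \<notin> bmon"
      by (simp add: in_keys_iff lookup_minus lookup_munit)
    then show "Poly_Mapping.lookup (he_P Bk i f) m = 0"
      unfolding lookup_bosonic_H using bosonic_lookup_zero[OF f] by simp
  qed
qed (auto intro!: poly_mapping_eqI simp: lookup_bosonic_H lookup_add simp del: of_nat_Suc)

lemma bosonic_Q_linear: "linear_map Bk Bk (he_Q Bk i)"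
  unfolding linear_map_def
proof (intro conjI ballI allI funcsetI)
  fix f assume f: "f \<in> carrier Bk"
  show "he_Q Bk i f \<in> carrier Bk"
  proof (rule bosonic_inI)
    fix m :: "nat \<Rightarrow>\<^sub>0 nat" assume "m \<notin> bmon"
    then have "m + munit (Suc i) \<notin> bmon" by (simp add: keys_add_single)
    then show "Poly_Mapping.lookup (he_Q Bk i f) m = 0"
      unfolding lookup_bosonic_H using bosonic_lookup_zero[OF f] by simp
  qed
qed (auto intro!: poly_mapping_eqI simp: lookup_bosonic_H lookup_add distrib_left simp del: of_nat_Suc)

lemma bosonic_PP: "he_P Bk i (he_P Bk j f) = he_P Bk j (he_P Bk i f)"
  by (simp add: bosonic_fock_space_def mult.left_commute del: of_nat_Suc)

lemma bosonic_QQ: "he_Q Bk i (he_Q Bk j f) = he_Q Bk j (he_Q Bk i f)"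
proof (rule poly_mapping_eqI)
  fix m
  have "m + munit (Suc i) + munit (Suc j) =
      m + munit (Suc j) + munit (Suc i)"
    by (simp add: ac_simps)
  then show "Poly_Mapping.lookup (he_Q Bk i (he_Q Bk j f)) m = Poly_Mapping.lookup (he_Q Bk j (he_Q Bk i f)) m"
    by (cases "i = j") (simp_all add: lookup_bosonic_H lookup_add lookup_munit del: of_nat_Suc)
qed

text \<open>The product rule, in coordinates: for \<open>i = j\<close> the exponent of the variable differs by one
  on the two sides, and \<open>- (i + 1)\<close> times this difference is the commutator.\<close>

lemma bosonic_QP:
  "he_Q Bk i (he_P Bk j f) = he_P Bk j (he_Q Bk i f) + pm_scale (if i = j then - of_nat (Suc i) else 0) f"
proof (rule poly_mapping_eqI)
  fix m :: "nat \<Rightarrow>\<^sub>0 nat"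
  let ?i = "munit (Suc i)" and ?j = "munit (Suc j)"
  show "Poly_Mapping.lookup (he_Q Bk i (he_P Bk j f)) m =
      Poly_Mapping.lookup (he_P Bk j (he_Q Bk i f) + pm_scale (if i = j then - of_nat (Suc i) else 0) f) m"
  proof (cases "Suc j \<in> Poly_Mapping.keys m")
    case True
    have m: "m - ?j + ?j = m" using remove_one[OF True] by simp
    have swap: "m + ?i - ?j = m - ?j + ?i"
      by (rule poly_mapping_eqI) (use True in \<open>auto simp: lookup_add lookup_minus lookup_munit in_keys_iff\<close>)
    have dec: "(of_nat (Poly_Mapping.lookup m (Suc j)) :: rat) = of_nat (Poly_Mapping.lookup (m - ?j) (Suc j)) + 1"
      using arg_cong[OF m, of "\<lambda>m. of_nat (Poly_Mapping.lookup m (Suc j)) :: rat"]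
      by (simp add: lookup_add lookup_munit)
    show ?thesis
    proof (cases "i = j")
      case ij: True
      show ?thesis
        unfolding lookup_add lookup_bosonic_H
        using True m dec ij by (simp add: lookup_add lookup_munit keys_add_single algebra_simps)
    next
      case False
      have "Poly_Mapping.lookup (m - ?j) (Suc i) = Poly_Mapping.lookup m (Suc i)"
        using False by (simp add: lookup_minus lookup_munit)
      then show ?thesis
        using True False swap by (simp add: lookup_bosonic_H lookup_add keys_add_single del: of_nat_Suc)
    qed
  next
    case False
    then have "Poly_Mapping.lookup m (Suc j) = 0" by (simp add: in_keys_iff)
    then show ?thesis using False
      by (cases "i = j") (auto simp: lookup_bosonic_H lookup_add keys_add_single simp del: of_nat_Suc)
  qed
qed

text \<open>Differentiation with respect to any variable lowers the weight.\<close>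

lemma bosonic_nilpotent:
  assumes "f \<in> carrier Bk" "\<And>m. m \<in> Poly_Mapping.keys f \<Longrightarrow> seq_weight m < n"
  shows "qnil Bk (he_Q Bk) n f"
  using assms
proof (induction n arbitrary: f)
  case 0
  then have "Poly_Mapping.keys f = {}" by blast
  then show ?case by simp
next
  case (Suc n)
  have "qnil Bk (he_Q Bk) n (he_Q Bk i f)" for i
  proof (rule Suc.IH)
    show "he_Q Bk i f \<in> carrier Bk" by (rule linear_mapD(1)[OF bosonic_Q_linear Suc.prems(1)])
    fix m assume "m \<in> Poly_Mapping.keys (he_Q Bk i f)"
    then have "Poly_Mapping.lookup f (m + munit (Suc i)) \<noteq> 0"
      unfolding in_keys_iff lookup_bosonic_H by auto
    then show "seq_weight m < n"
      using Suc.prems(2)[of "m + munit (Suc i)"] by (simp add: in_keys_iff seq_weight_add_single)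
  qed
  then show ?case by simp
qed

lemma bosonic_ladder: "ladder Bk (he_P Bk) (he_Q Bk) 1 (\<lambda>i. - of_nat (Suc i))"
proof (intro ladder.intro lowering.intro rat_vs.intro ladder_axioms.intro lowering_axioms.intro)
  fix f assume f: "f \<in> carrier Bk"
  have fin: "finite (\<Union>(Poly_Mapping.keys ` Poly_Mapping.keys f))" by auto
  then obtain b where b: "\<forall>i\<in>\<Union>(Poly_Mapping.keys ` Poly_Mapping.keys f). i < b"
    using finite_nat_set_iff_bounded by blast
  show "\<exists>b. \<forall>m\<ge>b. he_Q Bk m f = \<zero>\<^bsub>Bk\<^esub>"
  proof (intro exI allI impI)
    fix k assume k: "k \<ge> b"
    have "Poly_Mapping.lookup f (m + munit (Suc k)) = 0" for m
    proof (rule ccontr)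
      assume "Poly_Mapping.lookup f (m + munit (Suc k)) \<noteq> 0"
      then have "m + munit (Suc k) \<in> Poly_Mapping.keys f" by (simp add: in_keys_iff)
      moreover have "Suc k \<in> Poly_Mapping.keys (m + munit (Suc k))"
        by (simp add: keys_add_single)
      ultimately have "Suc k < b" using b by blast
      then show False using k by simp
    qed
    then show "he_Q Bk k f = \<zero>\<^bsub>Bk\<^esub>"
      by (intro poly_mapping_eqI) (simp add: lookup_bosonic_H del: of_nat_Suc)
  qed
  have "finite (seq_weight ` Poly_Mapping.keys f)" by simp
  then obtain n where "\<forall>k\<in>seq_weight ` Poly_Mapping.keys f. k < n"
    using finite_nat_set_iff_bounded by blast
  then show "\<exists>n. qnil Bk (he_Q Bk) n f"
    by (intro exI bosonic_nilpotent[OF f]) auto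
  show "he_P Bk i (he_P Bk j f) = 1 \<odot>\<^bsub>Bk\<^esub> he_P Bk j (he_P Bk i f)" for i j
    unfolding bosonic_sel pm_scale_simps(2) by (rule bosonic_PP)
  show "he_Q Bk i (he_Q Bk j f) = 1 \<odot>\<^bsub>Bk\<^esub> he_Q Bk j (he_Q Bk i f)" for i j
    unfolding bosonic_sel pm_scale_simps(2) by (rule bosonic_QQ)
  show "he_Q Bk i (he_P Bk j f) = 1 \<odot>\<^bsub>Bk\<^esub> he_P Bk j (he_Q Bk i f) \<oplus>\<^bsub>Bk\<^esub>
      (if i = j then - of_nat (Suc i) else 0) \<odot>\<^bsub>Bk\<^esub> f" for i j
    unfolding bosonic_sel pm_scale_simps(2) by (rule bosonic_QP)
next
  show "- of_nat (Suc i) \<noteq> (0 :: rat)" for i by (metis neg_equal_0_iff_equal of_nat_Suc of_nat_neq_0)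
qed (rule bosonic_vector_space bosonic_P_linear bosonic_Q_linear | simp)+

interpretation bos: ladder Bk "he_P Bk" "he_Q Bk" 1 "\<lambda>i. - of_nat (Suc i)"
  by (rule bosonic_ladder)

abbreviation bvac :: boson where
  "bvac \<equiv> Poly_Mapping.single 0 1"

lemma bvac_in_vac: "bvac \<in> bos.vac"
proof -
  have "he_Q Bk i bvac = 0" for i
  proof (rule poly_mapping_eqI)
    fix m :: "nat \<Rightarrow>\<^sub>0 nat"
    have "m + munit (Suc i) \<noteq> 0"
      using keys_add_single[of m "Suc i"] by (metis insert_not_empty keys_zero)
    then show "Poly_Mapping.lookup (he_Q Bk i bvac) m = Poly_Mapping.lookup 0 m"
      by (simp add: lookup_bosonic_H lookup_one del: of_nat_Suc)
  qed
  then show ?thesis unfolding bos.vac_def by simp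
qed

text \<open>The coefficient of \<open>f\<close> at \<open>m \<noteq> 0\<close> is a nonzero rational multiple of a coefficient of the derivative of
  \<open>f\<close> by any variable that occurs in \<open>m\<close>.\<close>

lemma bosonic_vac: "bos.vac \<subseteq> range (\<lambda>c. c \<odot>\<^bsub>Bk\<^esub> bvac)"
proof
  fix f assume f: "f \<in> bos.vac"
  have "Poly_Mapping.lookup f m = 0" if ne: "m \<noteq> 0" for m
  proof (cases "m \<in> bmon")
    case True
    have "Poly_Mapping.keys m \<noteq> {}" using ne by simp
    then obtain i where i: "i \<in> Poly_Mapping.keys m" by blast
    then have "i \<noteq> 0" using True by (metis mem_Collect_eq)
    then obtain k where k: "i = Suc k" using not0_implies_Suc by blast
    have "Poly_Mapping.lookup (he_Q Bk k f) (m - munit i) = 0"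
      using bos.vacD(2)[OF f, of k] by simp
    then show ?thesis
      unfolding lookup_bosonic_H using remove_one[OF i] k by (simp del: of_nat_Suc)
  next
    case False
    then show ?thesis using bosonic_lookup_zero bos.vacD(1)[OF f] by blast
  qed
  then have "f = pm_scale (Poly_Mapping.lookup f 0) bvac"
    by (intro poly_mapping_eqI) (auto simp: lookup_one when_def)
  then show "f \<in> range (\<lambda>c. c \<odot>\<^bsub>Bk\<^esub> bvac)" by auto
qed

lemma heisenberg_tensor_sel [simp]:
  "carrier (heisenberg_tensor W V) = carrier (tensor_prod W V)"
  "\<zero>\<^bsub>heisenberg_tensor W V\<^esub> = \<zero>\<^bsub>tensor_prod W V\<^esub>"
  "add (heisenberg_tensor W V) = add (tensor_prod W V)"
  "smult (heisenberg_tensor W V) = smult (tensor_prod W V)"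
  "heis_H (heisenberg_tensor W V) = (\<lambda>i. tensor_map W V W V (heis_H W i) id)"
  by (simp_all add: heisenberg_tensor_def module.defs heisenberg_module.defs)

lemma ladder_same_space:
  assumes l: "ladder T P Q \<epsilon> \<kappa>"
    and same: "carrier W = carrier T" "\<zero>\<^bsub>W\<^esub> = \<zero>\<^bsub>T\<^esub>" "add W = add T" "smult W = smult T"
  shows "ladder W P Q \<epsilon> \<kappa>"
proof -
  interpret T: ladder T P Q \<epsilon> \<kappa> by (rule l)
  have lin: "linear_map W W f \<longleftrightarrow> linear_map T T f" for f by (simp add: linear_map_def same)
  have nil: "qnil W Q n x = qnil T Q n x" for n x by (induction n arbitrary: x) (simp_all add: same)
  show ?thesis
  proof (intro ladder.intro lowering.intro rat_vs.intro ladder_axioms.intro lowering_axioms.intro)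
    show "rat_vector_space W"
      by (rule rat_vector_space_cong[of T]) (simp_all add: T.vector_space same)
    fix x i j assume "x \<in> carrier W"
    then have x: "x \<in> carrier T" by (simp add: same)
    show "P i (P j x) = \<epsilon> \<odot>\<^bsub>W\<^esub> P j (P i x)" unfolding same by (rule T.PP[OF x])
    show "Q i (Q j x) = \<epsilon> \<odot>\<^bsub>W\<^esub> Q j (Q i x)" unfolding same by (rule T.QQ[OF x])
    show "Q i (P j x) = \<epsilon> \<odot>\<^bsub>W\<^esub> P j (Q i x) \<oplus>\<^bsub>W\<^esub> (if i = j then \<kappa> i else 0) \<odot>\<^bsub>W\<^esub> x"
      unfolding same by (rule T.QP[OF x])
    show "\<exists>b. \<forall>m\<ge>b. Q m x = \<zero>\<^bsub>W\<^esub>" unfolding same by (rule T.Q_finite[OF x])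
    show "\<exists>n. qnil W Q n x" unfolding nil by (rule T.Q_nilpotent[OF x])
  qed (simp_all add: lin T.P_linear T.Q_linear)
qed

text \<open>For each choice of signs of \<open>i\<close> and \<open>j\<close>, the commutator of \<open>H\<^sub>i\<close> and \<open>H\<^sub>j\<close> is given by one of the
  three relations of a ladder module, read from right to left when \<open>i > 0 > j\<close>.\<close>

lemma bosonic_tensor_admissible:
  assumes V: "rat_vector_space V"
  shows "admissible_heisenberg_module (heisenberg_tensor Bk V)"
proof -
  interpret BT: ladder_tensor Bk "he_P Bk" "he_Q Bk" 1 "\<lambda>i. - of_nat (Suc i)" V
    by (rule ladder_tensor.intro[OF bosonic_ladder rat_vs.intro[OF V]])
  let ?W = "heisenberg_tensor Bk V"
  have l: "ladder ?W (he_P ?W) (he_Q ?W) 1 (\<lambda>i. - of_nat (Suc i))"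
    using ladder_same_space[OF BT.TL.ladder_axioms, of ?W] by simp
  interpret L: ladder ?W "he_P ?W" "he_Q ?W" 1 "\<lambda>i. - of_nat (Suc i)" by (rule l)
  have "heisenberg_module ?W"
    unfolding heisenberg_module_def
  proof (intro conjI allI impI ballI)
    show "rat_vector_space ?W" by (rule L.vector_space)
    fix i :: int assume i: "i \<noteq> 0"
    show "linear_map ?W ?W (heis_H ?W i)"
      using i by (cases rule: int_cases_nonzero) (use L.P_linear L.Q_linear in metis)+
    fix j :: int and x assume j: "j \<noteq> 0" and x: "x \<in> carrier ?W"
    let ?H = "heis_H ?W"
    have in_W: "?H i y \<in> carrier ?W" if "i \<noteq> 0" "y \<in> carrier ?W" for i y
      using that(1) by (cases rule: int_cases_nonzero) (use L.P_simps(1) L.Q_simps(1) that(2) in metis)+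
    have comm: "?H i (?H j x) = ?H j (?H i x) \<oplus>\<^bsub>?W\<^esub> (if i = - j then rat_of_int i else 0) \<odot>\<^bsub>?W\<^esub> x"
      using i
    proof (cases rule: int_cases_nonzero)
      case (1 a)
      show ?thesis
        using j
      proof (cases rule: int_cases_nonzero)
        case (1 b)
        then show ?thesis
          using L.PP[OF x, of a b] in_W[OF j in_W[OF i x]] x \<open>i = int (Suc a)\<close>
          by (simp del: heisenberg_tensor_sel of_nat_Suc)
      next
        case (2 b)
        then have "?H j (?H i x) = ?H i (?H j x) \<oplus>\<^bsub>?W\<^esub> (if b = a then - of_nat (Suc b) else 0) \<odot>\<^bsub>?W\<^esub> x"
          using L.QP[OF x, of b a] in_W[OF i in_W[OF j x]] \<open>i = int (Suc a)\<close>
          by (simp del: heisenberg_tensor_sel of_nat_Suc)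
        then show ?thesis
          using in_W[OF i in_W[OF j x]] x \<open>i = int (Suc a)\<close> 2
          by (auto simp: L.add_ac(1) L.add_collect simp del: heisenberg_tensor_sel of_nat_Suc)
      qed
    next
      case (2 a)
      show ?thesis
        using j
      proof (cases rule: int_cases_nonzero)
        case (1 b)
        then show ?thesis
          using L.QP[OF x, of a b] in_W[OF j in_W[OF i x]] \<open>i = - int (Suc a)\<close>
          by (auto simp del: heisenberg_tensor_sel of_nat_Suc)
      next
        case (2 b)
        then show ?thesis
          using L.QQ[OF x, of a b] in_W[OF j in_W[OF i x]] x \<open>i = - int (Suc a)\<close>
          by (simp del: heisenberg_tensor_sel of_nat_Suc)
      qed
    qed
    have "?H i (?H j x) \<ominus>\<^bsub>?W\<^esub> ?H j (?H i x) = ?H i (?H j x) \<oplus>\<^bsub>?W\<^esub> (-1) \<odot>\<^bsub>?W\<^esub> ?H j (?H i x)"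
      by (rule L.minus_eq[OF in_W[OF i in_W[OF j x]] in_W[OF j in_W[OF i x]]])
    also have "\<dots> = (if i = - j then rat_of_int i else 0) \<odot>\<^bsub>?W\<^esub> x"
      unfolding comm using L.add_ac(2)[of "?H j (?H i x)"] in_W[OF j in_W[OF i x]] x
      by (simp add: L.add_ac(1) L.add_collect1 del: heisenberg_tensor_sel)
    finally show "?H i (?H j x) \<ominus>\<^bsub>?W\<^esub> ?H j (?H i x) = (if i = - j then rat_of_int i \<odot>\<^bsub>?W\<^esub> x else \<zero>\<^bsub>?W\<^esub>)"
      using x by (simp del: heisenberg_tensor_sel)
  qed
  then show ?thesis using admissible_heisenberg_of_ladder l by blast
qed

lemma countable_bosonic: "countable (carrier Bk)"
proof -
  have "countable {m :: nat \<Rightarrow>\<^sub>0 nat. Poly_Mapping.keys m \<subseteq> UNIV - {0}}"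
    by (rule countable_poly_mappings) simp
  then have "countable bmon" by (rule countable_subset[rotated]) auto
  then show ?thesis by (simp add: countable_poly_mappings)
qed

theorem bosonic_functor_weak_equivalence:
  fixes U :: "'a set"
  assumes U: "infinite U"
  shows "weak_equivalence (vect_cat U :: ((rat, 'a) module, 'a \<Rightarrow> 'a) cat) (admissible_heisenberg_cat U) bosonic_functor"
proof -
  have sel: "Obj (admissible_heisenberg_cat U) = {W. admissible_heisenberg_module W \<and> carrier W \<lesssim> U}"
    "Hom (admissible_heisenberg_cat U) = heisenberg_homs"
    "Id (admissible_heisenberg_cat U) = (\<lambda>W. \<lambda>x\<in>carrier W. x)"
    "Comp (admissible_heisenberg_cat U) = (\<lambda>W W' W'' g f. compose (carrier W) g f)"
    for U :: "'a set"
    by (simp_all add: admissible_heisenberg_cat_def)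
  have fun_sel: "obj_map bosonic_functor V = heisenberg_tensor Bk V"
    "mor_map bosonic_functor V V' f = tensor_map Bk V Bk V' id f"
    for V V' :: "(rat, 'a) module" and f
    by (simp_all add: bosonic_functor_def)
  interpret fock_equivalence Bk "he_P Bk" "he_Q Bk" 1 "\<lambda>i. - of_nat (Suc i)" bvac
    "\<lambda>f. Poly_Mapping.lookup f 0" U "admissible_heisenberg_cat U" he_P he_Q
    "bosonic_functor :: ((rat, 'a) module, _, _, _) cat_functor"
  proof (intro fock_equivalence.intro fock_equivalence_axioms.intro bosonic_ladder bvac_in_vac bosonic_vac)
    fix V :: "(rat, 'a) module" assume V: "rat_vector_space V" "carrier V \<lesssim> U"
    show "obj_map bosonic_functor V \<in> Obj (admissible_heisenberg_cat U)"
      using bosonic_tensor_admissible[OF V(1)] tensor_prod_lepoll[OF U countable_bosonic V(2)]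
      by (simp add: sel fun_sel)
  qed (simp_all add: sel fun_sel lookup_add admissible_heisenberg_ladder heisenberg_hom_iff del: of_nat_Suc)
  show ?thesis by (rule weak_equivalence_F)
qed

section \<open>The two equivalences\<close>

theorem theorem2p21:
  fixes U :: "'a set"
  assumes "infinite U"
  shows
    "abelian_category (vect_cat U :: ((rat, 'a) module, 'a \<Rightarrow> 'a) cat) \<and>
     abelian_category (admissible_clifford_cat U ::
       ((fermion, 'a) tensor clifford_module,
        (fermion, 'a) tensor \<Rightarrow> (fermion, 'a) tensor) cat) \<and>
     abelian_category (admissible_heisenberg_cat U ::
       ((boson, 'a) tensor heisenberg_module,
        (boson, 'a) tensor \<Rightarrow> (boson, 'a) tensor) cat) \<and>
     equivalence_of_categories
       (vect_cat U :: ((rat, 'a) module, 'a \<Rightarrow> 'a) cat)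
       (admissible_clifford_cat U)
       fermionic_functor \<and>
     equivalence_of_categories
       (vect_cat U :: ((rat, 'a) module, 'a \<Rightarrow> 'a) cat)
       (admissible_heisenberg_cat U)
       bosonic_functor"
  using abelian_category_vect_cat[OF assms]
    abelian_category_transfer[OF fermionic_functor_weak_equivalence[OF assms] abelian_category_vect_cat[OF assms]]
    abelian_category_transfer[OF bosonic_functor_weak_equivalence[OF assms] abelian_category_vect_cat[OF assms]]
    weak_equivalence_imp_equivalence[OF fermionic_functor_weak_equivalence[OF assms]]
    weak_equivalence_imp_equivalence[OF bosonic_functor_weak_equivalence[OF assms]]
  by blast

end
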